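(* Let $(X,d)$ be a compact metric space, $\mathbb{G}$ a compact quantum group acting isometrically on it via $\beta:C(X)\to C(X)\otimes C(\mathbb{G})$, and $\mu$ a faithful $\beta$-invariant probability measure on $X$. Let $U$ be the associated unitary representation of $\mathbb{G}$ on $L^2(X)=L^2(X,\mu)$, let $\mathrm{End}_G(L^2(X))\subseteq\mathcal{B}(L^2(X))$ be the von Neumann algebra of intertwiners of $U$, and let $C(O)\subseteq C(X\times X)$ be the orbital algebra of the action, regarded inside $\mathcal{B}(L^2(X))$ via $\rho$, where $(\rho(f)(g))(x)=\int_X f(x,y)g(y)\,\mathrm{d}\mu(y)$. Then the von Neumann closure of $C(O)$ in $\mathcal{B}(L^2(X))$ is $\mathrm{End}_G(L^2(X))$.
   Context: All $C^*$-algebras are unital and tensor products of $C^*$-algebras are minimal. A compact quantum group $\mathbb{G}$ is a unital $C^*$-algebra $C(\mathbb{G})$ with a unital $*$-homomorphism $\Delta:C(\mathbb{G})\to C(\mathbb{G})\otimes C(\mathbb{G})$ such that $(\Delta\otimes\mathrm{id})\Delta=(\mathrm{id}\otimes\Delta)\Delta$ and the linear spans of $\Delta(C(\mathbb{G}))(C(\mathbb{G})\otimes 1)$ and $\Delta(C(\mathbb{G}))(1\otimes C(\mathbb{G}))$ are dense in $C(\mathbb{G})\otimes C(\mathbb{G})$. An action of $\mathbb{G}$ on a compact space $X$ is a unital $*$-homomorphism $\beta:C(X)\to C(X)\otimes C(\mathbb{G})$ with $(\beta\otimes\mathrm{id})\beta=(\mathrm{id}\otimes\Delta)\beta$ and with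 the span of $\beta(C(X))(1\otimes C(\mathbb{G}))$ dense in $C(X)\otimes C(\mathbb{G})$. A faithful (i.e. full support) Borel probability measure $\mu$ is $\beta$-invariant if $(\mu\otimes\mathrm{id})\beta(f)=\mu(f)1$ for all $f\in C(X)$, where $\mu(f)=\int_X f\,\mathrm{d}\mu$. Write $L^2(X)=L^2(X,\mu)$ and $L^2(X\times X)=L^2(X\times X,\mu\boxtimes\mu)$. The associated unitary representation $U\in\mathcal{M}(\mathcal{K}(L^2(X))\otimes C(\mathbb{G}))$ ($\mathcal{K}$ = compact operators, $\mathcal{M}$ = multiplier algebra) is the unitary on the Hilbert $C(\mathbb{G})$-module $L^2(X)\otimes C(\mathbb{G})$ determined by $U(f\otimes a)=\beta(f)(1\otimes a)$, $f\in C(X)$, $a\in C(\mathbb{G})$. An operator $t\in\mathcal{B}(L^2(X))$ is an intertwiner for $U$ if $U(t\otimes1)=(t\otimes1)U$. On $L^2(X)\otimes L^2(X)\otimes C(\mathbb{G})$ let $U_{13},U_{23}$ be $U$ acting on the indicated legs, and put $W=U_{13}U_{23}$, $Z=U_{23}U_{13}$. The action is isometric if $$W(d\otimes 1)=d\otimes 1=Z(d\otimes1),$$ where $d\in C(X\times X)\subset L^2(X\times X)$. Let $\pi^{(2)}:C(X\times X)\to\mathcal{B}(L^2(X\times X))$ be the representation by multiplication operators. The orbital algebra $C(O)$ of the action is the subalgebra of $C(X\times X)$ consisting of the functions $f\in C(X\times X)$ satisfying $$W(\pi^{(2)}(f)\otimes 1)W^*=\pi^{(2)}(f)\otimes 1=Z(\pi^{(2)}(f)\otimes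 1)Z^*.$$ "Von Neumann closure" means closure in the weak operator topology (for a $*$-subalgebra, the same as the weak-$*$ closure). *)

theory Defs
  imports "HOL-Probability.Probability"
begin

section \<open>Complex normed spaces, C*-algebras, Hilbert spaces\<close>

class complex_normed_vector = real_normed_vector +
  fixes scaleC :: "complex \<Rightarrow> 'a \<Rightarrow> 'a" (infixr "*\<^sub>C" 75)
  assumes scaleC_add_right: "c *\<^sub>C (x + y) = c *\<^sub>C x + c *\<^sub>C y"
    and scaleC_add_left: "(c + d) *\<^sub>C x = c *\<^sub>C x + d *\<^sub>C x"
    and scaleC_scaleC: "c *\<^sub>C d *\<^sub>C x = (c * d) *\<^sub>C x"
    and scaleC_of_real: "complex_of_real r *\<^sub>C x = r *\<^sub>R x"
    and norm_scaleC: "norm (c *\<^sub>C x) = cmod c * norm x"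

text \<open>The superclass \<^class>\<open>real_normed_algebra_1\<close> asks for \<open>norm 1 = 1\<close>,
  i.e. it excludes only the zero algebra.\<close>

class cstar_algebra = complex_normed_vector + real_normed_algebra_1 + banach +
  fixes star :: "'a \<Rightarrow> 'a"
  assumes scaleC_mult_left: "(c *\<^sub>C x) * y = c *\<^sub>C (x * y)"
    and scaleC_mult_right: "x * (c *\<^sub>C y) = c *\<^sub>C (x * y)"
    and star_add: "star (x + y) = star x + star y"
    and star_scaleC: "star (c *\<^sub>C x) = cnj c *\<^sub>C star x"
    and star_mult: "star (x * y) = star y * star x"
    and star_star: "star (star x) = x"
    and cstar_identity: "norm (star x * x) = (norm x)\<^sup>2"

text \<open>Inner products are conjugate-linear in the first variable.\<close>

class chilbert_space = complex_normed_vector + banach +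
  fixes cinner :: "'a \<Rightarrow> 'a \<Rightarrow> complex"
  assumes cinner_commute: "cinner y x = cnj (cinner x y)"
    and cinner_add_right: "cinner x (y + z) = cinner x y + cinner x z"
    and cinner_scaleC_right: "cinner x (c *\<^sub>C y) = c * cinner x y"
    and cinner_self: "cinner x x = complex_of_real ((norm x)\<^sup>2)"

instantiation complex :: cstar_algebra
begin

definition scaleC_complex :: "complex \<Rightarrow> complex \<Rightarrow> complex"
  where "scaleC_complex c x = c * x"

definition star_complex :: "complex \<Rightarrow> complex"
  where "star_complex = cnj"

instance
  by standard
    (simp_all add: scaleC_complex_def star_complex_def algebra_simps scaleR_conv_of_real
      norm_mult power2_eq_square)

end

text \<open>On a compact space the type of bounded continuous functions is the type of all
  continuous functions, so \<open>'x \<Rightarrow>\<^sub>C complex\<close> is the C*-algebra \<open>C(X)\<close>.\<close>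

lemma continuous_on_scaleC [continuous_intros]:
  fixes f :: "'a::topological_space \<Rightarrow> 'b::complex_normed_vector"
  assumes "continuous_on S f"
  shows "continuous_on S (\<lambda>x. c *\<^sub>C f x)"
proof -
  have "bounded_linear (\<lambda>v::'b. c *\<^sub>C v)"
  proof (rule bounded_linear_intro[where K = "cmod c"])
    show "c *\<^sub>C (r *\<^sub>R v) = r *\<^sub>R (c *\<^sub>C v)" for r and v :: 'b
      by (simp add: scaleC_of_real[symmetric] scaleC_scaleC mult.commute)
  qed (simp_all add: scaleC_add_right norm_scaleC mult.commute)
  then show ?thesis
    using assms by (rule bounded_linear.continuous_on)
qed

lemma norm_star: "norm (star (x :: 'a::cstar_algebra)) = norm x"
proof -
  have le: "norm y \<le> norm (star y)" for y :: 'a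
  proof (cases "y = 0")
    case False
    have "norm y * norm y = norm (star y * y)"
      by (simp add: cstar_identity power2_eq_square)
    also have "\<dots> \<le> norm (star y) * norm y"
      by (rule norm_mult_ineq)
    finally show ?thesis
      using False by simp
  qed simp
  show ?thesis
    using le[of x] le[of "star x"] by (simp add: star_star)
qed

lemma continuous_on_star [continuous_intros]:
  fixes f :: "'a::topological_space \<Rightarrow> 'b::cstar_algebra"
  assumes "continuous_on S f"
  shows "continuous_on S (\<lambda>x. star (f x))"
proof -
  have "bounded_linear (star :: 'b \<Rightarrow> 'b)"
  proof (rule bounded_linear_intro[where K = 1])
    show "star (r *\<^sub>R x) = r *\<^sub>R star x" for r and x :: 'b
      using star_scaleC[of "complex_of_real r" x] by (simp add: scaleC_of_real)
  qed (simp_all add: star_add norm_star)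
  then show ?thesis
    using assms by (rule bounded_linear.continuous_on)
qed

instantiation bcontfun :: (metric_space, cstar_algebra) cstar_algebra
begin

context
  includes bcontfun.lifting
begin

lift_definition scaleC_bcontfun :: "complex \<Rightarrow> ('a \<Rightarrow>\<^sub>C 'b) \<Rightarrow> 'a \<Rightarrow>\<^sub>C 'b"
  is "\<lambda>c f x. c *\<^sub>C f x"
proof -
  fix c and f :: "'a \<Rightarrow> 'b"
  assume "f \<in> bcontfun"
  then obtain B where "continuous_on UNIV f" "\<And>x. norm (f x) \<le> B"
    by (auto simp: bcontfun_def bounded_iff)
  then show "(\<lambda>x. c *\<^sub>C f x) \<in> bcontfun"
    by (intro bcontfun_normI[where b = "cmod c * B"] continuous_intros)
      (auto simp: norm_scaleC intro: mult_left_mono)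
qed

lift_definition star_bcontfun :: "('a \<Rightarrow>\<^sub>C 'b) \<Rightarrow> 'a \<Rightarrow>\<^sub>C 'b"
  is "\<lambda>f x. star (f x)"
proof -
  fix f :: "'a \<Rightarrow> 'b"
  assume "f \<in> bcontfun"
  then obtain B where "continuous_on UNIV f" "\<And>x. norm (f x) \<le> B"
    by (auto simp: bcontfun_def bounded_iff)
  then show "(\<lambda>x. star (f x)) \<in> bcontfun"
    by (intro bcontfun_normI[where b = B] continuous_intros) (auto simp: norm_star)
qed

lift_definition times_bcontfun :: "('a \<Rightarrow>\<^sub>C 'b) \<Rightarrow> ('a \<Rightarrow>\<^sub>C 'b) \<Rightarrow> 'a \<Rightarrow>\<^sub>C 'b"
  is "\<lambda>f g x. f x * g x"
proof -
  fix f g :: "'a \<Rightarrow> 'b"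
  assume "f \<in> bcontfun" "g \<in> bcontfun"
  then obtain B C where "continuous_on UNIV f" "\<And>x. norm (f x) \<le> B"
    and "continuous_on UNIV g" "\<And>x. norm (g x) \<le> C"
    by (auto simp: bcontfun_def bounded_iff)
  then show "(\<lambda>x. f x * g x) \<in> bcontfun"
    by (intro bcontfun_normI[where b = "B * C"] continuous_intros norm_mult_ineq[THEN order_trans]
        mult_mono order_trans[OF norm_ge_zero]) auto
qed

lift_definition one_bcontfun :: "'a \<Rightarrow>\<^sub>C 'b"
  is "\<lambda>_. 1"
  by (rule const_bcontfun)

end

lemmas bcontfun_apply = scaleC_bcontfun.rep_eq star_bcontfun.rep_eq times_bcontfun.rep_eq
  one_bcontfun.rep_eq

instance
proof
  fix f g h :: "'a \<Rightarrow>\<^sub>C 'b" and c d :: complex and r :: real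
  show "norm (c *\<^sub>C f) = cmod c * norm f"
  proof (cases "c = 0")
    case False
    have le: "norm (c *\<^sub>C f) \<le> cmod c * norm f" for c and f :: "'a \<Rightarrow>\<^sub>C 'b"
      by (rule norm_bound) (simp add: bcontfun_apply norm_scaleC mult_left_mono norm_bounded)
    have "inverse c *\<^sub>C c *\<^sub>C f = f"
      using False scaleC_of_real[of 1]
      by (intro bcontfun_eqI) (simp add: bcontfun_apply scaleC_scaleC)
    then have "norm f \<le> cmod (inverse c) * norm (c *\<^sub>C f)"
      using le[of "inverse c" "c *\<^sub>C f"] by simp
    then have "cmod c * norm f \<le> norm (c *\<^sub>C f)"
      using False by (simp add: norm_inverse norm_divide field_simps)
    with le[of c f] show ?thesis
      by simp
  next
    case True
    then have "c *\<^sub>C f = 0"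
      using scaleC_of_real[of 0]
      by (intro bcontfun_eqI) (simp add: bcontfun_apply)
    then show ?thesis
      using True by simp
  qed
  show "norm (f * g) \<le> norm f * norm g"
    by (rule norm_bound)
      (auto simp: bcontfun_apply intro!: norm_mult_ineq[THEN order_trans] mult_mono norm_bounded)
  show "norm (1 :: 'a \<Rightarrow>\<^sub>C 'b) = 1"
    using norm_bound[of "1 :: 'a \<Rightarrow>\<^sub>C 'b" 1] norm_bounded[of "1 :: 'a \<Rightarrow>\<^sub>C 'b"]
    by (simp add: bcontfun_apply)
  show "norm (star f * f) = (norm f)\<^sup>2"
  proof (rule antisym)
    show "norm (star f * f) \<le> (norm f)\<^sup>2"
      by (rule norm_bound) (simp add: bcontfun_apply cstar_identity power_mono norm_bounded)
    have "norm (f x) \<le> sqrt (norm (star f * f))" for x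
      using norm_bounded[of "star f * f" x]
      by (simp add: bcontfun_apply cstar_identity real_le_rsqrt)
    then have "norm f \<le> sqrt (norm (star f * f))"
      by (rule norm_bound)
    then have "(norm f)\<^sup>2 \<le> (sqrt (norm (star f * f)))\<^sup>2"
      by (intro power_mono) auto
    then show "(norm f)\<^sup>2 \<le> norm (star f * f)"
      by simp
  qed
  show "(0 :: 'a \<Rightarrow>\<^sub>C 'b) \<noteq> 1"
    by (metis one_bcontfun.rep_eq zero_bcontfun.rep_eq zero_neq_one)
qed (auto intro!: bcontfun_eqI simp: bcontfun_apply scaleC_add_right scaleC_add_left
    scaleC_scaleC scaleC_of_real algebra_simps scaleC_mult_left scaleC_mult_right star_add
    star_scaleC star_mult star_star)

end

definition bounded_clinear ::
    "('u::complex_normed_vector \<Rightarrow> 'v::complex_normed_vector) \<Rightarrow> bool"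
  where "bounded_clinear T \<longleftrightarrow> bounded_linear T \<and> (\<forall>c x. T (c *\<^sub>C x) = c *\<^sub>C T x)"

text \<open>\<open>T\<close> is a bounded linear map with \<open>u i \<mapsto> v i\<close>. Whenever this is used the \<open>u i\<close> span a dense
  subspace, so that there is at most one such \<open>T\<close>.\<close>

definition extends_to ::
    "('i \<Rightarrow> 'u::complex_normed_vector) \<Rightarrow> ('i \<Rightarrow> 'v::complex_normed_vector) \<Rightarrow> ('u \<Rightarrow> 'v) \<Rightarrow> bool"
  where "extends_to u v T \<longleftrightarrow> bounded_clinear T \<and> (\<forall>i. T (u i) = v i)"

definition extension ::
    "('i \<Rightarrow> 'u::complex_normed_vector) \<Rightarrow> ('i \<Rightarrow> 'v::complex_normed_vector) \<Rightarrow> 'u \<Rightarrow> 'v"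
  where "extension u v = (THE T. extends_to u v T)"

definition weak_operator_topology :: "('h::chilbert_space \<Rightarrow> 'h) topology"
  where "weak_operator_topology =
    pullback_topology {T. bounded_clinear T} (\<lambda>T (\<xi>, \<eta>). cinner \<xi> (T \<eta>)) euclidean"


section \<open>Minimal tensor products of C*-algebras\<close>

definition unital_star_hom :: "('a::cstar_algebra \<Rightarrow> 'b::cstar_algebra) \<Rightarrow> bool"
  where "unital_star_hom h \<longleftrightarrow>
    (\<forall>x y. h (x + y) = h x + h y) \<and> (\<forall>c x. h (c *\<^sub>C x) = c *\<^sub>C h x) \<and>
    (\<forall>x y. h (x * y) = h x * h y) \<and> (\<forall>x. h (star x) = star (h x)) \<and> h 1 = 1"

definition state :: "('a::cstar_algebra \<Rightarrow> complex) \<Rightarrow> bool"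
  where "state \<phi> \<longleftrightarrow> bounded_clinear \<phi> \<and> (\<forall>a. \<phi> (star a * a) \<in> \<real>\<^sub>\<ge>\<^sub>0) \<and> \<phi> 1 = 1"

definition product_functional ::
    "('a::cstar_algebra \<Rightarrow> 'b::cstar_algebra \<Rightarrow> 't::cstar_algebra) \<Rightarrow>
     ('a \<Rightarrow> complex) \<Rightarrow> ('b \<Rightarrow> complex) \<Rightarrow> ('t \<Rightarrow> complex) \<Rightarrow> bool"
  where "product_functional t \<phi> \<psi> =
    extends_to (\<lambda>(a, b). t a b) (\<lambda>(a, b). \<phi> a * \<psi> b)"

text \<open>\<open>min_tensor t\<close>: the target C*-algebra, with \<open>t a b\<close> in the role of \<open>a \<otimes> b\<close>, is the minimal
  tensor product, i.e. the completion of the algebraic tensor product in the norm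
  \<open>\<parallel>z\<parallel> = sup \<parallel>(\<pi> \<otimes> \<sigma>)(z)\<parallel>\<close>, with \<open>\<pi>\<close>, \<open>\<sigma>\<close> running over the representations of the two factors.
  It suffices to let them run over the GNS representations of states \<open>\<phi>\<close>, \<open>\<psi>\<close>; then \<open>\<pi> \<otimes> \<sigma>\<close> is the
  GNS representation of the product functional \<open>\<omega> = \<phi> \<otimes> \<psi>\<close>, and its norm at \<open>z\<close> is the supremum
  of \<open>\<omega>(y*z*zy)\<^sup>1\<^sup>/\<^sup>2\<close> over the \<open>y\<close> with \<open>\<omega>(y*y) = 1\<close>. The existence of all product
  functionals makes the map from the algebraic tensor product injective.

  In the density conditions here and below, the spanning set is stable under complex scalars, so
  its real span is its complex span.\<close>

locale min_tensor =
  fixes t :: "'a::cstar_algebra \<Rightarrow> 'b::cstar_algebra \<Rightarrow> 't::cstar_algebra"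
  assumes add_left: "t (a + a') b = t a b + t a' b"
    and add_right: "t a (b + b') = t a b + t a b'"
    and scaleC_left: "t (c *\<^sub>C a) b = c *\<^sub>C t a b"
    and scaleC_right: "t a (c *\<^sub>C b) = c *\<^sub>C t a b"
    and mult: "t a b * t a' b' = t (a * a') (b * b')"
    and star: "star (t a b) = t (star a) (star b)"
    and one: "t 1 1 = 1"
    and dense: "closure (span (range (\<lambda>(a, b). t a b))) = UNIV"
    and product_functional_exists:
      "state \<phi> \<Longrightarrow> state \<psi> \<Longrightarrow> \<exists>\<omega>. product_functional t \<phi> \<psi> \<omega>"
    and norm_min: "(norm z)\<^sup>2 =
      Sup {Re (\<omega> (star y * star z * z * y)) |\<omega> y.
        (\<exists>\<phi> \<psi>. state \<phi> \<and> state \<psi> \<and> product_functional t \<phi> \<psi> \<omega>) \<and> \<omega> (star y * y) = 1}"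

text \<open>Threefold tensor products, with \<open>(a \<otimes> b) \<otimes> c\<close> and \<open>a \<otimes> (b \<otimes> c)\<close> identified.\<close>

locale min_tensor3 =
  ab: min_tensor tab + bc: min_tensor tbc + ab_c: min_tensor tab_c + a_bc: min_tensor ta_bc
  for tab :: "'a::cstar_algebra \<Rightarrow> 'b::cstar_algebra \<Rightarrow> 'ab::cstar_algebra"
    and tbc :: "'b \<Rightarrow> 'c::cstar_algebra \<Rightarrow> 'bc::cstar_algebra"
    and tab_c :: "'ab \<Rightarrow> 'c \<Rightarrow> 'abc::cstar_algebra"
    and ta_bc :: "'a \<Rightarrow> 'bc \<Rightarrow> 'abc" +
  assumes assoc: "tab_c (tab a b) c = ta_bc a (tbc b c)"


section \<open>Compact quantum groups and their actions\<close>

text \<open>In the locale below, \<open>'a\<close>, \<open>'aa\<close>, \<open>'aaa\<close> are \<open>C(G)\<close> and its tensor square and cube, and the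
  two maps in the axiom \<open>coassoc\<close> are \<open>\<Delta> \<otimes> id\<close> and \<open>id \<otimes> \<Delta>\<close>.\<close>

locale compact_quantum_group = min_tensor3 tAA tAA tAA_A tA_AA
  for tAA :: "'a::cstar_algebra \<Rightarrow> 'a \<Rightarrow> 'aa::cstar_algebra"
    and tAA_A :: "'aa \<Rightarrow> 'a \<Rightarrow> 'aaa::cstar_algebra"
    and tA_AA :: "'a \<Rightarrow> 'aa \<Rightarrow> 'aaa" +
  fixes \<Delta> :: "'a \<Rightarrow> 'aa"
  assumes \<Delta>_hom: "unital_star_hom \<Delta>"
    and coassoc: "\<exists>\<Delta>_id id_\<Delta>.
      extends_to (\<lambda>(a, b). tAA a b) (\<lambda>(a, b). tAA_A (\<Delta> a) b) \<Delta>_id \<and>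
      extends_to (\<lambda>(a, b). tAA a b) (\<lambda>(a, b). tA_AA a (\<Delta> b)) id_\<Delta> \<and>
      \<Delta>_id \<circ> \<Delta> = id_\<Delta> \<circ> \<Delta>"
    and cancel_left: "closure (span {\<Delta> a * tAA b 1 |a b. True}) = UNIV"
    and cancel_right: "closure (span {\<Delta> a * tAA 1 b |a b. True}) = UNIV"

text \<open>Here \<open>'p\<close>, \<open>'q\<close> are \<open>C(X) \<otimes> C(G)\<close> and \<open>C(X) \<otimes> C(G) \<otimes> C(G)\<close>.\<close>

locale quantum_action = compact_quantum_group tAA tAA_A tA_AA \<Delta> + X: min_tensor3 tX tAA tXA_A tX_AA
  for tAA :: "'a::cstar_algebra \<Rightarrow> 'a \<Rightarrow> 'aa::cstar_algebra"
    and tAA_A :: "'aa \<Rightarrow> 'a \<Rightarrow> 'aaa::cstar_algebra"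
    and tA_AA :: "'a \<Rightarrow> 'aa \<Rightarrow> 'aaa"
    and \<Delta> :: "'a \<Rightarrow> 'aa"
    and tX :: "('x::metric_space \<Rightarrow>\<^sub>C complex) \<Rightarrow> 'a \<Rightarrow> 'p::cstar_algebra"
    and tXA_A :: "'p \<Rightarrow> 'a \<Rightarrow> 'q::cstar_algebra"
    and tX_AA :: "('x \<Rightarrow>\<^sub>C complex) \<Rightarrow> 'aa \<Rightarrow> 'q" +
  fixes \<beta> :: "('x \<Rightarrow>\<^sub>C complex) \<Rightarrow> 'p"
  assumes \<beta>_hom: "unital_star_hom \<beta>"
    and action: "\<exists>\<beta>_id id_\<Delta>.
      extends_to (\<lambda>(f, a). tX f a) (\<lambda>(f, a). tXA_A (\<beta> f) a) \<beta>_id \<and>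
      extends_to (\<lambda>(f, a). tX f a) (\<lambda>(f, a). tX_AA f (\<Delta> a)) id_\<Delta> \<and>
      \<beta>_id \<circ> \<beta> = id_\<Delta> \<circ> \<beta>"
    and podles: "closure (span {\<beta> f * tX 1 a |f a. True}) = UNIV"

definition faithful_borel_prob :: "'x::topological_space measure \<Rightarrow> bool"
  where "faithful_borel_prob \<mu> \<longleftrightarrow> prob_space \<mu> \<and> sets \<mu> = sets borel \<and>
    (\<forall>V. open V \<longrightarrow> V \<noteq> {} \<longrightarrow> emeasure \<mu> V > 0)"

text \<open>\<open>\<mu>_id\<close> below is \<open>\<mu> \<otimes> id : C(X) \<otimes> C(G) \<rightarrow> C(G)\<close>.\<close>

definition invariant_measure ::
    "(('x::metric_space \<Rightarrow>\<^sub>C complex) \<Rightarrow> 'a::cstar_algebra \<Rightarrow> 'p::cstar_algebra) \<Rightarrow>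
     (('x \<Rightarrow>\<^sub>C complex) \<Rightarrow> 'p) \<Rightarrow> 'x measure \<Rightarrow> bool"
  where "invariant_measure tX \<beta> \<mu> \<longleftrightarrow> (\<exists>\<mu>_id.
    extends_to (\<lambda>(f, a). tX f a) (\<lambda>(f, a). (\<integral>x. f x \<partial>\<mu>) *\<^sub>C a) \<mu>_id \<and>
    (\<forall>f. \<mu>_id (\<beta> f) = (\<integral>x. f x \<partial>\<mu>) *\<^sub>C 1))"


section \<open>Hilbert spaces of square-integrable functions\<close>

definition square_integrable :: "'x measure \<Rightarrow> ('x \<Rightarrow> complex) set"
  where "square_integrable M = {f \<in> borel_measurable M. integrable M (\<lambda>x. (cmod (f x))\<^sup>2)}"

text \<open>The Hilbert space \<open>'h\<close> is \<open>L\<^sup>2(M)\<close>, with \<open>cls f\<close> the almost-everywhere class of \<open>f\<close>. Outside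
  \<^const>\<open>square_integrable\<close>, \<open>cls\<close> carries no information.\<close>

locale L2_space =
  fixes M :: "'x measure" and cls :: "('x \<Rightarrow> complex) \<Rightarrow> 'h::chilbert_space"
  assumes cls_eq_iff: "f \<in> square_integrable M \<Longrightarrow> g \<in> square_integrable M \<Longrightarrow>
      cls f = cls g \<longleftrightarrow> (AE x in M. f x = g x)"
    and cls_surj: "cls ` square_integrable M = UNIV"
    and cls_add: "f \<in> square_integrable M \<Longrightarrow> g \<in> square_integrable M \<Longrightarrow>
      cls (\<lambda>x. f x + g x) = cls f + cls g"
    and cls_scaleC: "f \<in> square_integrable M \<Longrightarrow> cls (\<lambda>x. c * f x) = c *\<^sub>C cls f"
    and cinner_cls: "f \<in> square_integrable M \<Longrightarrow> g \<in> square_integrable M \<Longrightarrow>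
      cinner (cls f) (cls g) = (\<integral>x. cnj (f x) * g x \<partial>M)"

definition L2_rep :: "'x measure \<Rightarrow> (('x \<Rightarrow> complex) \<Rightarrow> 'h) \<Rightarrow> 'h \<Rightarrow> 'x \<Rightarrow> complex"
  where "L2_rep M cls \<xi> = (SOME f. f \<in> square_integrable M \<and> cls f = \<xi>)"

definition multiplication_op ::
    "'x measure \<Rightarrow> (('x \<Rightarrow> complex) \<Rightarrow> 'h) \<Rightarrow> ('x::metric_space \<Rightarrow>\<^sub>C complex) \<Rightarrow> 'h \<Rightarrow> 'h"
  where "multiplication_op M cls f \<xi> = cls (\<lambda>x. f x * L2_rep M cls \<xi> x)"

definition kernel_op ::
    "'x measure \<Rightarrow> (('x \<Rightarrow> complex) \<Rightarrow> 'h) \<Rightarrow> (('x::metric_space \<times> 'x) \<Rightarrow>\<^sub>C complex) \<Rightarrow> 'h \<Rightarrow> 'h"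
  where "kernel_op M cls f \<xi> = cls (\<lambda>x. \<integral>y. f (x, y) * L2_rep M cls \<xi> y \<partial>M)"

text \<open>The elementary tensors under the identification of \<open>L\<^sup>2(M) \<otimes> L\<^sup>2(M)\<close> with \<open>L\<^sup>2(M \<otimes> M)\<close>.\<close>

definition L2_tensor ::
    "'x measure \<Rightarrow> (('x \<Rightarrow> complex) \<Rightarrow> 'h) \<Rightarrow> (('x \<times> 'x \<Rightarrow> complex) \<Rightarrow> 'k) \<Rightarrow> 'h \<Rightarrow> 'h \<Rightarrow> 'k"
  where "L2_tensor M cls cls2 \<xi> \<eta> =
    cls2 (\<lambda>(x, y). L2_rep M cls \<xi> x * L2_rep M cls \<eta> y)"


section \<open>Hilbert C*-modules\<close>

locale hilbert_module =
  fixes act :: "'e::{complex_normed_vector, banach} \<Rightarrow> 'a::cstar_algebra \<Rightarrow> 'e"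
    and ip :: "'e \<Rightarrow> 'e \<Rightarrow> 'a"
  assumes act_add_left: "act (v + w) a = act v a + act w a"
    and act_add_right: "act v (a + b) = act v a + act v b"
    and act_scaleC_left: "act (c *\<^sub>C v) a = c *\<^sub>C act v a"
    and act_scaleC_right: "act v (c *\<^sub>C a) = c *\<^sub>C act v a"
    and act_act: "act (act v a) b = act v (a * b)"
    and act_one: "act v 1 = v"
    and ip_add_right: "ip v (w + u) = ip v w + ip v u"
    and ip_scaleC_right: "ip v (c *\<^sub>C w) = c *\<^sub>C ip v w"
    and ip_act_right: "ip v (act w a) = ip v w * a"
    and ip_commute: "ip w v = star (ip v w)"
    and ip_self_positive: "\<exists>b. ip v v = star b * b"
    and norm_ip: "(norm v)\<^sup>2 = norm (ip v v)"

text \<open>The Hilbert \<open>'a\<close>-module \<open>'e\<close> is \<open>'h \<otimes> 'a\<close>, with elementary tensors \<open>tens \<xi> a\<close>.\<close>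

locale hilbert_tensor = hilbert_module act ip
  for act :: "'e::{complex_normed_vector, banach} \<Rightarrow> 'a::cstar_algebra \<Rightarrow> 'e"
    and ip :: "'e \<Rightarrow> 'e \<Rightarrow> 'a" +
  fixes tens :: "'h::chilbert_space \<Rightarrow> 'a \<Rightarrow> 'e"
  assumes tens_add_left: "tens (\<xi> + \<eta>) a = tens \<xi> a + tens \<eta> a"
    and tens_add_right: "tens \<xi> (a + b) = tens \<xi> a + tens \<xi> b"
    and tens_scaleC_left: "tens (c *\<^sub>C \<xi>) a = c *\<^sub>C tens \<xi> a"
    and tens_scaleC_right: "tens \<xi> (c *\<^sub>C a) = c *\<^sub>C tens \<xi> a"
    and act_tens: "act (tens \<xi> a) b = tens \<xi> (a * b)"
    and ip_tens: "ip (tens \<xi> a) (tens \<eta> b) = cinner \<xi> \<eta> *\<^sub>C (star a * b)"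
    and tens_dense: "closure (span (range (\<lambda>(\<xi>, a). tens \<xi> a))) = UNIV"

definition adjoint_ops :: "('e \<Rightarrow> 'e \<Rightarrow> 'a) \<Rightarrow> ('e \<Rightarrow> 'e) \<Rightarrow> ('e \<Rightarrow> 'e) \<Rightarrow> bool"
  where "adjoint_ops ip T S \<longleftrightarrow> (\<forall>v w. ip (T v) w = ip v (S w))"

definition module_adjoint :: "('e \<Rightarrow> 'e \<Rightarrow> 'a) \<Rightarrow> ('e \<Rightarrow> 'e) \<Rightarrow> 'e \<Rightarrow> 'e"
  where "module_adjoint ip T = (THE S. adjoint_ops ip T S)"

definition module_unitary :: "('e \<Rightarrow> 'e \<Rightarrow> 'a) \<Rightarrow> ('e \<Rightarrow> 'e) \<Rightarrow> bool"
  where "module_unitary ip T \<longleftrightarrow> (\<exists>S. adjoint_ops ip T S \<and> S \<circ> T = id \<and> T \<circ> S = id)"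

text \<open>The operator \<open>s \<otimes> 1\<close>.\<close>

definition amplification ::
    "('h::complex_normed_vector \<Rightarrow> 'a::cstar_algebra \<Rightarrow> 'e::complex_normed_vector) \<Rightarrow>
     ('h \<Rightarrow> 'h) \<Rightarrow> 'e \<Rightarrow> 'e"
  where "amplification tens s = extension (\<lambda>(\<xi>, a). tens \<xi> a) (\<lambda>(\<xi>, a). tens (s \<xi>) a)"


section \<open>The associated unitary, isometric actions, the orbital algebra\<close>

text \<open>\<open>\<kappa>\<close> is the canonical map \<open>C(X) \<otimes> C(G) \<rightarrow> L\<^sup>2(X) \<otimes> C(G)\<close>, through which \<open>\<beta>(f)(1 \<otimes> a)\<close> is
  regarded as an element of the module. It exists and is contractive because of
  \<open>\<parallel>\<kappa>(z)\<parallel>\<^sup>2 = \<parallel>(\<mu> \<otimes> id)(z*z)\<parallel> \<le> \<parallel>z\<parallel>\<^sup>2\<close>.\<close>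

definition associated_unitary ::
    "(('x::metric_space \<Rightarrow>\<^sub>C complex) \<Rightarrow> 'a::cstar_algebra \<Rightarrow> 'p::cstar_algebra) \<Rightarrow>
     (('x \<Rightarrow>\<^sub>C complex) \<Rightarrow> 'p) \<Rightarrow> (('x \<Rightarrow> complex) \<Rightarrow> 'h) \<Rightarrow>
     ('e::complex_normed_vector \<Rightarrow> 'e \<Rightarrow> 'a) \<Rightarrow> ('h \<Rightarrow> 'a \<Rightarrow> 'e) \<Rightarrow> ('e \<Rightarrow> 'e) \<Rightarrow> bool"
  where "associated_unitary tX \<beta> cls ip tens U \<longleftrightarrow> module_unitary ip U \<and> (\<exists>\<kappa>.
    extends_to (\<lambda>(f, a). tX f a) (\<lambda>(f, a). tens (cls (apply_bcontfun f)) a) \<kappa> \<and>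
    (\<forall>f a. U (tens (cls (apply_bcontfun f)) a) = \<kappa> (\<beta> f * tX 1 a)))"

definition intertwiners ::
    "('h::complex_normed_vector \<Rightarrow> 'a::cstar_algebra \<Rightarrow> 'e::complex_normed_vector) \<Rightarrow>
     ('e \<Rightarrow> 'e) \<Rightarrow> ('h \<Rightarrow> 'h) set"
  where "intertwiners tens U =
    {s. bounded_clinear s \<and> U \<circ> amplification tens s = amplification tens s \<circ> U}"

text \<open>Leg numbering on \<open>L\<^sup>2(X) \<otimes> L\<^sup>2(X) \<otimes> C(G) = L\<^sup>2(X \<times> X) \<otimes> C(G)\<close>. Given \<open>tn = L2_tensor \<dots>\<close>,
  \<open>put_first \<xi>\<close> is \<open>\<eta> \<otimes> a \<mapsto> \<xi> \<otimes> \<eta> \<otimes> a\<close> and \<open>put_second \<eta>\<close> is \<open>\<xi> \<otimes> a \<mapsto> \<xi> \<otimes> \<eta> \<otimes> a\<close>, both defined on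
  \<open>L\<^sup>2(X) \<otimes> C(G)\<close>.\<close>

definition put_first ::
    "('h \<Rightarrow> 'h \<Rightarrow> 'k) \<Rightarrow> ('h \<Rightarrow> 'a \<Rightarrow> 'e::complex_normed_vector) \<Rightarrow>
     ('k \<Rightarrow> 'a \<Rightarrow> 'f::complex_normed_vector) \<Rightarrow> 'h \<Rightarrow> 'e \<Rightarrow> 'f"
  where "put_first tn tens tens2 \<xi> =
    extension (\<lambda>(\<eta>, a). tens \<eta> a) (\<lambda>(\<eta>, a). tens2 (tn \<xi> \<eta>) a)"

definition put_second ::
    "('h \<Rightarrow> 'h \<Rightarrow> 'k) \<Rightarrow> ('h \<Rightarrow> 'a \<Rightarrow> 'e::complex_normed_vector) \<Rightarrow>
     ('k \<Rightarrow> 'a \<Rightarrow> 'f::complex_normed_vector) \<Rightarrow> 'h \<Rightarrow> 'e \<Rightarrow> 'f"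
  where "put_second tn tens tens2 \<eta> =
    extension (\<lambda>(\<xi>, a). tens \<xi> a) (\<lambda>(\<xi>, a). tens2 (tn \<xi> \<eta>) a)"

definition leg23 ::
    "('h \<Rightarrow> 'h \<Rightarrow> 'k) \<Rightarrow> ('h \<Rightarrow> 'a \<Rightarrow> 'e::complex_normed_vector) \<Rightarrow>
     ('k \<Rightarrow> 'a \<Rightarrow> 'f::complex_normed_vector) \<Rightarrow> ('e \<Rightarrow> 'e) \<Rightarrow> 'f \<Rightarrow> 'f"
  where "leg23 tn tens tens2 U =
    extension (\<lambda>(\<xi>, v). put_first tn tens tens2 \<xi> v) (\<lambda>(\<xi>, v). put_first tn tens tens2 \<xi> (U v))"

definition leg13 ::
    "('h \<Rightarrow> 'h \<Rightarrow> 'k) \<Rightarrow> ('h \<Rightarrow> 'a \<Rightarrow> 'e::complex_normed_vector) \<Rightarrow>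
     ('k \<Rightarrow> 'a \<Rightarrow> 'f::complex_normed_vector) \<Rightarrow> ('e \<Rightarrow> 'e) \<Rightarrow> 'f \<Rightarrow> 'f"
  where "leg13 tn tens tens2 U =
    extension (\<lambda>(\<eta>, v). put_second tn tens tens2 \<eta> v) (\<lambda>(\<eta>, v). put_second tn tens tens2 \<eta> (U v))"

definition op_W ::
    "('h \<Rightarrow> 'h \<Rightarrow> 'k) \<Rightarrow> ('h \<Rightarrow> 'a \<Rightarrow> 'e::complex_normed_vector) \<Rightarrow>
     ('k \<Rightarrow> 'a \<Rightarrow> 'f::complex_normed_vector) \<Rightarrow> ('e \<Rightarrow> 'e) \<Rightarrow> 'f \<Rightarrow> 'f"
  where "op_W tn tens tens2 U = leg13 tn tens tens2 U \<circ> leg23 tn tens tens2 U"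

definition op_Z ::
    "('h \<Rightarrow> 'h \<Rightarrow> 'k) \<Rightarrow> ('h \<Rightarrow> 'a \<Rightarrow> 'e::complex_normed_vector) \<Rightarrow>
     ('k \<Rightarrow> 'a \<Rightarrow> 'f::complex_normed_vector) \<Rightarrow> ('e \<Rightarrow> 'e) \<Rightarrow> 'f \<Rightarrow> 'f"
  where "op_Z tn tens tens2 U = leg23 tn tens tens2 U \<circ> leg13 tn tens tens2 U"

definition isometric ::
    "(('x::metric_space \<times> 'x \<Rightarrow> complex) \<Rightarrow> 'k) \<Rightarrow> ('h \<Rightarrow> 'h \<Rightarrow> 'k) \<Rightarrow>
     ('h \<Rightarrow> 'a::cstar_algebra \<Rightarrow> 'e::complex_normed_vector) \<Rightarrow>
     ('k \<Rightarrow> 'a \<Rightarrow> 'f::complex_normed_vector) \<Rightarrow> ('e \<Rightarrow> 'e) \<Rightarrow> bool"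
  where "isometric cls2 tn tens tens2 U \<longleftrightarrow>
    (let W = op_W tn tens tens2 U; Z = op_Z tn tens tens2 U;
         d = tens2 (cls2 (\<lambda>(x, y). complex_of_real (dist x y))) 1
     in W d = d \<and> Z d = d)"

definition orbital_algebra ::
    "'x::metric_space measure \<Rightarrow> (('x \<times> 'x \<Rightarrow> complex) \<Rightarrow> 'k::complex_normed_vector) \<Rightarrow>
     ('h \<Rightarrow> 'h \<Rightarrow> 'k) \<Rightarrow> ('h \<Rightarrow> 'a::cstar_algebra \<Rightarrow> 'e::complex_normed_vector) \<Rightarrow>
     ('k \<Rightarrow> 'a \<Rightarrow> 'f::complex_normed_vector) \<Rightarrow> ('f \<Rightarrow> 'f \<Rightarrow> 'a) \<Rightarrow> ('e \<Rightarrow> 'e) \<Rightarrow>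
     (('x \<times> 'x) \<Rightarrow>\<^sub>C complex) set"
  where "orbital_algebra \<mu> cls2 tn tens tens2 ip2 U =
    {f. let W = op_W tn tens tens2 U; Z = op_Z tn tens tens2 U;
            m = amplification tens2 (multiplication_op (\<mu> \<Otimes>\<^sub>M \<mu>) cls2 f)
        in W \<circ> m \<circ> module_adjoint ip2 W = m \<and> m = Z \<circ> m \<circ> module_adjoint ip2 Z}"

end

theory Submission
  imports Defs
begin

text \<open>Isometry of the action says that the kernel \<open>d\<close> is fixed by \<open>W\<close> and \<open>Z\<close>. The key point is that a
  continuous \<open>f\<close> with \<open>W(f \<otimes> 1) = f \<otimes> 1\<close> already satisfies \<open>W(\<pi>(f) \<otimes> 1) = (\<pi>(f) \<otimes> 1)W\<close>: for
  \<open>f = p \<otimes> q\<close>, commutativity of \<open>C(X)\<close> allows \<open>\<beta>(p)\<close> and \<open>\<beta>(q)\<close> to be brought next to each other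
  inside \<open>W((p \<otimes> q)(g \<otimes> h))\<close>, where they combine to \<open>W(p \<otimes> q)\<close>. Moreover \<open>U\<close> is real for complex
  conjugation, so both \<open>Wf = f\<close> and \<open>Zf = f\<close> say that \<open>\<rho>(f)\<close> intertwines \<open>U\<close>. Hence \<open>C(O)\<close> consists
  of the continuous kernels of intertwiners and is closed under pointwise products and inverses.

  For the density, normalised powers of \<open>1 - d/D\<close> are kernels in \<open>C(O)\<close> whose operators tend to the
  identity on \<open>C(X)\<close>. If \<open>b\<close> is a contractive multiple of such an operator, then
  \<open>1 - (1 - bb*)\<^sup>m = bqb*\<close> is close to the identity on finitely many given vectors, and
  \<open>bqb* T bqb*\<close> has a continuous kernel for every bounded \<open>T\<close>; it is an intertwiner if \<open>T\<close> is.\<close>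

section \<open>Bounded complex-linear maps\<close>

text \<open>As \<open>Z = U23 U13\<close>, fixing a vector by \<open>Z\<close> means that
  \<open>U13\<close> and the inverse of \<open>U23\<close> agree on it. Pairing with elementary
  tensors turns this into an equation between matrix coefficients of \<open>U\<close> that involve
  \<open>\<rho>(f)\<close> and its adjoint. Exchanging the variables passes from \<open>Z\<close> to
  \<open>W\<close> and replaces \<open>\<rho>(f)\<close> by its transpose. The obstacle in the
  density half is uniformity. The normalised powers are controlled by integrals in one variable,
  which gives convergence on \<open>C(X)\<close>; their operators are bounded by the sup norm of the
  kernel, for which no uniform bound is established. Only ranges are therefore used: the given
  vectors are close to the range of a single \<open>b\<close>, and powers of the contraction
  \<open>1 - b b*\<close> tend to zero on that range. The outer factors also give continuity:
  \<open>b S b*\<close> has the kernel \<open>\<langle>k x, S (k y)\<rangle>\<close> for a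
  continuous family of vectors \<open>k\<close>. In the other inclusion an equation in
  \<open>C(G)\<close> has to survive weak limits. It is tested by scalar functionals, and the Riesz
  theorem turns each side into a matrix coefficient of the operator.\<close>

lemma scaleC_zero_left [simp]: "0 *\<^sub>C (x :: 'a::complex_normed_vector) = 0"
  using scaleC_of_real[of 0 x] by simp

lemma scaleC_zero_right [simp]: "c *\<^sub>C (0 :: 'a::complex_normed_vector) = 0"
  using norm_scaleC[of c "0 :: 'a"] by simp

lemma scaleC_one [simp]: "1 *\<^sub>C (x :: 'a::complex_normed_vector) = x"
  using scaleC_of_real[of 1 x] by simp

lemma scaleC_minus_one: "(-1) *\<^sub>C (x :: 'a::complex_normed_vector) = - x"
  using scaleC_of_real[of "-1" x] by simp

lemma scaleC_complex [simp]: "c *\<^sub>C (z :: complex) = c * z"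
  by (simp add: scaleC_complex_def)

lemma star_complex [simp]: "star (z :: complex) = cnj z"
  by (simp add: star_complex_def)

lemma bounded_clinearI:
  assumes "\<And>x y. T (x + y) = T x + T y" "\<And>c x. T (c *\<^sub>C x) = c *\<^sub>C T x"
    and "\<And>x. norm (T x) \<le> C * norm x"
  shows "bounded_clinear T"
  unfolding bounded_clinear_def
proof
  show "bounded_linear T"
  proof (rule bounded_linear_intro[where K = C])
    show "T (r *\<^sub>R x) = r *\<^sub>R T x" for r x
      using assms(2)[of "complex_of_real r" x] by (simp add: scaleC_of_real)
  qed (use assms in \<open>auto simp: mult.commute\<close>)
qed (use assms in simp)

lemma bounded_clinear_scaleC: "bounded_clinear T \<Longrightarrow> T (c *\<^sub>C x) = c *\<^sub>C T x"
  by (simp add: bounded_clinear_def)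

lemma bounded_clinear_bounded_linear: "bounded_clinear T \<Longrightarrow> bounded_linear T"
  by (simp add: bounded_clinear_def)

lemma bounded_clinear_add: "bounded_clinear T \<Longrightarrow> T (x + y) = T x + T y"
  by (simp add: bounded_clinear_def linear_simps)

lemma bounded_clinear_diff: "bounded_clinear T \<Longrightarrow> T (x - y) = T x - T y"
  by (simp add: bounded_clinear_def linear_simps)

lemma bounded_clinear_zero: "bounded_clinear T \<Longrightarrow> T 0 = 0"
  by (simp add: bounded_clinear_def linear_simps)

lemma bounded_clinear_bound:
  assumes "bounded_clinear T"
  obtains C where "C > 0" "\<And>x. norm (T x) \<le> C * norm x"
  using bounded_linear.pos_bounded[OF bounded_clinear_bounded_linear[OF assms]]
  by (metis mult.commute)

lemma bounded_clinear_compose: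
  "bounded_clinear S \<Longrightarrow> bounded_clinear T \<Longrightarrow> bounded_clinear (\<lambda>x. S (T x))"
  by (auto simp: bounded_clinear_def intro: bounded_linear_compose)

lemma bounded_clinear_plus:
  "bounded_clinear S \<Longrightarrow> bounded_clinear T \<Longrightarrow> bounded_clinear (\<lambda>x. S x + T x)"
  by (auto simp: bounded_clinear_def scaleC_add_right intro: bounded_linear_add)

lemma bounded_clinear_scale:
  assumes T: "bounded_clinear T"
  shows "bounded_clinear (\<lambda>x. c *\<^sub>C T x)"
proof -
  obtain C where C: "\<And>x. norm (T x) \<le> C * norm x"
    using bounded_clinear_bound[OF T] by blast
  show ?thesis
  proof (rule bounded_clinearI[where C = "cmod c * C"])
    show "norm (c *\<^sub>C T x) \<le> cmod c * C * norm x" for x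
      using mult_left_mono[OF C[of x], of "cmod c"] by (simp add: norm_scaleC mult.assoc)
    show "c *\<^sub>C T (d *\<^sub>C x) = d *\<^sub>C c *\<^sub>C T x" for d x
      by (simp add: bounded_clinear_scaleC[OF T] scaleC_scaleC mult.commute)
  qed (simp add: bounded_clinear_add[OF T] scaleC_add_right)
qed

lemma bounded_clinear_ident: "bounded_clinear (\<lambda>x. x)"
  by (simp add: bounded_clinear_def bounded_linear_ident)

section \<open>Density arguments and extension by continuity\<close>

lemma bounded_linear_eqI:
  assumes T: "bounded_linear T" and S: "bounded_linear S"
    and dense: "closure (span B) = UNIV" and eq: "\<And>x. x \<in> B \<Longrightarrow> T x = S x"
  shows "T x = S x"
proof -
  have span: "T y - S y = 0" if "y \<in> span B" for y
    using linear_eq_on_span[OF bounded_linear.linear[OF T] bounded_linear.linear[OF S] eq that]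
    by simp
  have "T x - S x = 0"
  proof (rule continuous_constant_on_closure[where S = "span B", OF _ span])
    show "continuous_on (closure (span B)) (\<lambda>y. T y - S y)"
      by (intro continuous_intros bounded_linear.continuous_on[OF T]
          bounded_linear.continuous_on[OF S])
  qed (simp_all add: dense)
  then show ?thesis
    by simp
qed

text \<open>Real scalars are absorbed into the index, so elements of the span are plain finite sums
  without coefficients. Bounds can then be stated for lists of indices.\<close>

lemma span_scale_closed_sum_list:
  fixes u :: "'i \<Rightarrow> 'u::real_vector"
  assumes scale: "\<And>r i. \<exists>j. u j = r *\<^sub>R u i"
  shows "x \<in> span (range u) \<longleftrightarrow> (\<exists>l. x = sum_list (map u l))"
proof
  assume "x \<in> span (range u)"
  then show "\<exists>l. x = sum_list (map u l)"
  proof (induction rule: span_induct_alt)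
    case base
    show ?case by (rule exI[of _ "[]"]) simp
  next
    case (step c x y)
    then obtain i l where "x = u i" "y = sum_list (map u l)" by auto
    moreover obtain j where "u j = c *\<^sub>R u i" using scale by blast
    ultimately show ?case by (intro exI[of _ "j # l"]) simp
  qed
next
  have "sum_list (map u l) \<in> span (range u)" for l
    by (induction l) (auto intro: span_zero span_add span_base)
  then show "\<exists>l. x = sum_list (map u l) \<Longrightarrow> x \<in> span (range u)" by auto
qed

text \<open>The span \<open>G\<close> of the pairs \<open>(u i, v i)\<close> is a linear relation,
  and the norm bound on finite sums makes it single-valued: a pair \<open>(0, y)\<close> in
  \<open>G\<close> has \<open>y = 0\<close>. The resulting function is Lipschitz on a dense subspace
  and extends by uniform continuity; \<open>scale\<close> provides complex homogeneity.\<close>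

lemma extends_to_exists:
  fixes u :: "'i \<Rightarrow> 'u::complex_normed_vector" and v :: "'i \<Rightarrow> 'v::{complex_normed_vector,banach}"
  assumes scale: "\<And>c i. \<exists>j. u j = c *\<^sub>C u i \<and> v j = c *\<^sub>C v i"
    and bound: "\<And>l. norm (sum_list (map v l)) \<le> C * norm (sum_list (map u l))"
    and dense: "closure (span (range u)) = UNIV"
  shows "\<exists>T. extends_to u v T"
proof -
  define w where "w i = (u i, v i)" for i
  define G where "G = span (range w)"
  have list_w: "sum_list (map w l) = (sum_list (map u l), sum_list (map v l))" for l
    by (induction l) (auto simp: w_def zero_prod_def)
  have scaleR: "\<exists>j. u j = r *\<^sub>R u i \<and> v j = r *\<^sub>R v i" for r i
    using scale[of "complex_of_real r" i] by (simp add: scaleC_of_real)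
  have G: "p \<in> G \<longleftrightarrow> (\<exists>l. p = sum_list (map w l))" for p
    unfolding G_def by (rule span_scale_closed_sum_list) (use scaleR in \<open>auto simp: w_def\<close>)
  have span_u: "x \<in> span (range u) \<longleftrightarrow> (\<exists>l. x = sum_list (map u l))" for x
    by (rule span_scale_closed_sum_list) (use scaleR in blast)
  have G_bound: "norm y \<le> C * norm x" if "(x, y) \<in> G" for x y
    using that bound by (auto simp: G list_w)
  have G_add: "(x + x', y + y') \<in> G" if "(x, y) \<in> G" "(x', y') \<in> G" for x y x' y'
    using span_add[of "(x, y)" "range w" "(x', y')"] that by (simp add: G_def)
  have G_diff: "(x - x', y - y') \<in> G" if "(x, y) \<in> G" "(x', y') \<in> G" for x y x' y'
    using span_diff[of "(x, y)" "range w" "(x', y')"] that by (simp add: G_def)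
  have G_unique: "y = y'" if "(x, y) \<in> G" "(x, y') \<in> G" for x y y'
    using G_bound[OF G_diff[OF that]] by simp
  define f where "f x = (THE y. (x, y) \<in> G)" for x
  have f_eq: "f x = y" if "(x, y) \<in> G" for x y
    unfolding f_def using that G_unique by blast
  have f_mem: "(x, f x) \<in> G" if x: "x \<in> span (range u)" for x
  proof -
    obtain l where "x = sum_list (map u l)" using x unfolding span_u by blast
    then have "(x, sum_list (map v l)) = sum_list (map w l)" by (simp add: list_w)
    then have mem: "(x, sum_list (map v l)) \<in> G" using G by blast
    show ?thesis unfolding f_eq[OF mem] by (rule mem)
  qed
  \<comment> \<open>A negative \<open>C\<close> is possible if every \<open>u i\<close> is zero,
    while a Lipschitz constant must be nonnegative.\<close>
  define C' where "C' = max C 0"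
  have f_dist: "dist (f x) (f y) \<le> C' * dist x y"
    if "x \<in> span (range u)" "y \<in> span (range u)" for x y
  proof -
    have "norm (f x - f y) \<le> C * norm (x - y)"
      by (intro G_bound G_diff f_mem that)
    also have "\<dots> \<le> C' * norm (x - y)"
      by (intro mult_right_mono) (auto simp: C'_def)
    finally show ?thesis by (simp add: dist_norm)
  qed
  have "C'-lipschitz_on (span (range u)) f"
    using f_dist by (intro lipschitz_onI) (auto simp: C'_def)
  then have "uniformly_continuous_on (span (range u)) f"
    by (rule lipschitz_on_uniformly_continuous)
  from uniformly_continuous_on_extension_on_closure[OF this]
  obtain g where ug: "uniformly_continuous_on UNIV g" and fg: "\<And>x. x \<in> span (range u) \<Longrightarrow> f x = g x"
    using dense by metis
  have cont: "continuous_on S g" for S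
    using uniformly_continuous_imp_continuous[OF ug] continuous_on_subset by blast
  have cl: "x \<in> closure (span (range u))" for x using dense by simp
  have gG: "(x, g x) \<in> G" if "x \<in> span (range u)" for x
    using f_mem[OF that] fg[OF that] by simp
  have gu: "g (u i) = v i" for i
  proof -
    have "(u i, v i) \<in> G" unfolding G_def w_def by (intro span_base) auto
    moreover have "(u i, g (u i)) \<in> G" by (intro gG span_base) auto
    ultimately show ?thesis using G_unique by blast
  qed
  have contg: "continuous_on S (\<lambda>x. g (h x))" if "continuous_on S h" for S and h :: "'u \<Rightarrow> 'u"
    using continuous_on_compose2[OF cont that subset_UNIV] .
  \<comment> \<open>Additivity is extended one variable at a time: here \<open>x\<close> becomes
    arbitrary with \<open>y\<close> still in the span, then \<open>y\<close> as well.\<close>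
  have add1: "g (x + y) = g x + g y" if y: "y \<in> span (range u)" for x y
  proof -
    have eq: "g (z + y) - (g z + g y) = 0" if z: "z \<in> span (range u)" for z
    proof -
      have "(z + y, g (z + y)) \<in> G" by (intro gG span_add z y)
      moreover have "(z + y, g z + g y) \<in> G" by (intro gG G_add z y)
      ultimately have "g (z + y) = g z + g y" by (rule G_unique)
      then show ?thesis by simp
    qed
    have "g (x + y) - (g x + g y) = 0"
      by (rule continuous_constant_on_closure[where S = "span (range u)", OF _ eq cl])
        (intro continuous_intros contg)
    then show ?thesis by simp
  qed
  have add: "g (x + y) = g x + g y" for x y
  proof -
    have eq: "g (x + z) - (g x + g z) = 0" if z: "z \<in> span (range u)" for z
      using add1[OF z] by simp
    have "g (x + y) - (g x + g y) = 0"
      by (rule continuous_constant_on_closure[where S = "span (range u)", OF _ eq cl])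
        (intro continuous_intros contg)
    then show ?thesis by simp
  qed
  have bnd: "norm (g x) \<le> C' * norm x" for x
  proof -
    have le: "norm (g z) - C' * norm z \<le> 0" if z: "z \<in> span (range u)" for z
    proof -
      have "C * norm z \<le> C' * norm z"
        by (intro mult_right_mono) (auto simp: C'_def)
      with G_bound[OF gG[OF z]] show ?thesis by simp
    qed
    have "norm (g x) - C' * norm x \<le> 0"
      by (rule continuous_le_on_closure[OF _ cl le]) (intro continuous_intros contg)
    then show ?thesis by simp
  qed
  have lin: "bounded_linear g"
  proof (rule bounded_linear_intro[where K = C'])
    interpret additive g by unfold_locales (rule add)
    show "g (r *\<^sub>R x) = r *\<^sub>R g x" for r x
    proof -
      have "g (r *\<^sub>R x) - r *\<^sub>R g x = 0"
      proof (rule continuous_constant_on_closure[where S = "span (range u)" and f = "\<lambda>x. g (r *\<^sub>R x) - r *\<^sub>R g x", OF _ _ cl])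
        fix x assume x: "x \<in> span (range u)"
        have "(r *\<^sub>R x, r *\<^sub>R g x) \<in> G"
          using span_scale[of "(x, g x)" "range w" r] gG[OF x] by (simp add: G_def)
        from G_unique[OF gG[OF span_scale[OF x]] this] show "g (r *\<^sub>R x) - r *\<^sub>R g x = 0" by simp
      qed (intro continuous_intros contg)+
      then show ?thesis by simp
    qed
  qed (use add bnd in \<open>auto simp: mult.commute\<close>)
  have sc: "bounded_linear (\<lambda>x::'z::complex_normed_vector. c *\<^sub>C x)" for c
    using bounded_clinear_scale[OF bounded_clinear_ident] by (rule bounded_clinear_bounded_linear)
  have "g (c *\<^sub>C x) = c *\<^sub>C g x" for c x
  proof (rule bounded_linear_eqI[OF _ _ dense, of "\<lambda>x. g (c *\<^sub>C x)" "\<lambda>x. c *\<^sub>C g x"])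
    show "g (c *\<^sub>C x) = c *\<^sub>C g x" if "x \<in> range u" for x
      using that gu scale by (metis rangeE)
  qed (rule bounded_linear_compose[OF lin sc] bounded_linear_compose[OF sc lin])+
  then show ?thesis
    using lin gu by (auto simp: extends_to_def bounded_clinear_def)
qed

lemma extends_to_unique:
  assumes "extends_to u v T" "extends_to u v S" "closure (span (range u)) = UNIV"
  shows "T = S"
proof
  show "T x = S x" for x
    by (rule bounded_linear_eqI[OF _ _ assms(3)])
      (use assms in \<open>auto simp: extends_to_def bounded_clinear_def\<close>)
qed

lemma extends_to_extension:
  assumes "extends_to u v T" "closure (span (range u)) = UNIV"
  shows "extends_to u v (extension u v)"
  unfolding extension_def
  using assms extends_to_unique[OF _ _ assms(2)] by (metis (mono_tags) theI)

section \<open>Hilbert spaces\<close>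

lemma cinner_scaleC_left: "cinner (c *\<^sub>C x) y = cnj c * cinner x y"
  by (subst (1 2) cinner_commute) (simp add: cinner_scaleC_right)

lemma cinner_add_left: "cinner (x + y) z = cinner x z + cinner y z"
  by (subst (1 2 3) cinner_commute) (simp add: cinner_add_right)

lemma cinner_zero_right [simp]: "cinner x 0 = 0"
  using cinner_scaleC_right[of x 0 0] by simp

lemma cinner_zero_left [simp]: "cinner 0 x = 0"
  using cinner_scaleC_left[of 0 0 x] by simp

lemma cinner_diff_right: "cinner x (y - z) = cinner x y - cinner x z"
  using cinner_add_right[of x y "(-1) *\<^sub>C z"]
  by (simp add: cinner_scaleC_right scaleC_minus_one cinner_scaleC_right[of x "-1" z, unfolded scaleC_minus_one])

lemma cinner_diff_left: "cinner (x - y) z = cinner x z - cinner y z"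
  by (subst (1 2 3) cinner_commute) (simp add: cinner_diff_right)

lemma cinner_eqI:
  assumes "\<And>z. cinner z x = cinner z y"
  shows "x = y"
proof -
  have "cinner (x - y) (x - y) = 0"
    by (simp add: cinner_diff_right assms)
  then show ?thesis
    by (simp add: cinner_self)
qed

section \<open>Norm identities, projections and the Riesz theorem\<close>

lemma norm_add_square: "(norm (x + y))\<^sup>2 = (norm x)\<^sup>2 + (norm y)\<^sup>2 + 2 * Re (cinner x y)"
proof -
  have "complex_of_real ((norm (x + y))\<^sup>2) = cinner x x + cinner y y + (cinner x y + cnj (cinner x y))"
    by (simp only: cinner_self[symmetric] cinner_add_left cinner_add_right cinner_commute[of x y])
      (simp add: cinner_commute[of y x])
  also have "\<dots> = complex_of_real ((norm x)\<^sup>2 + (norm y)\<^sup>2 + 2 * Re (cinner x y))"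
    by (simp add: cinner_self complex_add_cnj)
  finally show ?thesis
    by (simp only: of_real_eq_iff)
qed

lemma norm_diff_square: "(norm (x - y))\<^sup>2 = (norm x)\<^sup>2 + (norm y)\<^sup>2 - 2 * Re (cinner x y)"
proof -
  have "cinner x (- y) = - cinner x y"
    using cinner_diff_right[of x 0 y] by simp
  then show ?thesis
    using norm_add_square[of x "- y"] by simp
qed

text \<open>Pythagoras for the projection of \<open>z\<close> onto the line of \<open>m\<close>.
  Nonnegativity of the left side is the Cauchy--Schwarz inequality; the decrease by the last term is
  what makes a nearest point an orthogonal projection.\<close>

lemma norm_minus_component_square:
  assumes "m \<noteq> (0 :: 'h::chilbert_space)"
  shows "(norm (z - (cinner m z / complex_of_real ((norm m)\<^sup>2)) *\<^sub>C m))\<^sup>2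
    = (norm z)\<^sup>2 - (cmod (cinner m z))\<^sup>2 / (norm m)\<^sup>2"
proof -
  define c where "c = cinner m z / complex_of_real ((norm m)\<^sup>2)"
  have c: "cmod c = cmod (cinner m z) / (norm m)\<^sup>2"
    by (simp add: c_def norm_divide norm_power)
  have "cinner z (c *\<^sub>C m) = c * cnj (cinner m z)"
    unfolding cinner_scaleC_right cinner_commute[of z m, symmetric] ..
  also have "\<dots> = cinner m z * cnj (cinner m z) / complex_of_real ((norm m)\<^sup>2)"
    by (simp add: c_def)
  also have "\<dots> = complex_of_real ((cmod (cinner m z))\<^sup>2 / (norm m)\<^sup>2)"
    unfolding complex_norm_square[symmetric] by simp
  finally have "cinner z (c *\<^sub>C m) = complex_of_real ((cmod (cinner m z))\<^sup>2 / (norm m)\<^sup>2)" .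
  moreover have "(norm (c *\<^sub>C m))\<^sup>2 = (cmod (cinner m z))\<^sup>2 / (norm m)\<^sup>2"
    using assms by (simp add: norm_scaleC c power_mult_distrib power_divide power2_eq_square)
  ultimately show ?thesis
    unfolding c_def[symmetric] norm_diff_square by simp
qed

lemma cauchy_schwarz: "cmod (cinner x y) \<le> norm x * norm y"
proof (cases "x = 0")
  case False
  have "0 \<le> (norm y)\<^sup>2 - (cmod (cinner x y))\<^sup>2 / (norm x)\<^sup>2"
    unfolding norm_minus_component_square[OF False, of y, symmetric] by simp
  then have "(cmod (cinner x y))\<^sup>2 \<le> (norm x * norm y)\<^sup>2"
    using False by (simp add: field_simps power_mult_distrib)
  then show ?thesis
    by (rule power2_le_imp_le) simp
qed simp

lemma bounded_clinear_cinner: "bounded_clinear (cinner x)"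
  by (rule bounded_clinearI[where C = "norm x"])
    (simp_all add: cinner_add_right cinner_scaleC_right cauchy_schwarz)

lemma bounded_bilinear_cinner: "bounded_bilinear cinner"
proof (rule bounded_bilinear.intro)
  show "cinner (r *\<^sub>R x) y = r *\<^sub>R cinner x y" for r and x y :: 'a
    using cinner_scaleC_left[of "complex_of_real r" x y] by (simp add: scaleC_of_real scaleR_conv_of_real)
  show "cinner x (r *\<^sub>R y) = r *\<^sub>R cinner x y" for r and x y :: 'a
    using cinner_scaleC_right[of x "complex_of_real r" y] by (simp add: scaleC_of_real scaleR_conv_of_real)
  show "\<exists>K. \<forall>x y :: 'a. norm (cinner x y) \<le> norm x * norm y * K"
    by (rule exI[of _ 1]) (simp add: cauchy_schwarz)
qed (simp_all add: cinner_add_left cinner_add_right)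

lemma norm_eq_sqrt_cinner: "norm x = sqrt (cmod (cinner x x))"
  by (simp add: cinner_self norm_power)

lemma norm_le_if_cinner_le:
  assumes "\<And>z. cmod (cinner z x) \<le> C * norm z" "C \<ge> 0"
  shows "norm x \<le> C"
proof (cases "x = 0")
  case False
  have "norm x * norm x \<le> C * norm x"
    using assms(1)[of x] by (simp add: cinner_self norm_mult power2_eq_square)
  then show ?thesis
    using False by simp
qed (use assms in simp)

text \<open>The parallelogram law makes a minimising sequence Cauchy, because the midpoint of two of
  its members lies in \<open>M\<close> and so has distance at least \<open>D\<close> from
  \<open>x\<close>.\<close>

lemma closest_point_exists:
  fixes M :: "'h::chilbert_space set"
  assumes M: "closed M" "subspace M"
  shows "\<exists>y\<in>M. \<forall>m\<in>M. norm (x - y) \<le> norm (x - m)"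
proof -
  define D where "D = infdist x M"
  have ne: "M \<noteq> {}"
    using subspace_0[OF M(2)] by auto
  have D_le: "D \<le> norm (x - m)" if "m \<in> M" for m
    using infdist_le[OF that, of x] by (simp add: D_def dist_norm)
  have D_ge: "0 \<le> D"
    by (simp add: D_def infdist_nonneg)
  have "\<exists>m\<in>M. norm (x - m) < D + 1 / (real n + 1)" for n :: nat
    using cINF_less_iff[of M "dist x" "D + 1 / (real n + 1)"] ne
    by (simp add: D_def infdist_def dist_norm[symmetric])
  then obtain y where y: "\<And>n. y n \<in> M" "\<And>n. norm (x - y n) < D + 1 / (real n + 1)"
    by metis
  have lim: "(\<lambda>n. norm (x - y n)) \<longlonglongrightarrow> D"
  proof (rule tendsto_sandwich[of "\<lambda>_. D" _ _ "\<lambda>n. D + 1 / (real n + 1)"])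
    show "(\<lambda>n. D + 1 / (real n + 1)) \<longlonglongrightarrow> D"
      using tendsto_add[OF tendsto_const LIMSEQ_inverse_real_of_nat, of D]
      by (simp add: inverse_eq_divide add.commute)
  qed (use D_le[OF y(1)] less_imp_le[OF y(2)] in \<open>auto intro!: always_eventually\<close>)
  have par: "(norm (y n - y k))\<^sup>2 \<le> 2 * (norm (x - y n))\<^sup>2 + 2 * (norm (x - y k))\<^sup>2 - 4 * D\<^sup>2" for n k
  proof -
    define a b where "a = x - y n" and "b = x - y k"
    have "(1/2) *\<^sub>R (y n + y k) \<in> M"
      using y M(2) by (intro subspace_scale subspace_add)
    then have "D \<le> norm (x - (1/2) *\<^sub>R (y n + y k))"
      by (rule D_le)
    also have "x - (1/2) *\<^sub>R (y n + y k) = (1/2) *\<^sub>R (a + b)"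
    proof -
      have "a + b = 2 *\<^sub>R x - (y n + y k)"
        by (simp add: a_def b_def scaleR_2)
      then show ?thesis
        by (simp add: scaleR_right_diff_distrib)
    qed
    finally have "2 * D \<le> norm (a + b)"
      by simp
    then have "(2 * D)\<^sup>2 \<le> (norm (a + b))\<^sup>2"
      using D_ge by (intro power_mono) auto
    moreover have "(norm (a + b))\<^sup>2 + (norm (b - a))\<^sup>2 = 2 * (norm a)\<^sup>2 + 2 * (norm b)\<^sup>2"
      unfolding norm_add_square norm_diff_square by (simp add: cinner_commute[of a b])
    moreover have "b - a = y n - y k"
      by (simp add: a_def b_def)
    ultimately show ?thesis
      by (simp add: a_def b_def power_mult_distrib)
  qed
  have "Cauchy y"
  proof (rule metric_CauchyI)
    fix e :: real
    assume "e > 0"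
    have "(\<lambda>n. (norm (x - y n))\<^sup>2) \<longlonglongrightarrow> D\<^sup>2"
      by (intro tendsto_intros lim)
    then have "\<forall>\<^sub>F n in sequentially. (norm (x - y n))\<^sup>2 < D\<^sup>2 + e\<^sup>2 / 4"
      using \<open>e > 0\<close> by (intro order_tendstoD) auto
    then obtain N where N: "\<And>n. n \<ge> N \<Longrightarrow> (norm (x - y n))\<^sup>2 < D\<^sup>2 + e\<^sup>2 / 4"
      by (auto simp: eventually_sequentially)
    have "dist (y m) (y n) < e" if "m \<ge> N" "n \<ge> N" for m n
    proof -
      have "(norm (y m - y n))\<^sup>2 < e\<^sup>2"
        using par[of m n] N[OF that(1)] N[OF that(2)] by linarith
      then show ?thesis
        using \<open>e > 0\<close> by (simp add: dist_norm power_less_imp_less_base)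
    qed
    then show "\<exists>N. \<forall>m\<ge>N. \<forall>n\<ge>N. dist (y m) (y n) < e"
      by blast
  qed
  then obtain z where z: "y \<longlonglongrightarrow> z"
    using Cauchy_convergent convergent_def by blast
  have "z \<in> M"
    using closed_sequentially[OF M(1) y(1) z] .
  moreover have "norm (x - z) = D"
    by (rule LIMSEQ_unique[OF _ lim]) (intro tendsto_intros z)
  ultimately show ?thesis
    using D_le by metis
qed

text \<open>If \<open>x - y\<close> had a component along some \<open>m\<close> in \<open>M\<close>,
  moving \<open>y\<close> by that component would shorten the distance. Stability under complex
  scalars keeps the moved point in \<open>M\<close>.\<close>

lemma orthogonal_projection_exists:
  fixes M :: "'h::chilbert_space set"
  assumes M: "closed M" "subspace M" and scale: "\<And>c m. m \<in> M \<Longrightarrow> c *\<^sub>C m \<in> M"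
  shows "\<exists>y\<in>M. \<forall>m\<in>M. cinner m (x - y) = 0"
proof -
  obtain y where y: "y \<in> M" "\<And>m. m \<in> M \<Longrightarrow> norm (x - y) \<le> norm (x - m)"
    using closest_point_exists[OF M] by blast
  have "cinner m (x - y) = 0" if m: "m \<in> M" for m
  proof (cases "m = 0")
    case False
    define c where "c = cinner m (x - y) / complex_of_real ((norm m)\<^sup>2)"
    have "norm (x - y) \<le> norm (x - (y + c *\<^sub>C m))"
      using M(2) y(1) m scale by (intro y(2) subspace_add) auto
    then have "(norm (x - y))\<^sup>2 \<le> (norm ((x - y) - c *\<^sub>C m))\<^sup>2"
      by (simp add: diff_diff_add power_mono)
    also have "\<dots> = (norm (x - y))\<^sup>2 - (cmod (cinner m (x - y)))\<^sup>2 / (norm m)\<^sup>2"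
      unfolding c_def by (rule norm_minus_component_square[OF False])
    finally have "(cmod (cinner m (x - y)))\<^sup>2 / (norm m)\<^sup>2 \<le> 0"
      by simp
    then show ?thesis
      using False by (simp add: divide_le_0_iff)
  qed simp
  then show ?thesis
    using y(1) by blast
qed

lemma subspace_closure:
  fixes S :: "'a::real_normed_vector set"
  assumes "subspace S"
  shows "subspace (closure S)"
proof (rule subspaceI)
  show "0 \<in> closure S"
    using subspace_0[OF assms] closure_subset by blast
  fix x assume "x \<in> closure S"
  then obtain f where f: "\<And>n. f n \<in> S" "f \<longlonglongrightarrow> x"
    unfolding closure_sequential by blast
  show "c *\<^sub>R x \<in> closure S" for c
    unfolding closure_sequential
    using f by (intro exI[of _ "\<lambda>n. c *\<^sub>R f n"]) (auto intro!: tendsto_intros subspace_scale[OF assms])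
  fix y assume "y \<in> closure S"
  then obtain g where g: "\<And>n. g n \<in> S" "g \<longlonglongrightarrow> y"
    unfolding closure_sequential by blast
  show "x + y \<in> closure S"
    unfolding closure_sequential
    using f g by (intro exI[of _ "\<lambda>n. f n + g n"]) (auto intro!: tendsto_intros subspace_add[OF assms])
qed

text \<open>The closed real span of a set stable under complex scalars is a complex subspace, and a
  vector minus its projection onto it is orthogonal to \<open>B\<close>. The criterion serves both
  for continuous functions and for elementary tensors.\<close>

lemma dense_span_if_orthogonal_trivial:
  fixes B :: "'h::chilbert_space set"
  assumes scale: "\<And>c b. b \<in> B \<Longrightarrow> c *\<^sub>C b \<in> B"
    and trivial: "\<And>z. (\<And>b. b \<in> B \<Longrightarrow> cinner b z = 0) \<Longrightarrow> z = 0"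
  shows "closure (span B) = UNIV"
proof -
  define M where "M = closure (span B)"
  have M: "closed M" "subspace M"
    by (auto simp: M_def intro: subspace_closure)
  have bl: "bounded_linear (\<lambda>x::'h. c *\<^sub>C x)" for c
    by (rule bounded_clinear_bounded_linear[OF bounded_clinear_scale[OF bounded_clinear_ident]])
  have sM: "c *\<^sub>C m \<in> M" if m: "m \<in> M" for c m
  proof -
    have "(\<lambda>x. c *\<^sub>C x) ` span B \<subseteq> span B"
      unfolding linear_span_image[OF bounded_linear.linear[OF bl], symmetric]
      by (rule span_mono) (auto intro: scale)
    then have "(\<lambda>x. c *\<^sub>C x) ` M \<subseteq> M"
      using closure_bounded_linear_image_subset[OF bl, of c "span B"] closure_mono
      unfolding M_def by blast
    then show ?thesis
      using m by blast
  qed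
  have "x \<in> M" for x
  proof -
    obtain y where y: "y \<in> M" "\<And>m. m \<in> M \<Longrightarrow> cinner m (x - y) = 0"
      using orthogonal_projection_exists[OF M sM] by blast
    have "x - y = 0"
    proof (rule trivial)
      fix b assume "b \<in> B"
      then have "b \<in> M"
        unfolding M_def using closure_subset span_base by blast
      then show "cinner b (x - y) = 0"
        by (rule y(2))
    qed
    then show ?thesis
      using y(1) by simp
  qed
  then show ?thesis
    unfolding M_def by blast
qed

text \<open>A vector \<open>z\<close> orthogonal to the kernel spans its complement:
  \<open>x - (\<phi> x / \<phi> z) z\<close> lies in the kernel, so pairing with \<open>z\<close>
  determines \<open>\<phi> x\<close>.\<close>

lemma riesz_representation:
  fixes \<phi> :: "'h::chilbert_space \<Rightarrow> complex"
  assumes \<phi>: "bounded_clinear \<phi>"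
  shows "\<exists>w. \<forall>x. \<phi> x = cinner w x"
proof (cases "\<forall>x. \<phi> x = 0")
  case False
  then obtain x0 where x0: "\<phi> x0 \<noteq> 0" by blast
  define M where "M = {x. \<phi> x = 0}"
  have bl: "bounded_linear \<phi>"
    using \<phi> by (rule bounded_clinear_bounded_linear)
  have M: "closed M"
    unfolding M_def
    by (intro closed_Collect_eq continuous_on_const bounded_linear.continuous_on[OF bl] continuous_on_id)
  have M': "subspace M"
    unfolding M_def by (rule linear_subspace_kernel[OF bounded_linear.linear[OF bl]])
  have scale: "c *\<^sub>C m \<in> M" if "m \<in> M" for c m
    using that by (simp add: M_def bounded_clinear_scaleC[OF \<phi>])
  obtain y where y: "y \<in> M" "\<And>m. m \<in> M \<Longrightarrow> cinner m (x0 - y) = 0"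
    using orthogonal_projection_exists[OF M M' scale] by blast
  define z where "z = x0 - y"
  have \<phi>z: "\<phi> z \<noteq> 0"
    using y(1) x0 by (simp add: z_def M_def bounded_clinear_diff[OF \<phi>])
  then have "z \<noteq> 0"
    using bounded_clinear_zero[OF \<phi>] by auto
  have "\<phi> x = cinner ((cnj (\<phi> z) / complex_of_real ((norm z)\<^sup>2)) *\<^sub>C z) x" for x
  proof -
    have "x - (\<phi> x / \<phi> z) *\<^sub>C z \<in> M"
      using \<phi>z by (simp add: M_def bounded_clinear_diff[OF \<phi>] bounded_clinear_scaleC[OF \<phi>])
    then have "cinner z (x - (\<phi> x / \<phi> z) *\<^sub>C z) = 0"
      using y(2) cinner_commute[of z] unfolding z_def by (metis complex_cnj_zero)
    then have "cinner z x = (\<phi> x / \<phi> z) * complex_of_real ((norm z)\<^sup>2)"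
      by (simp add: cinner_diff_right cinner_scaleC_right cinner_self)
    then show ?thesis
      using \<phi>z \<open>z \<noteq> 0\<close> by (simp add: cinner_scaleC_left)
  qed
  then show ?thesis
    by blast
qed (auto intro: exI[of _ 0])

text \<open>The choice is justified by the Riesz theorem when \<open>T\<close> is bounded and
  complex-linear; outside that case the value has no meaning.\<close>

definition cadjoint :: "('h::chilbert_space \<Rightarrow> 'k::chilbert_space) \<Rightarrow> 'k \<Rightarrow> 'h"
  where "cadjoint T x = (SOME w. \<forall>y. cinner x (T y) = cinner w y)"

lemma cinner_cadjoint_left:
  assumes "bounded_clinear T"
  shows "cinner (cadjoint T x) y = cinner x (T y)"
proof -
  have ex: "\<exists>w. \<forall>y. cinner x (T y) = cinner w y"
    by (rule riesz_representation) (rule bounded_clinear_compose[OF bounded_clinear_cinner assms])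
  show ?thesis
    unfolding cadjoint_def by (rule someI_ex[OF ex, THEN spec, symmetric])
qed

lemma cinner_cadjoint_right:
  assumes "bounded_clinear T"
  shows "cinner y (cadjoint T x) = cinner (T y) x"
  using cinner_cadjoint_left[OF assms, of x y]
  unfolding cinner_commute[of y "cadjoint T x"] cinner_commute[of "T y" x] by simp

lemma bounded_clinear_cadjoint:
  assumes T: "bounded_clinear T"
  shows "bounded_clinear (cadjoint T)"
proof -
  obtain C where C: "C > 0" "\<And>x. norm (T x) \<le> C * norm x"
    using bounded_clinear_bound[OF T] by blast
  show ?thesis
  proof (rule bounded_clinearI[where C = C])
    show "cadjoint T (x + y) = cadjoint T x + cadjoint T y" for x y
      by (rule cinner_eqI) (simp add: cinner_add_right cinner_cadjoint_right[OF T])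
    show "cadjoint T (c *\<^sub>C x) = c *\<^sub>C cadjoint T x" for c x
      by (rule cinner_eqI) (simp add: cinner_scaleC_right cinner_cadjoint_right[OF T])
    show "norm (cadjoint T x) \<le> C * norm x" for x
    proof (rule norm_le_if_cinner_le)
      fix z
      have "cmod (cinner z (cadjoint T x)) \<le> norm (T z) * norm x"
        by (simp add: cinner_cadjoint_right[OF T] cauchy_schwarz)
      also have "\<dots> \<le> C * norm z * norm x"
        by (intro mult_right_mono C) simp
      finally show "cmod (cinner z (cadjoint T x)) \<le> C * norm x * norm z"
        by (simp add: ac_simps)
    qed (use C in simp)
  qed
qed

lemma cadjoint_eqI:
  assumes "bounded_clinear T" "\<And>x y. cinner (S x) y = cinner x (T y)"
  shows "cadjoint T = S"
proof
  fix x
  show "cadjoint T x = S x"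
  proof (rule cinner_eqI)
    fix y
    show "cinner y (cadjoint T x) = cinner y (S x)"
      unfolding cinner_cadjoint_right[OF assms(1)] cinner_commute[of y "S x"] assms(2)
      by (rule cinner_commute)
  qed
qed

section \<open>Hilbert modules\<close>

lemma bounded_linear_star: "bounded_linear (star :: 'a::cstar_algebra \<Rightarrow> 'a)"
proof (rule bounded_linear_intro[where K = 1])
  show "star (r *\<^sub>R x) = r *\<^sub>R star x" for r and x :: 'a
    using star_scaleC[of "complex_of_real r" x] by (simp add: scaleC_of_real)
qed (simp_all add: star_add norm_star)

lemma star_zero [simp]: "star 0 = (0 :: 'a::cstar_algebra)"
  by (rule linear_0[OF bounded_linear.linear[OF bounded_linear_star]])

lemma star_one [simp]: "star 1 = (1 :: 'a::cstar_algebra)"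
  using star_mult[of "star 1" "1 :: 'a"] by (simp add: star_star)

lemma bounded_clinear_scaleC_self: "bounded_clinear (\<lambda>x. c *\<^sub>C x)"
  by (rule bounded_clinear_scale[OF bounded_clinear_ident])

lemma bounded_linear_scaleC: "bounded_linear (\<lambda>x. c *\<^sub>C x)"
  by (rule bounded_clinear_bounded_linear[OF bounded_clinear_scaleC_self])

context hilbert_module
begin

lemma ip_add_left: "ip (v + w) u = ip v u + ip w u"
  by (subst (1 2 3) ip_commute) (simp add: ip_add_right star_add)

lemma ip_scaleC_left: "ip (c *\<^sub>C v) w = cnj c *\<^sub>C ip v w"
  by (subst (1 2) ip_commute) (simp add: ip_scaleC_right star_scaleC)

lemma ip_act_left: "ip (act v a) w = star a * ip v w"
  by (subst (1 2) ip_commute) (simp add: ip_act_right star_mult)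

lemma ip_zero_right [simp]: "ip v 0 = 0"
  using ip_scaleC_right[of v 0 0] by simp

lemma ip_zero_left [simp]: "ip 0 v = 0"
  using ip_scaleC_left[of 0 0 v] by simp

lemma ip_diff_right: "ip v (w - u) = ip v w - ip v u"
  using ip_add_right[of v w "(-1) *\<^sub>C u"] ip_scaleC_right[of v "-1" u]
  by (simp add: scaleC_minus_one)

lemma ip_diff_left: "ip (v - w) u = ip v u - ip w u"
  using ip_add_left[of v "(-1) *\<^sub>C w" u] ip_scaleC_left[of "-1" w u]
  by (simp add: scaleC_minus_one)

lemma ip_self_eq_zero: "ip v v = 0 \<longleftrightarrow> v = 0"
  using norm_ip[of v] by auto

text \<open>The inner products on the right are diagonal, so \<open>norm_ip\<close> turns their
  norms into squares of norms of vectors. This leads to a bound on \<open>ip v w\<close> without the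
  order of the C*-algebra.\<close>

lemma ip_polarization: "4 *\<^sub>C ip v w =
    ip (v + w) (v + w) - ip (v - w) (v - w)
    - (\<i> *\<^sub>C ip (v + \<i> *\<^sub>C w) (v + \<i> *\<^sub>C w) - \<i> *\<^sub>C ip (v - \<i> *\<^sub>C w) (v - \<i> *\<^sub>C w))"
proof -
  have two: "4 *\<^sub>C x = (x + x) + (x + x)" for x :: 'a
    using scaleC_of_real[of 4 x] by (simp add: scaleR_2[symmetric])
  have neg: "- (1 *\<^sub>C x) = - x" "(- 1) *\<^sub>C x = - x" for x :: 'a
    by (simp_all add: scaleC_minus_one)
  have diff: "c *\<^sub>C (x - y) = c *\<^sub>C x - c *\<^sub>C y" for c and x y :: 'a
    by (rule bounded_clinear_diff[OF bounded_clinear_scaleC_self])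
  show ?thesis
    by (simp add: two ip_add_left ip_add_right ip_diff_left ip_diff_right ip_scaleC_left
        ip_scaleC_right scaleC_add_right diff scaleC_scaleC neg)
qed

lemma norm_ip_le_square: "norm (ip v w) \<le> (norm v + norm w)\<^sup>2"
proof -
  have sq: "norm (ip x x) \<le> (norm v + norm w)\<^sup>2" if "norm x \<le> norm v + norm w" for x
    using that by (simp add: norm_ip[symmetric] power_mono)
  have "4 * norm (ip v w) = norm (4 *\<^sub>C ip v w)"
    by (simp add: norm_scaleC)
  also have "\<dots> \<le> (norm (ip (v + w) (v + w)) + norm (ip (v - w) (v - w)))
      + (norm (\<i> *\<^sub>C ip (v + \<i> *\<^sub>C w) (v + \<i> *\<^sub>C w))
        + norm (\<i> *\<^sub>C ip (v - \<i> *\<^sub>C w) (v - \<i> *\<^sub>C w)))"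
    unfolding ip_polarization
    by (intro order_trans[OF norm_triangle_ineq4] add_mono) simp_all
  also have "\<dots> \<le> ((norm v + norm w)\<^sup>2 + (norm v + norm w)\<^sup>2)
      + ((norm v + norm w)\<^sup>2 + (norm v + norm w)\<^sup>2)"
    unfolding norm_scaleC
    using norm_triangle_ineq[of v "\<i> *\<^sub>C w"] norm_triangle_ineq4[of v "\<i> *\<^sub>C w"]
    by (intro add_mono) (auto simp: norm_scaleC norm_triangle_ineq norm_triangle_ineq4 intro!: sq)
  finally show ?thesis
    by simp
qed

text \<open>Scaling both vectors to norm 1 turns the preceding bound into
  \<open>(1 + 1)^2 = 4\<close>. The sharp constant is 1, but continuity and the growth argument for
  amplifications tolerate any constant.\<close>

lemma norm_ip_le: "norm (ip v w) \<le> 4 * norm v * norm w"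
proof (cases "v = 0 \<or> w = 0")
  case False
  define a where "a = complex_of_real (inverse (norm v))"
  define b where "b = complex_of_real (inverse (norm w))"
  have "norm (ip (a *\<^sub>C v) (b *\<^sub>C w)) \<le> (norm (a *\<^sub>C v) + norm (b *\<^sub>C w))\<^sup>2"
    by (rule norm_ip_le_square)
  also have "\<dots> = 4"
    using False by (simp add: norm_scaleC a_def b_def norm_inverse power2_eq_square)
  finally show ?thesis
    using False
    by (simp add: ip_scaleC_left ip_scaleC_right norm_scaleC a_def b_def norm_divide divide_inverse[symmetric] field_simps)
qed auto

lemma bounded_bilinear_ip: "bounded_bilinear ip"
proof (rule bounded_bilinear.intro)
  show "ip (r *\<^sub>R x) y = r *\<^sub>R ip x y" for r x y
    using ip_scaleC_left[of "complex_of_real r" x y] by (simp add: scaleC_of_real)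
  show "ip x (r *\<^sub>R y) = r *\<^sub>R ip x y" for r x y
    using ip_scaleC_right[of x "complex_of_real r" y] by (simp add: scaleC_of_real)
  show "\<exists>K. \<forall>x y. norm (ip x y) \<le> norm x * norm y * K"
    by (rule exI[of _ 4]) (use norm_ip_le in \<open>simp add: ac_simps\<close>)
qed (simp_all add: ip_add_left ip_add_right)

lemma bounded_clinear_ip: "bounded_clinear (ip v)"
  by (rule bounded_clinearI[where C = "4 * norm v"])
    (simp_all add: ip_add_right ip_scaleC_right norm_ip_le)

lemma bounded_linear_ip_right: "bounded_linear (ip v)"
  by (rule bounded_clinear_bounded_linear[OF bounded_clinear_ip])

lemma bounded_linear_ip_left: "bounded_linear (\<lambda>v. ip v w)"
  by (rule bounded_bilinear.bounded_linear_left[OF bounded_bilinear_ip])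

lemma module_eqI:
  assumes dense: "closure (span B) = UNIV" and eq: "\<And>b. b \<in> B \<Longrightarrow> ip b v = ip b w"
  shows "v = w"
proof -
  have "ip x v = ip x w" for x
    by (rule bounded_linear_eqI[OF bounded_linear_ip_left bounded_linear_ip_left dense eq])
  then have "ip (v - w) (v - w) = 0"
    by (simp add: ip_diff_right)
  then show ?thesis
    by (simp add: ip_self_eq_zero)
qed

lemma norm_eq_if_ip_eq: "ip v v = r *\<^sub>R a \<Longrightarrow> norm v = sqrt (\<bar>r\<bar> * norm a)"
  using norm_ip[of v] by (metis norm_ge_zero norm_scaleR real_sqrt_unique)

lemma norm_act_le: "norm (act v a) \<le> norm v * norm a"
proof -
  have "(norm (act v a))\<^sup>2 = norm (star a * (ip v v * a))"
    by (simp add: norm_ip ip_act_left ip_act_right mult.assoc)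
  also have "\<dots> \<le> norm a * (norm (ip v v) * norm a)"
    by (intro norm_mult_ineq[THEN order_trans] mult_mono) (auto simp: norm_star norm_mult_ineq)
  also have "\<dots> = (norm v * norm a)\<^sup>2"
    by (simp add: norm_ip[symmetric] power2_eq_square)
  finally show ?thesis
    by (rule power2_le_imp_le) simp
qed

lemma bounded_clinear_act: "bounded_clinear (\<lambda>v. act v a)"
  by (rule bounded_clinearI[where C = "norm a"])
    (simp_all add: act_add_left act_scaleC_left norm_act_le mult.commute[of "norm a"])

lemma bounded_linear_act: "bounded_linear (\<lambda>v. act v a)"
  by (rule bounded_clinear_bounded_linear[OF bounded_clinear_act])

lemma ip_sum_list:
  "ip (sum_list (map u l)) (sum_list (map w m)) =
    (\<Sum>i\<leftarrow>l. \<Sum>j\<leftarrow>m. ip (u i) (w j))"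
proof -
  have "ip v (sum_list (map w m)) = (\<Sum>j\<leftarrow>m. ip v (w j))" for v
    by (induction m) (simp_all add: ip_add_right)
  then show ?thesis
    by (induction l) (simp_all add: ip_add_left sum_list_addf)
qed

end

text \<open>Preservation of inner products up to the factor \<open>r\<close> yields the norm bound
  on finite sums at once. It is used with \<open>r = (norm \<xi>)^2\<close> for inserting a fixed
  vector and with \<open>r = 1\<close> for leg-numbered unitaries.\<close>

lemma ip_scaled_extension:
  fixes u :: "'i \<Rightarrow> 'e::{complex_normed_vector,banach}" and v :: "'i \<Rightarrow> 'f::{complex_normed_vector,banach}"
  assumes E: "hilbert_module act ip" and F: "hilbert_module act2 ip2"
    and scale: "\<And>c i. \<exists>j. u j = c *\<^sub>C u i \<and> v j = c *\<^sub>C v i"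
    and ip: "\<And>i j. ip2 (v i) (v j) = r *\<^sub>R ip (u i) (u j)"
    and dense: "closure (span (range u)) = UNIV"
  shows "extends_to u v (extension u v)"
    and "ip2 (extension u v x) (extension u v y) = r *\<^sub>R ip x y"
proof -
  interpret E: hilbert_module act ip by fact
  interpret F: hilbert_module act2 ip2 by fact
  have lists: "ip2 (sum_list (map v l)) (sum_list (map v m)) = r *\<^sub>R ip (sum_list (map u l)) (sum_list (map u m))" for l m
    unfolding E.ip_sum_list F.ip_sum_list ip
  proof (induction l)
    case (Cons i l)
    have "(\<Sum>j\<leftarrow>m. r *\<^sub>R ip (u i) (u j)) = r *\<^sub>R (\<Sum>j\<leftarrow>m. ip (u i) (u j))"
      by (induction m) (simp_all add: scaleR_right_distrib)
    with Cons show ?case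
      by (simp add: scaleR_right_distrib)
  qed simp
  have "norm (sum_list (map v l)) \<le> sqrt \<bar>r\<bar> * norm (sum_list (map u l))" for l
    using F.norm_eq_if_ip_eq[OF lists[of l l]]
    by (simp add: E.norm_ip[symmetric] real_sqrt_mult)
  then have "\<exists>T. extends_to u v T"
    by (rule extends_to_exists[OF scale _ dense])
  then show ext: "extends_to u v (extension u v)"
    using extends_to_extension dense by blast
  define T where "T = extension u v"
  have T: "bounded_linear T" and Tu: "T (u i) = v i" for i
    using ext by (auto simp: T_def extends_to_def bounded_clinear_def)
  have 1: "ip2 (T (u i)) (T y) = r *\<^sub>R ip (u i) y" for i y
  proof (rule bounded_linear_eqI[OF _ _ dense, of "\<lambda>y. ip2 (T (u i)) (T y)" "\<lambda>y. r *\<^sub>R ip (u i) y"])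
    show "bounded_linear (\<lambda>y. ip2 (T (u i)) (T y))"
      by (rule bounded_linear_compose[OF F.bounded_linear_ip_right T])
    show "bounded_linear (\<lambda>y. r *\<^sub>R ip (u i) y)"
      by (rule bounded_linear_compose[OF bounded_linear_scaleR_right
            E.bounded_linear_ip_right])
  qed (auto simp: Tu ip)
  have "ip2 (T x) (T y) = r *\<^sub>R ip x y"
  proof (rule bounded_linear_eqI[OF _ _ dense, of "\<lambda>x. ip2 (T x) (T y)" "\<lambda>x. r *\<^sub>R ip x y"])
    show "bounded_linear (\<lambda>x. ip2 (T x) (T y))"
      by (rule bounded_linear_compose[OF F.bounded_linear_ip_left T])
    show "bounded_linear (\<lambda>x. r *\<^sub>R ip x y)"
      by (rule bounded_linear_compose[OF bounded_linear_scaleR_right E.bounded_linear_ip_left])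
  qed (use 1 in auto)
  then show "ip2 (extension u v x) (extension u v y) = r *\<^sub>R ip x y"
    by (simp add: T_def)
qed

section \<open>Elementary tensors and the operators \<open>s \<otimes> 1\<close>\<close>

context hilbert_tensor
begin

lemma norm_tens: "norm (tens \<xi> a) = norm \<xi> * norm a"
proof -
  have "(norm (tens \<xi> a))\<^sup>2 = (norm \<xi> * norm a)\<^sup>2"
    by (simp add: norm_ip ip_tens norm_scaleC cinner_self norm_power cstar_identity power_mult_distrib)
  then show ?thesis
    by simp
qed

lemma bounded_clinear_tens_left: "bounded_clinear (\<lambda>\<xi>. tens \<xi> a)"
  by (rule bounded_clinearI[where C = "norm a"])
    (simp_all add: tens_add_left tens_scaleC_left norm_tens)

lemma bounded_linear_tens_left: "bounded_linear (\<lambda>\<xi>. tens \<xi> a)"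
  by (rule bounded_clinear_bounded_linear[OF bounded_clinear_tens_left])

lemma tens_eq_act: "tens \<xi> a = act (tens \<xi> 1) a"
  by (simp add: act_tens)

lemma ip_tens_left: "ip (tens \<xi> a) v = star a * ip (tens \<xi> 1) v"
  by (subst tens_eq_act) (rule ip_act_left)

lemma tens_scale: "\<exists>q. (case q of (\<xi>, a) \<Rightarrow> tens \<xi> a) = c *\<^sub>C (case p of (\<xi>, a) \<Rightarrow> tens \<xi> a) \<and>
    (case q of (\<xi>, a) \<Rightarrow> tens (s \<xi>) a) = c *\<^sub>C (case p of (\<xi>, a) \<Rightarrow> tens (s \<xi>) a)"
  by (rule exI[of _ "(fst p, c *\<^sub>C snd p)"]) (cases p, simp add: tens_scaleC_right)

lemma module_eqI_tens:
  assumes "\<And>\<xi>. ip (tens \<xi> 1) v = ip (tens \<xi> 1) w"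
  shows "v = w"
proof (rule module_eqI[OF tens_dense])
  fix b assume "b \<in> range (\<lambda>(\<xi>, a). tens \<xi> a)"
  then obtain \<xi> a where b: "b = tens \<xi> a" by auto
  show "ip b v = ip b w"
    unfolding b ip_tens_left[of \<xi> a] assms ..
qed

text \<open>The power trick replaces the usual appeal to positivity: with \<open>h = s* s\<close> and
  \<open>x\<^sub>n = \<parallel>(h\<^sup>n \<otimes> 1) v\<parallel>\<close> one has \<open>x\<^sub>n\<^sup>2 \<le> 4 x\<^sub>0 x\<^sub>2\<^sub>n\<close>, while any fixed expression of \<open>v\<close> as a sum of
  elementary tensors bounds \<open>x\<^sub>n\<close> by a multiple of \<open>\<parallel>s\<parallel>\<^sup>2\<^sup>n\<close>.\<close>

lemma amplification_list_bound:
  fixes s :: "'h \<Rightarrow> 'h"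
  assumes s: "bounded_clinear s" and bound: "\<And>\<xi>. norm (s \<xi>) \<le> C * norm \<xi>" and C: "C > 0"
  shows "norm (\<Sum>(\<xi>, a)\<leftarrow>l. tens (s \<xi>) a) \<le> 4 * C * norm (\<Sum>(\<xi>, a)\<leftarrow>l. tens \<xi> a)"
proof -
  define S where "S t = (\<Sum>(\<xi>, a)\<leftarrow>l. tens (t \<xi>) a)" for t :: "'h \<Rightarrow> 'h"
  define h where "h \<xi> = cadjoint s (s \<xi>)" for \<xi>
  define K where "K = (\<Sum>(\<xi>, a)\<leftarrow>l. norm \<xi> * norm a)"
  define x where "x n = norm (S (h ^^ n))" for n
  have ipS: "ip (S t) (S t') = (\<Sum>(\<xi>, a)\<leftarrow>l. \<Sum>(\<eta>, b)\<leftarrow>l. cinner (t \<xi>) (t' \<eta>) *\<^sub>C (star a * b))" for t t'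
    unfolding S_def ip_sum_list by (simp add: case_prod_unfold ip_tens)
  have h: "cinner (h \<xi>) \<eta> = cinner (s \<xi>) (s \<eta>)" "cinner \<xi> (h \<eta>) = cinner (s \<xi>) (s \<eta>)" for \<xi> \<eta>
    unfolding h_def by (simp_all add: cinner_cadjoint_left[OF s] cinner_cadjoint_right[OF s])
  have h_pow: "cinner ((h ^^ n) \<xi>) ((h ^^ m) \<eta>) = cinner \<xi> ((h ^^ (n + m)) \<eta>)" for n m \<xi> \<eta>
  proof (induction n arbitrary: m)
    case (Suc n)
    have "cinner ((h ^^ Suc n) \<xi>) ((h ^^ m) \<eta>) = cinner ((h ^^ n) \<xi>) ((h ^^ Suc m) \<eta>)"
      by (simp add: h)
    then show ?case
      unfolding Suc[of "Suc m"] by simp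
  qed simp
  have ip_pow: "ip (S (h ^^ n)) (S (h ^^ n)) = ip (S (h ^^ 0)) (S (h ^^ (2 * n)))" for n
    by (simp add: ipS h_pow mult_2)
  have x_ge: "x n \<ge> 0" for n
    by (simp add: x_def)
  have x_double: "(x n)\<^sup>2 \<le> 4 * x 0 * x (2 * n)" for n
    unfolding x_def norm_ip ip_pow by (rule norm_ip_le)
  have s_x: "(norm (S s))\<^sup>2 \<le> 4 * x 0 * x 1"
  proof -
    have "ip (S s) (S s) = ip (S (h ^^ 0)) (S (h ^^ 1))"
      by (simp add: ipS h)
    then show ?thesis
      unfolding norm_ip x_def using norm_ip_le by metis
  qed
  have h_bound: "norm (h \<xi>) \<le> C\<^sup>2 * norm \<xi>" for \<xi>
  proof (rule norm_le_if_cinner_le)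
    fix z
    have "cmod (cinner z (h \<xi>)) \<le> norm (s z) * norm (s \<xi>)"
      by (simp add: h cauchy_schwarz)
    also have "\<dots> \<le> (C * norm z) * (C * norm \<xi>)"
      by (intro mult_mono bound) (use C in auto)
    finally show "cmod (cinner z (h \<xi>)) \<le> C\<^sup>2 * norm \<xi> * norm z"
      by (simp add: power2_eq_square ac_simps)
  qed simp
  have pow_bound: "norm ((h ^^ n) \<xi>) \<le> (C\<^sup>2) ^ n * norm \<xi>" for n \<xi>
  proof (induction n)
    case (Suc n)
    have "norm ((h ^^ Suc n) \<xi>) \<le> C\<^sup>2 * norm ((h ^^ n) \<xi>)"
      by (simp add: h_bound)
    also have "\<dots> \<le> C\<^sup>2 * ((C\<^sup>2) ^ n * norm \<xi>)"
      by (intro mult_left_mono Suc) simp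
    finally show ?case
      by (simp add: mult.assoc)
  qed simp
  have K_bound: "x n \<le> (C\<^sup>2) ^ n * K" for n
  proof -
    have "norm (\<Sum>(\<xi>, a)\<leftarrow>m. tens ((h ^^ n) \<xi>) a) \<le> (C\<^sup>2) ^ n * (\<Sum>(\<xi>, a)\<leftarrow>m. norm \<xi> * norm a)" for m
    proof (induction m)
      case (Cons p m)
      obtain \<xi> a where p: "p = (\<xi>, a)" by (cases p)
      have "norm (tens ((h ^^ n) \<xi>) a) \<le> (C\<^sup>2) ^ n * (norm \<xi> * norm a)"
        unfolding norm_tens using mult_right_mono[OF pow_bound[of n \<xi>] norm_ge_zero[of a]]
        by (simp add: mult.assoc)
      with Cons show ?case
        by (simp add: p distrib_left) (smt (verit) norm_triangle_ineq)
    qed simp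
    then show ?thesis
      by (simp add: x_def S_def K_def)
  qed
  have "x 1 \<le> 4 * C\<^sup>2 * x 0"
  proof (cases "x 0 = 0")
    case True
    then show ?thesis
      using x_double[of 1] by simp
  next
    case False
    then have pos: "x 0 > 0"
      using x_ge[of 0] by simp
    \<comment> \<open>Dividing by \<open>4 * x 0\<close> absorbs the constant of the doubling
      estimate, which becomes \<open>(y n)^2 \<le> y (2 * n)\<close> and can be iterated along
      powers of two.\<close>
    define y where "y n = x n / (4 * x 0)" for n
    have y_ge: "y n \<ge> 0" for n
      using x_ge pos by (simp add: y_def)
    have y_double: "(y n)\<^sup>2 \<le> y (2 * n)" for n
      using x_double[of n] pos by (simp add: y_def power_divide field_simps power2_eq_square)
    have y_pow: "y 1 ^ (2 ^ k) \<le> y (2 ^ k)" for k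
    proof (induction k)
      case (Suc k)
      have "y 1 ^ (2 ^ Suc k) = (y 1 ^ (2 ^ k))\<^sup>2"
        by (simp add: power_mult[symmetric] mult.commute)
      also have "\<dots> \<le> (y (2 ^ k))\<^sup>2"
        using Suc y_ge by (intro power_mono) auto
      also have "\<dots> \<le> y (2 ^ Suc k)"
        using y_double[of "2 ^ k"] by simp
      finally show ?case .
    qed simp
    \<comment> \<open>If \<open>y 1\<close> exceeded \<open>C^2\<close>, its powers would outgrow
      those of \<open>C^2\<close> by an unbounded factor, against the crude bound
      \<open>K_bound\<close>.\<close>
    have "y 1 \<le> C\<^sup>2"
    proof (rule ccontr)
      assume "\<not> y 1 \<le> C\<^sup>2"
      then have gt: "1 < y 1 / C\<^sup>2"
        using C by simp
      then obtain k where k: "K / (4 * x 0) < (y 1 / C\<^sup>2) ^ k"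
        using real_arch_pow by blast
      have "(y 1 / C\<^sup>2) ^ k \<le> (y 1 / C\<^sup>2) ^ (2 ^ k)"
        using gt less_exp[of k] by (intro power_increasing) auto
      also have "\<dots> = y 1 ^ (2 ^ k) / (C\<^sup>2) ^ (2 ^ k)"
        by (rule power_divide)
      also have "\<dots> \<le> y (2 ^ k) / (C\<^sup>2) ^ (2 ^ k)"
        using y_pow by (intro divide_right_mono) auto
      also have "\<dots> \<le> K / (4 * x 0)"
        using K_bound[of "2 ^ k"] pos C by (simp add: y_def field_simps)
      finally show False
        using k by simp
    qed
    then show ?thesis
      using pos by (simp add: y_def field_simps)
  qed
  then have "(norm (S s))\<^sup>2 \<le> 4 * x 0 * (4 * C\<^sup>2 * x 0)"
    using s_x x_ge[of 0] by (smt (verit) mult_left_mono)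
  also have "\<dots> = (4 * C * x 0)\<^sup>2"
    by (simp add: power2_eq_square)
  finally have le: "(norm (S s))\<^sup>2 \<le> (4 * C * x 0)\<^sup>2" .
  have "norm (S s) \<le> 4 * C * x 0"
    by (rule power2_le_imp_le[OF le]) (use C x_ge[of 0] in simp)
  then show ?thesis
    by (simp add: x_def S_def)
qed

lemma amplification_extends:
  assumes s: "bounded_clinear s"
  shows "extends_to (\<lambda>(\<xi>, a). tens \<xi> a) (\<lambda>(\<xi>, a). tens (s \<xi>) a) (amplification tens s)"
proof -
  obtain C where C: "C > 0" "\<And>\<xi>. norm (s \<xi>) \<le> C * norm \<xi>"
    using bounded_clinear_bound[OF s] by blast
  have "\<exists>T. extends_to (\<lambda>(\<xi>, a). tens \<xi> a) (\<lambda>(\<xi>, a). tens (s \<xi>) a) T"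
    by (rule extends_to_exists[OF tens_scale amplification_list_bound[OF s C(2) C(1)] tens_dense])
  then show ?thesis
    unfolding amplification_def using extends_to_extension tens_dense by blast
qed

lemma bounded_clinear_amplification: "bounded_clinear s \<Longrightarrow> bounded_clinear (amplification tens s)"
  using amplification_extends by (simp add: extends_to_def)

lemma bounded_linear_amplification: "bounded_clinear s \<Longrightarrow> bounded_linear (amplification tens s)"
  using bounded_clinear_amplification by (rule bounded_clinear_bounded_linear)

lemma amplification_tens: "bounded_clinear s \<Longrightarrow> amplification tens s (tens \<xi> a) = tens (s \<xi>) a"
  using amplification_extends by (auto simp: extends_to_def)

lemma eq_on_tens:
  assumes "bounded_linear T" "bounded_linear S" "\<And>\<xi> a. T (tens \<xi> a) = S (tens \<xi> a)"
  shows "T v = S v"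
  by (rule bounded_linear_eqI[OF assms(1,2) tens_dense]) (use assms(3) in auto)

lemma amplification_eqI:
  assumes "bounded_clinear s" "bounded_linear T" "\<And>\<xi> a. T (tens \<xi> a) = tens (s \<xi>) a"
  shows "amplification tens s v = T v"
  by (rule eq_on_tens[OF bounded_linear_amplification[OF assms(1)] assms(2)])
    (simp add: assms amplification_tens)

lemma amplification_compose:
  assumes s: "bounded_clinear s" and t: "bounded_clinear t"
  shows "amplification tens (\<lambda>\<xi>. s (t \<xi>)) v = amplification tens s (amplification tens t v)"
  by (rule amplification_eqI[OF bounded_clinear_compose[OF s t]
        bounded_linear_compose[OF bounded_linear_amplification[OF s] bounded_linear_amplification[OF t]]])
    (simp add: amplification_tens s t)

lemma amplification_ident: "amplification tens (\<lambda>\<xi>. \<xi>) v = v"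
  by (rule amplification_eqI[OF bounded_clinear_ident bounded_linear_ident]) simp

lemma amplification_plus:
  assumes s: "bounded_clinear s" and t: "bounded_clinear t"
  shows "amplification tens (\<lambda>\<xi>. s \<xi> + t \<xi>) v = amplification tens s v + amplification tens t v"
  by (rule amplification_eqI[OF bounded_clinear_plus[OF s t]
        bounded_linear_add[OF bounded_linear_amplification[OF s] bounded_linear_amplification[OF t]]])
    (simp add: amplification_tens s t tens_add_left)

lemma amplification_scale:
  assumes s: "bounded_clinear s"
  shows "amplification tens (\<lambda>\<xi>. c *\<^sub>C s \<xi>) v = c *\<^sub>C amplification tens s v"
  by (rule amplification_eqI[OF bounded_clinear_scale[OF s]
        bounded_linear_compose[OF bounded_linear_scaleC
          bounded_linear_amplification[OF s]]])
    (simp add: amplification_tens s tens_scaleC_left)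

text \<open>The estimate on finite sums of elementary tensors passes to limits. Its explicit
  constant makes \<open>M f x\<close> bounded in \<open>f\<close>, which later permits reducing
  identities to functions \<open>p \<otimes> q\<close>.\<close>

lemma amplification_bound:
  assumes s: "bounded_clinear s" and bound: "\<And>\<xi>. norm (s \<xi>) \<le> C * norm \<xi>" and C: "C > 0"
  shows "norm (amplification tens s v) \<le> 4 * C * norm v"
proof -
  let ?A = "amplification tens s"
  have le: "norm (?A v) - 4 * C * norm v \<le> 0" if v: "v \<in> span (range (\<lambda>(\<xi>, a). tens \<xi> a))" for v
  proof -
    have "\<exists>j. (case j of (\<xi>, a) \<Rightarrow> tens \<xi> a) = r *\<^sub>R (case i of (\<xi>, a) \<Rightarrow> tens \<xi> a)" for r i
      using tens_scale[where c = "complex_of_real r" and p = i and s = "\<lambda>\<xi>. \<xi>"]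
      unfolding scaleC_of_real by blast
    then obtain l where l: "v = (\<Sum>(\<xi>, a)\<leftarrow>l. tens \<xi> a)"
      using v span_scale_closed_sum_list[of "\<lambda>(\<xi>, a). tens \<xi> a" v] by auto
    have "?A (\<Sum>(\<xi>, a)\<leftarrow>l. tens \<xi> a) = (\<Sum>(\<xi>, a)\<leftarrow>l. tens (s \<xi>) a)"
      by (induction l)
        (auto simp: bounded_clinear_zero[OF bounded_clinear_amplification[OF s]]
          bounded_clinear_add[OF bounded_clinear_amplification[OF s]] amplification_tens[OF s])
    then show ?thesis
      using amplification_list_bound[OF s bound C, of l] by (simp add: l)
  qed
  have "norm (?A v) - 4 * C * norm v \<le> 0"
    by (rule continuous_le_on_closure[OF _ _ le])
      (auto simp: tens_dense intro!: continuous_intros bounded_linear.continuous_on[OF bounded_linear_amplification[OF s]])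
  then show ?thesis
    by simp
qed

lemma amplification_act:
  assumes s: "bounded_clinear s"
  shows "amplification tens s (act v a) = act (amplification tens s v) a"
  by (rule eq_on_tens[OF bounded_linear_compose[OF bounded_linear_amplification[OF s] bounded_linear_act]
        bounded_linear_compose[OF bounded_linear_act bounded_linear_amplification[OF s]]])
    (simp add: act_tens amplification_tens[OF s])

lemma ip_tens_amplification:
  assumes s: "bounded_clinear s"
  shows "ip (tens \<xi> a) (amplification tens s v) = ip (tens (cadjoint s \<xi>) a) v"
proof (rule eq_on_tens[of "\<lambda>v. ip (tens \<xi> a) (amplification tens s v)"])
  show "bounded_linear (\<lambda>v. ip (tens \<xi> a) (amplification tens s v))"
    by (rule bounded_linear_compose[OF bounded_linear_ip_right bounded_linear_amplification[OF s]])
  show "bounded_linear (ip (tens (cadjoint s \<xi>) a))"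
    by (rule bounded_linear_ip_right)
qed (simp add: amplification_tens[OF s] ip_tens cinner_cadjoint_left[OF s])

end

section \<open>Unitaries, intertwiners and leg numbering\<close>

context hilbert_module
begin

lemma ip_eqI: "(\<And>w. ip w x = ip w y) \<Longrightarrow> x = y"
  by (rule module_eqI[where B = UNIV]) simp_all

text \<open>\<open>module_unitary\<close> demands no linearity; it is forced by the adjoint, since
  \<open>ip w (T v) = ip (S w) v\<close> is linear in \<open>v\<close> and inner products separate
  vectors. Isometry gives the bound 1.\<close>

lemma adjoint_ops_bounded_clinear:
  assumes adj: "\<And>v w. ip (T v) w = ip v (S w)" and iso: "\<And>v. ip (T v) (T v) = ip v v"
  shows "bounded_clinear T"
proof (rule bounded_clinearI[where C = 1])
  have adj': "ip w (T v) = ip (S w) v" for v w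
    using adj[of v w] ip_commute[of w "T v"] ip_commute[of "S w" v] by (simp add: star_star)
  show "T (x + y) = T x + T y" for x y
    by (rule ip_eqI) (simp add: adj' ip_add_right)
  show "T (c *\<^sub>C x) = c *\<^sub>C T x" for c x
    by (rule ip_eqI) (simp add: adj' ip_scaleC_right)
  show "norm (T x) \<le> 1 * norm x" for x
    using norm_ip[of "T x"] norm_ip[of x] power2_eq_iff_nonneg[of "norm (T x)" "norm x"]
    by (simp add: iso[of x])
qed

lemma adjoint_ops_act:
  assumes adj: "\<And>v w. ip (T v) w = ip v (S w)"
  shows "T (act v a) = act (T v) a"
proof (rule ip_eqI)
  fix w
  have adj': "ip w (T v) = ip (S w) v" for v w
    using adj[of v w] ip_commute[of w "T v"] ip_commute[of "S w" v] by (simp add: star_star)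
  show "ip w (T (act v a)) = ip w (act (T v) a)"
    by (simp add: adj' ip_act_right)
qed

lemma module_unitaryI:
  assumes "\<And>v w. ip (T v) w = ip v (S w)" "\<And>v. S (T v) = v" "\<And>v. T (S v) = v"
  shows "module_unitary ip T"
  unfolding module_unitary_def adjoint_ops_def using assms by (intro exI[of _ S]) auto

lemma module_adjoint_eq:
  assumes "\<And>v w. ip (T v) w = ip v (S w)"
  shows "module_adjoint ip T = S"
  unfolding module_adjoint_def
proof (rule the_equality)
  show "adjoint_ops ip T S"
    using assms by (simp add: adjoint_ops_def)
  fix R assume "adjoint_ops ip T R"
  then show "R = S"
    using assms by (intro ext ip_eqI) (metis adjoint_ops_def)
qed

end

section \<open>A unitary on the module and its intertwiners\<close>

locale unitary_tensor = hilbert_tensor act ip tens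
  for act :: "'e::{complex_normed_vector, banach} \<Rightarrow> 'a::cstar_algebra \<Rightarrow> 'e"
    and ip :: "'e \<Rightarrow> 'e \<Rightarrow> 'a"
    and tens :: "'h::chilbert_space \<Rightarrow> 'a \<Rightarrow> 'e" +
  fixes U :: "'e \<Rightarrow> 'e"
  assumes U_unitary: "module_unitary ip U"
begin

text \<open>The adjoint occurring in the definition of a unitary is a two-sided inverse, hence equal
  to \<open>inv U\<close>, which from here on stands for the adjoint of \<open>U\<close>.\<close>

lemma ip_U: "ip (U v) w = ip v (inv U w)"
  and U_inv: "U (inv U v) = v"
  and inv_U: "inv U (U v) = v"
proof -
  obtain S where S: "adjoint_ops ip U S" "S \<circ> U = id" "U \<circ> S = id"
    using U_unitary unfolding module_unitary_def by blast
  then have "inv U = S"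
    by (intro inv_unique_comp) auto
  with S show "ip (U v) w = ip v (inv U w)" "U (inv U v) = v" "inv U (U v) = v"
    by (auto simp: adjoint_ops_def fun_eq_iff)
qed

lemma ip_inv_U: "ip (inv U v) w = ip v (U w)"
  using ip_U[of w v] ip_commute[of "inv U v" w] ip_commute[of v "U w"] by simp

lemma ip_U_U: "ip (U v) (U w) = ip v w"
  by (simp add: ip_U inv_U)

lemma unitary_inv: "unitary_tensor act ip tens (inv U)"
  by unfold_locales (rule module_unitaryI[OF ip_inv_U U_inv inv_U])

lemma bounded_clinear_U: "bounded_clinear U"
  by (rule adjoint_ops_bounded_clinear[OF ip_U ip_U_U])

lemma bounded_linear_U: "bounded_linear U"
  by (rule bounded_clinear_bounded_linear[OF bounded_clinear_U])

lemma bounded_linear_inv_U: "bounded_linear (inv U)"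
  by (rule unitary_tensor.bounded_linear_U[OF unitary_inv])

lemma U_act: "U (act v a) = act (U v) a"
  by (rule adjoint_ops_act[OF ip_U])

lemma module_adjoint_U: "module_adjoint ip U = inv U"
  by (rule module_adjoint_eq[OF ip_U])

lemma ip_amplification_right:
  assumes s: "bounded_clinear s"
  shows "ip v (amplification tens s w) = ip (amplification tens (cadjoint s) v) w"
proof -
  note s' = bounded_clinear_cadjoint[OF s]
  show ?thesis
    by (rule eq_on_tens[OF bounded_linear_ip_left
          bounded_linear_compose[OF bounded_linear_ip_left bounded_linear_amplification[OF s']]])
      (simp add: ip_tens_amplification[OF s] amplification_tens[OF s'])
qed

lemma ip_amplification_left:
  assumes s: "bounded_clinear s"
  shows "ip (amplification tens s v) w = ip v (amplification tens (cadjoint s) w)"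
  by (metis ip_amplification_right[OF s, of w v] ip_commute)

lemma intertwinersD:
  assumes "s \<in> intertwiners tens U"
  shows "bounded_clinear s" "U (amplification tens s v) = amplification tens s (U v)"
  using assms by (auto simp: intertwiners_def fun_eq_iff)

lemma intertwinersI:
  assumes s: "bounded_clinear s" and eq: "\<And>v. U (amplification tens s v) = amplification tens s (U v)"
  shows "s \<in> intertwiners tens U"
  using assms by (auto simp: intertwiners_def fun_eq_iff)

text \<open>Both \<open>U\<close> and \<open>s \<otimes> 1\<close> are module maps, so commutation
  need only be checked on \<open>\<xi> \<otimes> 1\<close> and tested against
  \<open>\<eta> \<otimes> 1\<close>. Both sides are then matrix coefficients of \<open>U\<close>,
  the form in which conjugation, invariance of kernels and weak limits are treated.\<close>

lemma intertwiners_iff: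
  "s \<in> intertwiners tens U \<longleftrightarrow> bounded_clinear s \<and>
    (\<forall>\<xi> \<eta>. ip (tens \<eta> 1) (U (tens (s \<xi>) 1)) = ip (tens (cadjoint s \<eta>) 1) (U (tens \<xi> 1)))"
proof (cases "bounded_clinear s")
  case s: True
  have "(\<forall>v. U (amplification tens s v) = amplification tens s (U v)) \<longleftrightarrow>
    (\<forall>\<xi> \<eta>. ip (tens \<eta> 1) (U (tens (s \<xi>) 1)) = ip (tens (cadjoint s \<eta>) 1) (U (tens \<xi> 1)))"
    (is "?L \<longleftrightarrow> ?R")
  proof
    assume L: ?L
    show ?R
    proof (intro allI)
      fix \<xi> \<eta>
      have "ip (tens \<eta> 1) (U (tens (s \<xi>) 1)) = ip (tens \<eta> 1) (amplification tens s (U (tens \<xi> 1)))"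
        by (simp only: L[rule_format, symmetric] amplification_tens[OF s])
      then show "ip (tens \<eta> 1) (U (tens (s \<xi>) 1)) = ip (tens (cadjoint s \<eta>) 1) (U (tens \<xi> 1))"
        by (simp add: ip_tens_amplification[OF s])
    qed
  next
    assume R: ?R
    have one: "U (amplification tens s (tens \<xi> 1)) = amplification tens s (U (tens \<xi> 1))" for \<xi>
      by (rule module_eqI_tens)
        (simp add: amplification_tens[OF s] ip_tens_amplification[OF s] R)
    show ?L
    proof
      fix v
      show "U (amplification tens s v) = amplification tens s (U v)"
      proof (rule eq_on_tens[OF bounded_linear_compose[OF bounded_linear_U bounded_linear_amplification[OF s]]
            bounded_linear_compose[OF bounded_linear_amplification[OF s] bounded_linear_U]])
        fix \<xi> a
        show "U (amplification tens s (tens \<xi> a)) = amplification tens s (U (tens \<xi> a))"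
          unfolding tens_eq_act[of \<xi> a] by (simp add: amplification_act[OF s] U_act one)
      qed
    qed
  qed
  then show ?thesis
    using s intertwinersI intertwinersD by metis
qed (auto simp: intertwiners_def)

lemma intertwiners_compose:
  assumes s: "s \<in> intertwiners tens U" and t: "t \<in> intertwiners tens U"
  shows "(\<lambda>\<xi>. s (t \<xi>)) \<in> intertwiners tens U"
proof (rule intertwinersI)
  note bs = intertwinersD(1)[OF s] and bt = intertwinersD(1)[OF t]
  show "bounded_clinear (\<lambda>\<xi>. s (t \<xi>))"
    by (rule bounded_clinear_compose[OF bs bt])
  show "U (amplification tens (\<lambda>\<xi>. s (t \<xi>)) v) = amplification tens (\<lambda>\<xi>. s (t \<xi>)) (U v)" for v
    unfolding amplification_compose[OF bs bt] by (simp only: intertwinersD(2)[OF s] intertwinersD(2)[OF t])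
qed

lemma intertwiners_ident: "(\<lambda>\<xi>. \<xi>) \<in> intertwiners tens U"
  by (rule intertwinersI[OF bounded_clinear_ident]) (simp only: amplification_ident)

lemma intertwiners_plus:
  assumes s: "s \<in> intertwiners tens U" and t: "t \<in> intertwiners tens U"
  shows "(\<lambda>\<xi>. s \<xi> + t \<xi>) \<in> intertwiners tens U"
proof (rule intertwinersI)
  note bs = intertwinersD(1)[OF s] and bt = intertwinersD(1)[OF t]
  show "bounded_clinear (\<lambda>\<xi>. s \<xi> + t \<xi>)"
    by (rule bounded_clinear_plus[OF bs bt])
  show "U (amplification tens (\<lambda>\<xi>. s \<xi> + t \<xi>) v) = amplification tens (\<lambda>\<xi>. s \<xi> + t \<xi>) (U v)" for v
    unfolding amplification_plus[OF bs bt] bounded_clinear_add[OF bounded_clinear_U]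
    by (simp only: intertwinersD(2)[OF s] intertwinersD(2)[OF t])
qed

lemma intertwiners_scale:
  assumes s: "s \<in> intertwiners tens U"
  shows "(\<lambda>\<xi>. c *\<^sub>C s \<xi>) \<in> intertwiners tens U"
proof (rule intertwinersI)
  note bs = intertwinersD(1)[OF s]
  show "bounded_clinear (\<lambda>\<xi>. c *\<^sub>C s \<xi>)"
    by (rule bounded_clinear_scale[OF bs])
  show "U (amplification tens (\<lambda>\<xi>. c *\<^sub>C s \<xi>) v) = amplification tens (\<lambda>\<xi>. c *\<^sub>C s \<xi>) (U v)" for v
    unfolding amplification_scale[OF bs] bounded_clinear_scaleC[OF bounded_clinear_U]
    by (simp only: intertwinersD(2)[OF s])
qed

lemma intertwiners_minus:
  assumes "s \<in> intertwiners tens U" "t \<in> intertwiners tens U"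
  shows "(\<lambda>\<xi>. s \<xi> - t \<xi>) \<in> intertwiners tens U"
  using intertwiners_plus[OF assms(1) intertwiners_scale[OF assms(2), of "-1"]]
  by (simp add: scaleC_minus_one)

text \<open>As \<open>U\<close> is invertible, \<open>s \<otimes> 1\<close> also commutes with
  \<open>inv U\<close>; passing to adjoints in that relation gives the claim, because
  \<open>inv U\<close> is the adjoint of \<open>U\<close>.\<close>

lemma intertwiners_cadjoint:
  assumes s: "s \<in> intertwiners tens U"
  shows "cadjoint s \<in> intertwiners tens U"
proof (rule intertwinersI)
  note bs = intertwinersD(1)[OF s]
  show "bounded_clinear (cadjoint s)"
    by (rule bounded_clinear_cadjoint[OF bs])
  fix v
  have inv_comm: "inv U (amplification tens s w) = amplification tens s (inv U w)" for w
    by (metis inv_U U_inv intertwinersD(2)[OF s])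
  show "U (amplification tens (cadjoint s) v) = amplification tens (cadjoint s) (U v)"
  proof (rule ip_eqI)
    fix w
    have "ip w (U (amplification tens (cadjoint s) v)) = ip (inv U (amplification tens s w)) v"
      by (simp add: ip_inv_U[symmetric] ip_amplification_left[OF bs, symmetric] inv_comm)
    also have "\<dots> = ip w (amplification tens (cadjoint s) (U v))"
      by (simp add: ip_inv_U ip_amplification_left[OF bs])
    finally show "ip w (U (amplification tens (cadjoint s) v)) = ip w (amplification tens (cadjoint s) (U v))" .
  qed
qed

end

section \<open>Leg numbering on a tensor square\<close>

lemma dense_span_mono:
  fixes A B :: "'v::real_normed_vector set"
  assumes "closure (span A) = UNIV" "A \<subseteq> closure (span B)"
  shows "closure (span B) = UNIV"
proof -
  have "span A \<subseteq> closure (span B)"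
    by (rule span_minimal[OF assms(2) subspace_closure[OF subspace_span]])
  then have "closure (span A) \<subseteq> closure (span B)"
    by (rule closure_minimal) simp
  then show ?thesis
    using assms(1) by auto
qed

lemma bounded_linear_image_closure_span:
  assumes f: "bounded_linear f" and dense: "closure (span B) = UNIV" and sub: "f ` B \<subseteq> S"
  shows "f x \<in> closure (span S)"
proof -
  have "f ` span B \<subseteq> span S"
    unfolding linear_span_image[OF bounded_linear.linear[OF f], symmetric] by (rule span_mono[OF sub])
  then have "f ` closure (span B) \<subseteq> closure (span S)"
    using closure_bounded_linear_image_subset[OF f, of "span B"] closure_mono by blast
  then show ?thesis
    using dense by auto
qed

text \<open>The tensor square is known only through a bilinear \<open>tn\<close> with multiplicative
  inner products and total range. Nothing distinguishes the two legs, so the flipped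
  \<open>tn\<close> is again an instance.\<close>

locale leg_pair = H: unitary_tensor act ip tens U + K: hilbert_tensor act2 ip2 tens2
  for act :: "'e::{complex_normed_vector, banach} \<Rightarrow> 'a::cstar_algebra \<Rightarrow> 'e"
    and ip :: "'e \<Rightarrow> 'e \<Rightarrow> 'a"
    and tens :: "'h::chilbert_space \<Rightarrow> 'a \<Rightarrow> 'e"
    and U :: "'e \<Rightarrow> 'e"
    and act2 :: "'f::{complex_normed_vector, banach} \<Rightarrow> 'a \<Rightarrow> 'f"
    and ip2 :: "'f \<Rightarrow> 'f \<Rightarrow> 'a"
    and tens2 :: "'k::chilbert_space \<Rightarrow> 'a \<Rightarrow> 'f" +
  fixes tn :: "'h \<Rightarrow> 'h \<Rightarrow> 'k"
  assumes tn_add_left: "tn (\<xi> + \<xi>') \<eta> = tn \<xi> \<eta> + tn \<xi>' \<eta>"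
    and tn_add_right: "tn \<xi> (\<eta> + \<eta>') = tn \<xi> \<eta> + tn \<xi> \<eta>'"
    and tn_scaleC_left: "tn (c *\<^sub>C \<xi>) \<eta> = c *\<^sub>C tn \<xi> \<eta>"
    and tn_scaleC_right: "tn \<xi> (c *\<^sub>C \<eta>) = c *\<^sub>C tn \<xi> \<eta>"
    and cinner_tn: "cinner (tn \<xi> \<eta>) (tn \<xi>' \<eta>') = cinner \<xi> \<xi>' * cinner \<eta> \<eta>'"
    and tn_dense: "closure (span (range (\<lambda>(\<xi>, \<eta>). tn \<xi> \<eta>))) = UNIV"
begin

abbreviation "P1 \<equiv> put_first tn tens tens2"
abbreviation "P2 \<equiv> put_second tn tens tens2"
abbreviation "L23 \<equiv> leg23 tn tens tens2 U"
abbreviation "L13 \<equiv> leg13 tn tens tens2 U"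

lemma P1_extends:
  "extends_to (\<lambda>(\<eta>, a). tens \<eta> a) (\<lambda>(\<eta>, a). tens2 (tn \<xi> \<eta>) a) (P1 \<xi>)"
  unfolding put_first_def
proof (rule ip_scaled_extension(1)[OF H.hilbert_module_axioms K.hilbert_module_axioms, where r = "(norm \<xi>)\<^sup>2"])
  show "\<exists>j. (case j of (\<eta>, a) \<Rightarrow> tens \<eta> a) = c *\<^sub>C (case i of (\<eta>, a) \<Rightarrow> tens \<eta> a) \<and>
        (case j of (\<eta>, a) \<Rightarrow> tens2 (tn \<xi> \<eta>) a) = c *\<^sub>C (case i of (\<eta>, a) \<Rightarrow> tens2 (tn \<xi> \<eta>) a)" for c i
    by (rule exI[of _ "(fst i, c *\<^sub>C snd i)"])
      (cases i, simp add: H.tens_scaleC_right K.tens_scaleC_right)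
  show "ip2 (case i of (\<eta>, a) \<Rightarrow> tens2 (tn \<xi> \<eta>) a) (case j of (\<eta>, a) \<Rightarrow> tens2 (tn \<xi> \<eta>) a) =
      (norm \<xi>)\<^sup>2 *\<^sub>R ip (case i of (\<eta>, a) \<Rightarrow> tens \<eta> a) (case j of (\<eta>, a) \<Rightarrow> tens \<eta> a)" for i j
    by (cases i; cases j)
      (simp add: H.ip_tens K.ip_tens cinner_tn cinner_self scaleC_of_real[symmetric] scaleC_scaleC)
qed (rule H.tens_dense)

lemma P1_tens: "P1 \<xi> (tens \<eta> a) = tens2 (tn \<xi> \<eta>) a"
  using P1_extends[of \<xi>] by (auto simp: extends_to_def)

lemma bounded_clinear_P1: "bounded_clinear (P1 \<xi>)"
  using P1_extends[of \<xi>] by (simp add: extends_to_def)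

lemma bounded_linear_P1: "bounded_linear (P1 \<xi>)"
  by (rule bounded_clinear_bounded_linear[OF bounded_clinear_P1])

lemma ip2_P1: "ip2 (P1 \<xi> v) (P1 \<xi>' w) = cinner \<xi> \<xi>' *\<^sub>C ip v w"
proof -
  have 1: "ip2 (P1 \<xi> (tens \<eta> a)) (P1 \<xi>' w) = cinner \<xi> \<xi>' *\<^sub>C ip (tens \<eta> a) w" for \<eta> a
    by (rule H.eq_on_tens[OF
          bounded_linear_compose[OF K.bounded_linear_ip_right bounded_linear_P1]
          bounded_linear_compose[OF bounded_linear_scaleC
            H.bounded_linear_ip_right]])
      (simp add: P1_tens K.ip_tens H.ip_tens cinner_tn scaleC_scaleC)
  show ?thesis
    by (rule H.eq_on_tens[OF
          bounded_linear_compose[OF K.bounded_linear_ip_left bounded_linear_P1]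
          bounded_linear_compose[OF bounded_linear_scaleC
            H.bounded_linear_ip_left] 1])
qed

lemma tens2_tn_dense: "closure (span (range (\<lambda>(\<xi>, \<eta>, a). tens2 (tn \<xi> \<eta>) a))) = UNIV"
proof (rule dense_span_mono[OF K.tens_dense], safe)
  fix x a
  have "tens2 (tn \<xi> \<eta>) a \<in> range (\<lambda>(\<xi>, \<eta>, a). tens2 (tn \<xi> \<eta>) a)" for \<xi> \<eta>
    by (rule range_eqI[of _ _ "(\<xi>, \<eta>, a)"]) simp
  then have "(\<lambda>y. tens2 y a) ` range (\<lambda>(\<xi>, \<eta>). tn \<xi> \<eta>) \<subseteq> range (\<lambda>(\<xi>, \<eta>, a). tens2 (tn \<xi> \<eta>) a)"
    by clarsimp
  then show "tens2 x a \<in> closure (span (range (\<lambda>(\<xi>, \<eta>, a). tens2 (tn \<xi> \<eta>) a)))"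
    by (rule bounded_linear_image_closure_span[OF
          K.bounded_linear_tens_left tn_dense])
qed

lemma eq_on_tn:
  assumes "bounded_linear T" "bounded_linear S"
    and "\<And>\<xi> \<eta> a. T (tens2 (tn \<xi> \<eta>) a) = S (tens2 (tn \<xi> \<eta>) a)"
  shows "T x = S x"
  by (rule bounded_linear_eqI[OF assms(1,2) tens2_tn_dense]) (use assms(3) in auto)

lemma P1_dense: "closure (span (range (\<lambda>(\<xi>, v). P1 \<xi> v))) = UNIV"
proof (rule dense_span_mono[OF tens2_tn_dense], safe)
  fix \<xi> \<eta> a
  have "P1 \<xi> (tens \<eta> a) \<in> span (range (\<lambda>(\<xi>, v). P1 \<xi> v))"
    by (rule span_base) auto
  then show "tens2 (tn \<xi> \<eta>) a \<in> closure (span (range (\<lambda>(\<xi>, v). P1 \<xi> v)))"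
    using closure_subset by (auto simp: P1_tens)
qed

lemma eq_on_P1:
  assumes "bounded_linear T" "bounded_linear S" "\<And>\<xi> v. T (P1 \<xi> v) = S (P1 \<xi> v)"
  shows "T x = S x"
  by (rule bounded_linear_eqI[OF assms(1,2) P1_dense]) (use assms(3) in auto)

lemma leg23_extends:
  "extends_to (\<lambda>(\<xi>, v). P1 \<xi> v) (\<lambda>(\<xi>, v). P1 \<xi> (U v)) L23"
  and ip2_leg23_leg23: "ip2 (L23 x) (L23 y) = ip2 x y"
proof -
  have 1: "\<exists>j. (case j of (\<xi>, v) \<Rightarrow> P1 \<xi> v) = c *\<^sub>C (case i of (\<xi>, v) \<Rightarrow> P1 \<xi> v) \<and>
        (case j of (\<xi>, v) \<Rightarrow> P1 \<xi> (U v)) = c *\<^sub>C (case i of (\<xi>, v) \<Rightarrow> P1 \<xi> (U v))" for c i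
    by (rule exI[of _ "(fst i, c *\<^sub>C snd i)"])
      (cases i, simp add: bounded_clinear_scaleC[OF bounded_clinear_P1]
        bounded_clinear_scaleC[OF H.bounded_clinear_U])
  have 2: "ip2 (case i of (\<xi>, v) \<Rightarrow> P1 \<xi> (U v)) (case j of (\<xi>, v) \<Rightarrow> P1 \<xi> (U v)) =
      1 *\<^sub>R ip2 (case i of (\<xi>, v) \<Rightarrow> P1 \<xi> v) (case j of (\<xi>, v) \<Rightarrow> P1 \<xi> v)" for i j
    by (cases i; cases j) (simp add: ip2_P1 H.ip_U_U)
  show "extends_to (\<lambda>(\<xi>, v). P1 \<xi> v) (\<lambda>(\<xi>, v). P1 \<xi> (U v)) L23"
    unfolding leg23_def
    by (rule ip_scaled_extension(1)[OF K.hilbert_module_axioms K.hilbert_module_axioms 1 2 P1_dense])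
  show "ip2 (L23 x) (L23 y) = ip2 x y"
    unfolding leg23_def
    using ip_scaled_extension(2)[OF K.hilbert_module_axioms K.hilbert_module_axioms 1 2 P1_dense]
    by simp
qed

lemma leg23_P1: "L23 (P1 \<xi> v) = P1 \<xi> (U v)"
  using leg23_extends by (auto simp: extends_to_def)

lemma bounded_linear_leg23: "bounded_linear L23"
  using leg23_extends by (auto simp: extends_to_def bounded_clinear_def)

lemma leg_pair_inv: "leg_pair act ip tens (inv U) act2 ip2 tens2 tn"
  by (intro leg_pair.intro H.unitary_inv K.hilbert_tensor_axioms leg_pair_axioms.intro
      tn_add_left tn_add_right tn_scaleC_left tn_scaleC_right cinner_tn tn_dense)

lemma leg23_inverse: "L23 (leg23 tn tens tens2 (inv U) x) = x"
  "leg23 tn tens tens2 (inv U) (L23 x) = x"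
proof -
  interpret I: leg_pair act ip tens "inv U" act2 ip2 tens2 tn
    by (rule leg_pair_inv)
  show "L23 (leg23 tn tens tens2 (inv U) x) = x"
    by (rule eq_on_P1[OF bounded_linear_compose[OF bounded_linear_leg23 I.bounded_linear_leg23] bounded_linear_ident])
      (simp add: leg23_P1 I.leg23_P1 H.U_inv)
  show "leg23 tn tens tens2 (inv U) (L23 x) = x"
    by (rule eq_on_P1[OF bounded_linear_compose[OF I.bounded_linear_leg23 bounded_linear_leg23] bounded_linear_ident])
      (simp add: leg23_P1 I.leg23_P1 H.inv_U)
qed

lemma unitary_leg23: "unitary_tensor act2 ip2 tens2 L23"
proof (intro unitary_tensor.intro K.hilbert_tensor_axioms unitary_tensor_axioms.intro
    K.module_unitaryI[where S = "leg23 tn tens tens2 (inv U)"] leg23_inverse)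
  show "ip2 (L23 v) w = ip2 v (leg23 tn tens tens2 (inv U) w)" for v w
    using ip2_leg23_leg23[of v "leg23 tn tens tens2 (inv U) w"] by (simp add: leg23_inverse)
qed

lemma inv_leg23: "inv L23 = leg23 tn tens tens2 (inv U)"
  by (rule inv_unique_comp) (auto simp: leg23_inverse fun_eq_iff)

lemma inv_leg23_P1: "inv L23 (P1 \<xi> v) = P1 \<xi> (inv U v)"
  unfolding inv_leg23 by (rule leg_pair.leg23_P1[OF leg_pair_inv])

text \<open>The flip exchanges \<open>L23\<close> with \<open>L13\<close> and hence \<open>W\<close>
  with \<open>Z\<close>. Facts about \<open>P2\<close>, \<open>L13\<close> and one of
  \<open>W\<close>, \<open>Z\<close> become instances of those about \<open>P1\<close>,
  \<open>L23\<close> and the other.\<close>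

lemma leg_pair_swap: "leg_pair act ip tens U act2 ip2 tens2 (\<lambda>\<xi> \<eta>. tn \<eta> \<xi>)"
proof (intro leg_pair.intro H.unitary_tensor_axioms K.hilbert_tensor_axioms leg_pair_axioms.intro
      tn_add_left tn_add_right tn_scaleC_left tn_scaleC_right)
  show "closure (span (range (\<lambda>(\<xi>, \<eta>). tn \<eta> \<xi>))) = UNIV"
  proof (rule dense_span_mono[OF tn_dense], safe)
    fix \<xi> \<eta>
    have "tn \<xi> \<eta> \<in> range (\<lambda>(\<xi>, \<eta>). tn \<eta> \<xi>)"
      by (rule range_eqI[of _ _ "(\<eta>, \<xi>)"]) simp
    then show "tn \<xi> \<eta> \<in> closure (span (range (\<lambda>(\<xi>, \<eta>). tn \<eta> \<xi>)))"
      by (rule closure_subset[THEN subsetD, OF span_base])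
  qed
qed (simp add: cinner_tn mult.commute)

lemma put_first_swap: "put_first (\<lambda>\<xi> \<eta>. tn \<eta> \<xi>) tens tens2 = P2"
  by (simp add: fun_eq_iff put_first_def put_second_def)

lemma put_second_swap: "put_second (\<lambda>\<xi> \<eta>. tn \<eta> \<xi>) tens tens2 = P1"
  by (simp add: fun_eq_iff put_first_def put_second_def)

lemma leg23_swap: "leg23 (\<lambda>\<xi> \<eta>. tn \<eta> \<xi>) tens tens2 U = L13"
  by (simp add: leg23_def leg13_def put_first_swap)

lemma leg13_swap: "leg13 (\<lambda>\<xi> \<eta>. tn \<eta> \<xi>) tens tens2 U = L23"
  by (simp add: leg23_def leg13_def put_second_swap)

lemma op_W_swap: "op_W (\<lambda>\<xi> \<eta>. tn \<eta> \<xi>) tens tens2 U = op_Z tn tens tens2 U"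
  by (simp add: op_W_def op_Z_def leg23_swap leg13_swap)

lemma op_Z_swap: "op_Z (\<lambda>\<xi> \<eta>. tn \<eta> \<xi>) tens tens2 U = op_W tn tens tens2 U"
  by (simp add: op_W_def op_Z_def leg23_swap leg13_swap)

lemmas P2_tens = leg_pair.P1_tens[OF leg_pair_swap, unfolded put_first_swap]
lemmas bounded_linear_P2 = leg_pair.bounded_linear_P1[OF leg_pair_swap, unfolded put_first_swap]
lemmas leg13_P2 = leg_pair.leg23_P1[OF leg_pair_swap, unfolded put_first_swap leg23_swap]
lemmas unitary_leg13 = leg_pair.unitary_leg23[OF leg_pair_swap, unfolded leg23_swap]
lemmas inv_leg13_P2 = leg_pair.inv_leg23_P1[OF leg_pair_swap, unfolded put_first_swap leg23_swap]

lemma P1_act: "P1 \<xi> (act v a) = act2 (P1 \<xi> v) a"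
  by (rule H.eq_on_tens[OF
        bounded_linear_compose[OF bounded_linear_P1 H.bounded_linear_act]
        bounded_linear_compose[OF K.bounded_linear_act bounded_linear_P1]])
    (simp add: P1_tens H.act_tens K.act_tens)

sublocale L23: unitary_tensor act2 ip2 tens2 L23
  by (rule unitary_leg23)

sublocale L13: unitary_tensor act2 ip2 tens2 L13
  by (rule unitary_leg13)

lemma unitary_op_W: "unitary_tensor act2 ip2 tens2 (op_W tn tens tens2 U)"
  by (intro unitary_tensor.intro K.hilbert_tensor_axioms unitary_tensor_axioms.intro
      K.module_unitaryI[where S = "\<lambda>x. inv L23 (inv L13 x)"])
    (simp_all add: op_W_def L23.ip_U L13.ip_U L23.U_inv L13.U_inv L23.inv_U L13.inv_U)

end

text \<open>\<open>J\<close> is an antiunitary involution, in the application the complex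
  conjugation of functions. \<open>U_real\<close> says that \<open>U\<close> coincides with its
  complex conjugate: conjugating both vectors replaces a matrix coefficient by its adjoint.\<close>

locale real_leg_pair = leg_pair act ip tens U act2 ip2 tens2 tn
  for act :: "'e::{complex_normed_vector, banach} \<Rightarrow> 'a::cstar_algebra \<Rightarrow> 'e"
    and ip :: "'e \<Rightarrow> 'e \<Rightarrow> 'a"
    and tens :: "'h::chilbert_space \<Rightarrow> 'a \<Rightarrow> 'e"
    and U :: "'e \<Rightarrow> 'e"
    and act2 :: "'f::{complex_normed_vector, banach} \<Rightarrow> 'a \<Rightarrow> 'f"
    and ip2 :: "'f \<Rightarrow> 'f \<Rightarrow> 'a"
    and tens2 :: "'k::chilbert_space \<Rightarrow> 'a \<Rightarrow> 'f"
    and tn :: "'h \<Rightarrow> 'h \<Rightarrow> 'k" +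
  fixes J :: "'h \<Rightarrow> 'h"
  assumes J_add: "J (\<xi> + \<eta>) = J \<xi> + J \<eta>"
    and J_scaleC: "J (c *\<^sub>C \<xi>) = cnj c *\<^sub>C J \<xi>"
    and J_J: "J (J \<xi>) = \<xi>"
    and cinner_J_J: "cinner (J \<xi>) (J \<eta>) = cinner \<eta> \<xi>"
    and U_real: "ip (tens (J \<eta>) 1) (U (tens (J \<xi>) 1)) = star (ip (tens \<eta> 1) (U (tens \<xi> 1)))"
begin

lemma cinner_J_left: "cinner (J \<xi>) \<eta> = cinner (J \<eta>) \<xi>"
  using cinner_J_J[of \<xi> "J \<eta>"] by (simp add: J_J)

lemma cinner_J_right: "cinner \<xi> (J \<eta>) = cinner \<eta> (J \<xi>)"
  using cinner_J_J[of "J \<xi>" \<eta>] by (simp add: J_J)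

lemma norm_J: "norm (J \<xi>) = norm \<xi>"
  using cinner_J_J[of \<xi> \<xi>] by (simp add: norm_eq_sqrt_cinner)

lemma real_leg_pair_swap: "real_leg_pair act ip tens U act2 ip2 tens2 (\<lambda>\<xi> \<eta>. tn \<eta> \<xi>) J"
  by (intro real_leg_pair.intro leg_pair_swap real_leg_pair_axioms.intro
      J_add J_scaleC J_J cinner_J_J U_real)

lemma bounded_clinear_conjugate:
  assumes s: "bounded_clinear s"
  shows "bounded_clinear (\<lambda>\<xi>. J (s (J \<xi>)))"
proof -
  obtain C where C: "\<And>x. norm (s x) \<le> C * norm x"
    using bounded_clinear_bound[OF s] by blast
  show ?thesis
    by (rule bounded_clinearI[where C = C])
      (use C[of "J _"] in \<open>simp_all add: J_add J_scaleC norm_J bounded_clinear_add[OF s] bounded_clinear_scaleC[OF s]\<close>)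
qed

text \<open>\<open>U_real\<close> carries the matrix-coefficient form of intertwining over to
  conjugated vectors, and the adjoint of \<open>J s J\<close> is \<open>J s* J\<close> because
  \<open>J\<close> is antiunitary.\<close>

lemma intertwiners_conjugate:
  assumes s: "s \<in> intertwiners tens U"
  shows "(\<lambda>\<xi>. J (s (J \<xi>))) \<in> intertwiners tens U"
proof -
  note bs = H.intertwinersD(1)[OF s]
  note bc = bounded_clinear_conjugate[OF bs]
  have adj: "cadjoint (\<lambda>\<xi>. J (s (J \<xi>))) = (\<lambda>\<xi>. J (cadjoint s (J \<xi>)))"
  proof (rule cadjoint_eqI[OF bc])
    fix x y
    have "cinner (J (cadjoint s (J x))) y = cinner (J y) (cadjoint s (J x))"
      by (rule cinner_J_left)
    also have "\<dots> = cinner (s (J y)) (J x)"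
      by (rule cinner_cadjoint_right[OF bs])
    also have "\<dots> = cinner x (J (s (J y)))"
      by (rule cinner_J_right)
    finally show "cinner (J (cadjoint s (J x))) y = cinner x (J (s (J y)))" .
  qed
  have "ip (tens \<eta> 1) (U (tens (J (s (J \<xi>))) 1)) = ip (tens (J (cadjoint s (J \<eta>))) 1) (U (tens \<xi> 1))" for \<xi> \<eta>
  proof -
    have "ip (tens \<eta> 1) (U (tens (J (s (J \<xi>))) 1)) = star (ip (tens (J \<eta>) 1) (U (tens (s (J \<xi>)) 1)))"
      using U_real[of "J \<eta>" "s (J \<xi>)"] by (simp add: J_J)
    also have "\<dots> = star (ip (tens (cadjoint s (J \<eta>)) 1) (U (tens (J \<xi>) 1)))"
      using s unfolding H.intertwiners_iff by simp
    also have "\<dots> = ip (tens (J (cadjoint s (J \<eta>))) 1) (U (tens \<xi> 1))"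
      using U_real[of "cadjoint s (J \<eta>)" "J \<xi>"] by (simp add: J_J)
    finally show ?thesis .
  qed
  then show ?thesis
    unfolding H.intertwiners_iff adj using bc by blast
qed

text \<open>Fixing \<open>F \<otimes> 1\<close> means that \<open>L13\<close> and
  \<open>inv L23\<close> agree on it. In the pairing with \<open>\<xi> \<otimes> \<eta>\<close> the
  first leg sees the vector \<open>T (J \<eta>)\<close>, the second leg
  \<open>J (cadjoint T \<xi>)\<close>; \<open>U_real\<close> turns the latter coefficient into the
  one required of an intertwiner.\<close>

lemma op_Z_fixed_iff:
  assumes T: "bounded_clinear T" and F: "\<And>\<xi> \<eta>. cinner (tn \<xi> \<eta>) F = cinner \<xi> (T (J \<eta>))"
  shows "op_Z tn tens tens2 U (tens2 F 1) = tens2 F 1 \<longleftrightarrow> T \<in> intertwiners tens U"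
proof -
  let ?x = "tens2 F 1"
  have P2: "ip2 (P2 \<eta> v) ?x = ip v (tens (T (J \<eta>)) 1)" for \<eta> v
    by (rule H.eq_on_tens[OF bounded_linear_compose[OF K.bounded_linear_ip_left bounded_linear_P2]
          H.bounded_linear_ip_left])
      (simp add: P2_tens K.ip_tens H.ip_tens F)
  have P1: "ip2 (P1 \<xi> v) ?x = ip v (tens (J (cadjoint T \<xi>)) 1)" for \<xi> v
  proof (rule H.eq_on_tens[OF bounded_linear_compose[OF K.bounded_linear_ip_left bounded_linear_P1]
          H.bounded_linear_ip_left])
    fix \<eta> a
    have "cinner \<xi> (T (J \<eta>)) = cinner \<eta> (J (cadjoint T \<xi>))"
      using cinner_J_right[of "cadjoint T \<xi>" \<eta>] by (simp only: cinner_cadjoint_left[OF T])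
    then show "ip2 (P1 \<xi> (tens \<eta> a)) ?x = ip (tens \<eta> a) (tens (J (cadjoint T \<xi>)) 1)"
      by (simp add: P1_tens K.ip_tens H.ip_tens F)
  qed
  have left: "ip2 (tens2 (tn \<xi> \<eta>) 1) (L13 ?x) = ip (tens \<xi> 1) (U (tens (T (J \<eta>)) 1))" for \<xi> \<eta>
    unfolding L13.ip_inv_U[symmetric] P2_tens[symmetric] inv_leg13_P2 P2 by (rule H.ip_inv_U)
  have right: "ip2 (tens2 (tn \<xi> \<eta>) 1) (inv L23 ?x) = ip (tens (cadjoint T \<xi>) 1) (U (tens (J \<eta>) 1))" for \<xi> \<eta>
    unfolding L23.ip_U[symmetric] P1_tens[symmetric] leg23_P1 P1
    using U_real[of "J (cadjoint T \<xi>)" \<eta>] H.ip_commute[of "U (tens \<eta> 1)"] by (simp add: J_J)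
  have "op_Z tn tens tens2 U ?x = ?x \<longleftrightarrow> L13 ?x = inv L23 ?x"
    unfolding op_Z_def by (metis L23.U_inv L23.inv_U comp_apply)
  also have "\<dots> \<longleftrightarrow> (\<forall>\<xi> \<eta>. ip2 (tens2 (tn \<xi> \<eta>) 1) (L13 ?x) = ip2 (tens2 (tn \<xi> \<eta>) 1) (inv L23 ?x))"
  proof (rule iffI; (intro allI)?)
    assume eq: "\<forall>\<xi> \<eta>. ip2 (tens2 (tn \<xi> \<eta>) 1) (L13 ?x) = ip2 (tens2 (tn \<xi> \<eta>) 1) (inv L23 ?x)"
    show "L13 ?x = inv L23 ?x"
    proof (rule K.module_eqI[OF tens2_tn_dense], safe)
      fix \<xi> \<eta> a
      show "ip2 (tens2 (tn \<xi> \<eta>) a) (L13 ?x) = ip2 (tens2 (tn \<xi> \<eta>) a) (inv L23 ?x)"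
        unfolding K.ip_tens_left[of _ a] eq[rule_format] ..
    qed
  qed simp
  also have "\<dots> \<longleftrightarrow> (\<forall>\<xi> \<eta>. ip (tens \<xi> 1) (U (tens (T (J \<eta>)) 1)) = ip (tens (cadjoint T \<xi>) 1) (U (tens (J \<eta>) 1)))"
    unfolding left right ..
  also have "\<dots> \<longleftrightarrow> T \<in> intertwiners tens U"
    unfolding H.intertwiners_iff using T by (metis J_J)
  finally show ?thesis .
qed

text \<open>Exchanging the variables of a kernel replaces its operator by the transpose
  \<open>J T* J\<close>, which is again an intertwiner; \<open>op_Z_fixed_iff\<close> for the
  flipped legs then gives the equation for \<open>W\<close>.\<close>

lemma op_W_fixed:
  assumes T: "T \<in> intertwiners tens U" and F: "\<And>\<xi> \<eta>. cinner (tn \<xi> \<eta>) F = cinner \<xi> (T (J \<eta>))"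
  shows "op_W tn tens tens2 U (tens2 F 1) = tens2 F 1"
proof -
  define T' where "T' = (\<lambda>\<xi>. J (cadjoint T (J \<xi>)))"
  note bT = H.intertwinersD(1)[OF T]
  have T': "T' \<in> intertwiners tens U"
    unfolding T'_def by (rule intertwiners_conjugate[OF H.intertwiners_cadjoint[OF T]])
  have "cinner (tn \<eta> \<xi>) F = cinner \<xi> (T' (J \<eta>))" for \<xi> \<eta>
    using cinner_J_right[of "cadjoint T \<eta>" \<xi>]
    by (simp add: F T'_def J_J cinner_cadjoint_left[OF bT])
  then show ?thesis
    using real_leg_pair.op_Z_fixed_iff[OF real_leg_pair_swap H.intertwinersD(1)[OF T'], of F] T'
    by (simp add: op_Z_swap)
qed

end

section \<open>Multiplication operators and invariant functions of two variables\<close>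

context leg_pair
begin

lemma norm_tn: "norm (tn \<xi> \<eta>) = norm \<xi> * norm \<eta>"
  by (simp add: norm_eq_sqrt_cinner cinner_tn norm_mult real_sqrt_mult)

lemma bounded_clinear_tn_left: "bounded_clinear (\<lambda>\<xi>. tn \<xi> \<eta>)"
  by (rule bounded_clinearI[where C = "norm \<eta>"])
    (simp_all add: tn_add_left tn_scaleC_left norm_tn)

lemma bounded_clinear_tn_right: "bounded_clinear (tn \<xi>)"
  by (rule bounded_clinearI[where C = "norm \<xi>"])
    (simp_all add: tn_add_right tn_scaleC_right norm_tn)

end

text \<open>\<open>'c\<close> and \<open>'c2\<close> stand for \<open>C(X)\<close> and \<open>C(X \<times> X)\<close>, with their classes \<open>\<iota>\<close>, \<open>\<iota>2\<close> in the
  \<open>L\<^sup>2\<close>-spaces and their multiplication operators \<open>\<pi>\<close>, \<open>\<Theta>\<close>; \<open>e\<close> is the constant function 1. Leaving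
  them abstract makes the hypotheses symmetric under exchange of the two variables. Assumption
  \<open>U_mult\<close> expresses that \<open>U \<pi>(q) U*\<close> is left multiplication by \<open>\<beta>(q)\<close>.\<close>

locale function_legs = leg_pair act ip tens U act2 ip2 tens2 tn
  for act :: "'e::{complex_normed_vector, banach} \<Rightarrow> 'a::cstar_algebra \<Rightarrow> 'e"
    and ip :: "'e \<Rightarrow> 'e \<Rightarrow> 'a"
    and tens :: "'h::chilbert_space \<Rightarrow> 'a \<Rightarrow> 'e"
    and U :: "'e \<Rightarrow> 'e"
    and act2 :: "'f::{complex_normed_vector, banach} \<Rightarrow> 'a \<Rightarrow> 'f"
    and ip2 :: "'f \<Rightarrow> 'f \<Rightarrow> 'a"
    and tens2 :: "'k::chilbert_space \<Rightarrow> 'a \<Rightarrow> 'f"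
    and tn :: "'h \<Rightarrow> 'h \<Rightarrow> 'k" +
  fixes \<iota> :: "'c \<Rightarrow> 'h" and \<pi> :: "'c \<Rightarrow> 'h \<Rightarrow> 'h"
    and \<iota>2 :: "'c2::real_normed_vector \<Rightarrow> 'k" and \<Theta> :: "'c2 \<Rightarrow> 'k \<Rightarrow> 'k"
    and box :: "'c \<Rightarrow> 'c \<Rightarrow> 'c2" and e :: 'c
  assumes bounded_clinear_\<pi>: "bounded_clinear (\<pi> p)"
    and \<pi>_\<iota>: "\<pi> p (\<iota> q) = \<pi> q (\<iota> p)"
    and U_mult: "U (amplification tens (\<pi> q) (inv U (tens (\<iota> p) a))) = amplification tens (\<pi> p) (U (tens (\<iota> q) a))"
    and \<iota>_dense: "closure (span (range \<iota>)) = UNIV"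
    and bounded_clinear_\<Theta>: "bounded_clinear (\<Theta> f)"
    and \<Theta>_add: "\<Theta> (f + g) x = \<Theta> f x + \<Theta> g x"
    and \<Theta>_scaleR: "\<Theta> (r *\<^sub>R f) x = r *\<^sub>R \<Theta> f x"
    and \<Theta>_bound: "norm (\<Theta> f x) \<le> norm f * norm x"
    and bounded_linear_\<iota>2: "bounded_linear \<iota>2"
    and \<Theta>_box: "\<Theta> (box p q) (tn \<xi> \<eta>) = tn (\<pi> p \<xi>) (\<pi> q \<eta>)"
    and \<iota>2_box: "\<iota>2 (box p q) = tn (\<iota> p) (\<iota> q)"
    and box_dense: "closure (span (range (\<lambda>(p, q). box p q))) = UNIV"
    and U_unit: "U (tens (\<iota> e) a) = tens (\<iota> e) a"
    and \<Theta>_unit: "\<Theta> f (tn (\<iota> e) (\<iota> e)) = \<iota>2 f"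
begin

abbreviation "m p \<equiv> amplification tens (\<pi> p)"
abbreviation "M f \<equiv> amplification tens2 (\<Theta> f)"
abbreviation "W \<equiv> op_W tn tens tens2 U"

lemmas bounded_linear_m = H.bounded_linear_amplification[OF bounded_clinear_\<pi>]
lemmas bounded_linear_M = K.bounded_linear_amplification[OF bounded_clinear_\<Theta>]

lemma function_legs_swap:
  "function_legs act ip tens U act2 ip2 tens2 (\<lambda>\<xi> \<eta>. tn \<eta> \<xi>) \<iota> \<pi> \<iota>2 \<Theta> (\<lambda>p q. box q p) e"
proof (intro function_legs.intro leg_pair_swap function_legs_axioms.intro
      bounded_clinear_\<pi> \<pi>_\<iota> U_mult \<iota>_dense bounded_clinear_\<Theta> \<Theta>_add \<Theta>_scaleR \<Theta>_bound
      bounded_linear_\<iota>2 \<Theta>_box \<iota>2_box U_unit \<Theta>_unit)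
  show "closure (span (range (\<lambda>(p, q). box q p))) = UNIV"
  proof (rule dense_span_mono[OF box_dense], safe)
    fix p q
    have "box p q \<in> range (\<lambda>(p, q). box q p)"
      by (rule range_eqI[of _ _ "(q, p)"]) simp
    then show "box p q \<in> closure (span (range (\<lambda>(p, q). box q p)))"
      by (rule closure_subset[THEN subsetD, OF span_base])
  qed
qed

lemma bounded_linear_M_function: "bounded_linear (\<lambda>f. M f x)"
proof (rule bounded_linear_intro[where K = "4 * norm x"])
  show "M (f + g) x = M f x + M g x" for f g
    using K.amplification_plus[OF bounded_clinear_\<Theta>[of f] bounded_clinear_\<Theta>[of g]]
    by (simp add: \<Theta>_add[abs_def])
  show sc: "M (r *\<^sub>R f) x = r *\<^sub>R M f x" for r f
    using K.amplification_scale[OF bounded_clinear_\<Theta>[of f], of "complex_of_real r"]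
    by (simp add: \<Theta>_scaleR[abs_def] scaleC_of_real)
  show "norm (M f x) \<le> norm f * (4 * norm x)" for f
  proof (cases "f = 0")
    case True
    then show ?thesis using sc[of 0 f] by simp
  next
    case False
    then show ?thesis
      using K.amplification_bound[OF bounded_clinear_\<Theta>[of f] \<Theta>_bound, of x] by (simp add: ac_simps)
  qed
qed

lemma M_P1: "M (box p q) (P1 \<xi> v) = P1 (\<pi> p \<xi>) (m q v)"
  by (rule H.eq_on_tens[OF bounded_linear_compose[OF bounded_linear_M bounded_linear_P1]
        bounded_linear_compose[OF bounded_linear_P1 bounded_linear_m]])
    (simp add: P1_tens K.amplification_tens[OF bounded_clinear_\<Theta>]
      H.amplification_tens[OF bounded_clinear_\<pi>] \<Theta>_box)

lemma M_P2: "M (box p q) (P2 \<eta> v) = P2 (\<pi> q \<eta>) (m p v)"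
  by (rule H.eq_on_tens[OF bounded_linear_compose[OF bounded_linear_M bounded_linear_P2]
        bounded_linear_compose[OF bounded_linear_P2 bounded_linear_m]])
    (simp add: P2_tens K.amplification_tens[OF bounded_clinear_\<Theta>]
      H.amplification_tens[OF bounded_clinear_\<pi>] \<Theta>_box)

lemma bounded_linear_tens2_\<iota>2: "bounded_linear (\<lambda>f. tens2 (\<iota>2 f) a)"
  by (rule bounded_linear_compose[OF K.bounded_linear_tens_left bounded_linear_\<iota>2])

text \<open>After reduction to \<open>f = p \<otimes> q\<close>, \<open>U_mult\<close> exchanges
  \<open>q\<close> with \<open>h\<close> in the second leg and \<open>\<pi>_\<iota>\<close>
  exchanges \<open>p\<close> with \<open>g\<close> in the first. Before \<open>L13\<close> is
  applied, multiplication by \<open>f\<close> acting on \<open>g \<otimes> h\<close> has thus become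
  multiplication by \<open>g \<otimes> h\<close>, and \<open>f\<close> survives only inside
  \<open>W (f \<otimes> 1)\<close>.\<close>

lemma op_W_M_elementary:
  "L13 (L23 (M f (inv L23 (tens2 (tn (\<iota> g) (\<iota> h)) a)))) =
    act2 (L13 (M (box g h) (inv L13 (W (tens2 (\<iota>2 f) 1))))) a" (is "?l f = ?r f")
proof (rule bounded_linear_eqI[OF _ _ box_dense])
  show "bounded_linear ?l"
    by (rule bounded_linear_compose[OF L13.bounded_linear_U bounded_linear_compose[OF
            L23.bounded_linear_U bounded_linear_M_function]])
  show "bounded_linear ?r"
    unfolding op_W_def o_apply L13.inv_U
    by (rule bounded_linear_compose[OF K.bounded_linear_act
          bounded_linear_compose[OF L13.bounded_linear_U bounded_linear_compose[OF bounded_linear_M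
              bounded_linear_compose[OF L23.bounded_linear_U bounded_linear_tens2_\<iota>2]]]])
  fix f assume "f \<in> range (\<lambda>(p, q). box p q)"
  then obtain p q where f: "f = box p q" by auto
  have "L23 (M f (inv L23 (tens2 (tn (\<iota> g) (\<iota> h)) a))) = P1 (\<pi> p (\<iota> g)) (U (m q (inv U (tens (\<iota> h) a))))"
    unfolding f P1_tens[symmetric] inv_leg23_P1 M_P1 leg23_P1 ..
  also have "\<dots> = M (box g h) (P1 (\<iota> p) (U (tens (\<iota> q) a)))"
    unfolding U_mult \<pi>_\<iota>[of p g] M_P1 ..
  also have "U (tens (\<iota> q) a) = act (U (tens (\<iota> q) 1)) a"
    by (simp add: H.U_act[symmetric] H.act_tens)
  also have "M (box g h) (P1 (\<iota> p) (act (U (tens (\<iota> q) 1)) a)) = act2 (M (box g h) (L23 (tens2 (\<iota>2 f) 1))) a"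
    unfolding P1_act K.amplification_act[OF bounded_clinear_\<Theta>] f \<iota>2_box P1_tens[symmetric] leg23_P1 ..
  finally show "?l f = ?r f"
    by (simp add: op_W_def L13.inv_U L13.U_act)
qed

text \<open>The reverse exchange, now with \<open>U_mult\<close> in the first leg and
  \<open>\<pi>_\<iota>\<close> in the second. Once \<open>f\<close> has replaced
  \<open>W (f \<otimes> 1)\<close>, this turns it back into a multiplication operator.\<close>

lemma leg13_M_elementary:
  "L13 (M (box g h) (inv L13 (tens2 (\<iota>2 f) 1))) = M f (L13 (tens2 (tn (\<iota> g) (\<iota> h)) 1))" (is "?l f = ?r f")
proof (rule bounded_linear_eqI[OF _ _ box_dense])
  show "bounded_linear ?l"
    by (rule bounded_linear_compose[OF L13.bounded_linear_U bounded_linear_compose[OF bounded_linear_M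
          bounded_linear_compose[OF L13.bounded_linear_inv_U bounded_linear_tens2_\<iota>2]]])
  show "bounded_linear ?r"
    by (rule bounded_linear_M_function)
  fix f assume "f \<in> range (\<lambda>(p, q). box p q)"
  then obtain p q where f: "f = box p q" by auto
  have "?l f = P2 (\<pi> h (\<iota> q)) (U (m g (inv U (tens (\<iota> p) 1))))"
    unfolding f \<iota>2_box P2_tens[symmetric] inv_leg13_P2 M_P2 leg13_P2 ..
  also have "\<dots> = ?r f"
    unfolding U_mult \<pi>_\<iota>[of h q] M_P2[symmetric] f leg13_P2[symmetric] P2_tens ..
  finally show "?l f = ?r f" .
qed

text \<open>Invariance joins the two exchanges: \<open>op_W_M_elementary\<close> ends in
  \<open>W (f \<otimes> 1) = f \<otimes> 1\<close>, where \<open>leg13_M_elementary\<close> takes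
  over. This proves the identity at \<open>inv L23 y\<close> for \<open>y\<close> built from
  continuous functions; density in each variable gives all \<open>y\<close>, in particular
  \<open>y = L23 x\<close>.\<close>

lemma op_W_commutes_if_fixed:
  assumes fixed: "W (tens2 (\<iota>2 f) 1) = tens2 (\<iota>2 f) 1"
  shows "W (M f x) = M f (W x)"
proof -
  have elem: "W (M f (inv L23 (tens2 (tn (\<iota> g) (\<iota> h)) a))) = M f (L13 (tens2 (tn (\<iota> g) (\<iota> h)) a))" for g h a
  proof -
    have "W (M f (inv L23 (tens2 (tn (\<iota> g) (\<iota> h)) a))) = act2 (M f (L13 (tens2 (tn (\<iota> g) (\<iota> h)) 1))) a"
      using op_W_M_elementary[of f g h a] unfolding fixed leg13_M_elementary by (simp add: op_W_def)
    also have "\<dots> = M f (L13 (tens2 (tn (\<iota> g) (\<iota> h)) a))"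
      unfolding K.amplification_act[OF bounded_clinear_\<Theta>, symmetric] L13.U_act[symmetric] K.act_tens by simp
    finally show ?thesis .
  qed
  have blW: "bounded_linear W"
    by (rule unitary_tensor.bounded_linear_U[OF unitary_op_W])
  have bl: "bounded_linear (\<lambda>y. W (M f (inv L23 y)))"
    by (rule bounded_linear_compose[OF blW bounded_linear_compose[OF bounded_linear_M L23.bounded_linear_inv_U]])
  have br: "bounded_linear (\<lambda>y. M f (L13 y))"
    by (rule bounded_linear_compose[OF bounded_linear_M L13.bounded_linear_U])
  have tl: "bounded_linear (\<lambda>\<xi>. tens2 (tn \<xi> \<eta>) a)" for \<eta> a
    by (rule bounded_linear_compose[OF K.bounded_linear_tens_left
          bounded_clinear_bounded_linear[OF bounded_clinear_tn_left]])
  have tr: "bounded_linear (\<lambda>\<eta>. tens2 (tn \<xi> \<eta>) a)" for \<xi> a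
    by (rule bounded_linear_compose[OF K.bounded_linear_tens_left
          bounded_clinear_bounded_linear[OF bounded_clinear_tn_right]])
  have elem1: "W (M f (inv L23 (tens2 (tn (\<iota> g) \<eta>) a))) = M f (L13 (tens2 (tn (\<iota> g) \<eta>) a))" for g \<eta> a
    by (rule bounded_linear_eqI[OF bounded_linear_compose[OF bl tr] bounded_linear_compose[OF br tr] \<iota>_dense])
      (use elem in auto)
  have elem2: "W (M f (inv L23 (tens2 (tn \<xi> \<eta>) a))) = M f (L13 (tens2 (tn \<xi> \<eta>) a))" for \<xi> \<eta> a
    by (rule bounded_linear_eqI[OF bounded_linear_compose[OF bl tl] bounded_linear_compose[OF br tl] \<iota>_dense])
      (use elem1 in auto)
  have "W (M f (inv L23 y)) = M f (L13 y)" for y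
    by (rule eq_on_tn[OF bl br elem2])
  from this[of "L23 x"] show ?thesis
    by (simp add: L23.inv_U op_W_def)
qed

lemma op_W_unit: "W (tens2 (tn (\<iota> e) (\<iota> e)) a) = tens2 (tn (\<iota> e) (\<iota> e)) a"
proof -
  have "L23 (tens2 (tn (\<iota> e) (\<iota> e)) a) = tens2 (tn (\<iota> e) (\<iota> e)) a"
    unfolding P1_tens[symmetric] leg23_P1 U_unit ..
  moreover have "L13 (tens2 (tn (\<iota> e) (\<iota> e)) a) = tens2 (tn (\<iota> e) (\<iota> e)) a"
    unfolding P2_tens[symmetric] leg13_P2 U_unit ..
  ultimately show ?thesis
    by (simp add: op_W_def)
qed

lemma op_W_conjugation_iff_commutes:
  "W \<circ> M f \<circ> module_adjoint ip2 W = M f \<longleftrightarrow> (\<forall>x. W (M f x) = M f (W x))"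
proof -
  interpret W: unitary_tensor act2 ip2 tens2 W
    by (rule unitary_op_W)
  show ?thesis
    unfolding W.module_adjoint_U fun_eq_iff by (metis W.inv_U W.U_inv comp_apply)
qed

text \<open>One direction evaluates at the constant function, which \<open>W\<close> fixes and which
  multiplication by \<open>f\<close> sends to \<open>f\<close>. The other is the exchange
  argument.\<close>

lemma op_W_conjugation_iff_fixed:
  "W \<circ> M f \<circ> module_adjoint ip2 W = M f \<longleftrightarrow> W (tens2 (\<iota>2 f) 1) = tens2 (\<iota>2 f) 1"
proof
  assume "W \<circ> M f \<circ> module_adjoint ip2 W = M f"
  then have "W (M f (tens2 (tn (\<iota> e) (\<iota> e)) 1)) = M f (W (tens2 (tn (\<iota> e) (\<iota> e)) 1))"
    unfolding op_W_conjugation_iff_commutes by blast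
  then show "W (tens2 (\<iota>2 f) 1) = tens2 (\<iota>2 f) 1"
    by (simp add: op_W_unit K.amplification_tens[OF bounded_clinear_\<Theta>] \<Theta>_unit)
next
  assume "W (tens2 (\<iota>2 f) 1) = tens2 (\<iota>2 f) 1"
  then show "W \<circ> M f \<circ> module_adjoint ip2 W = M f"
    unfolding op_W_conjugation_iff_commutes using op_W_commutes_if_fixed by blast
qed

lemmas op_Z_conjugation_iff_commutes =
  function_legs.op_W_conjugation_iff_commutes[OF function_legs_swap, unfolded op_W_swap]
lemmas op_Z_conjugation_iff_fixed =
  function_legs.op_W_conjugation_iff_fixed[OF function_legs_swap, unfolded op_W_swap]

end

section \<open>Continuous functions of two variables\<close>

lemma bcontfun_one_apply [simp]: "apply_bcontfun 1 x = 1"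
  by (simp add: bcontfun_apply)

lemma compact_continuous_bcontfun:
  fixes f :: "'x::topological_space \<Rightarrow> 'b::metric_space"
  assumes "compact (UNIV :: 'x set)" "continuous_on UNIV f"
  shows "f \<in> bcontfun"
  using compact_imp_bounded[OF compact_continuous_image[OF assms(2,1)]] assms(2)
  by (simp add: bcontfun_def)

lemma apply_Bcontfun_compact:
  fixes f :: "'x::topological_space \<Rightarrow> 'b::metric_space"
  assumes "compact (UNIV :: 'x set)" "continuous_on UNIV f"
  shows "apply_bcontfun (Bcontfun f) = f"
  by (rule Bcontfun_inverse[OF compact_continuous_bcontfun[OF assms]])

definition box :: "('x::metric_space \<Rightarrow>\<^sub>C complex) \<Rightarrow> ('x \<Rightarrow>\<^sub>C complex) \<Rightarrow> ('x \<times> 'x) \<Rightarrow>\<^sub>C complex"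
  where "box p q = Bcontfun (\<lambda>(x, y). p x * q y)"

lemma apply_box [simp]: "apply_bcontfun (box p q) (x, y) = p x * q y"
proof -
  have "(\<lambda>(x, y). p x * q y) \<in> bcontfun"
  proof (rule bcontfun_normI[where b = "norm p * norm q"])
    show "continuous_on UNIV (\<lambda>(x, y). p x * q y)"
      unfolding case_prod_unfold
      by (intro continuous_intros continuous_on_compose2[OF continuous_on_apply_bcontfun[of UNIV]]) auto
    show "norm (case z of (x, y) \<Rightarrow> p x * q y) \<le> norm p * norm q" for z
      by (cases z) (auto simp: norm_mult intro!: mult_mono norm_bounded)
  qed
  then show ?thesis
    by (simp add: box_def Bcontfun_inverse)
qed

lemma box_times: "box p q * box p' q' = box (p * p') (q * q')"
  by (rule bcontfun_eqI) (auto simp: bcontfun_apply)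

lemma box_scaleC: "c *\<^sub>C box p q = box (c *\<^sub>C p) q"
  by (rule bcontfun_eqI) (auto simp: bcontfun_apply)

lemma span_box_times:
  assumes "F \<in> span (range (\<lambda>(p, q). box p q))" "G \<in> span (range (\<lambda>(p, q). box p q))"
  shows "F * G \<in> span (range (\<lambda>(p, q). box p q))"
  using assms(1)
proof (induction rule: span_induct_alt)
  case base
  show ?case by (simp add: span_zero)
next
  case (step c x y)
  then obtain p q where x: "x = box p q" by auto
  have "x * G \<in> span (range (\<lambda>(p, q). box p q))"
    using assms(2)
  proof (induction rule: span_induct_alt)
    case base
    show ?case by (simp add: span_zero)
  next
    case (step d z w)
    then obtain p' q' where "z = box p' q'" by auto
    then have mem: "x * z \<in> range (\<lambda>(p, q). box p q)"
      by (intro range_eqI[of _ _ "(p * p', q * q')"]) (simp add: x box_times)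
    have "d *\<^sub>R (x * z) + x * w \<in> span (range (\<lambda>(p, q). box p q))"
      by (rule span_add[OF span_scale[OF span_base[OF mem]] step(2)])
    then show ?case by (simp add: distrib_left)
  qed
  then have "c *\<^sub>R (x * G) + y * G \<in> span (range (\<lambda>(p, q). box p q))"
    using step(2) by (intro span_add span_scale)
  then show ?case by (simp add: distrib_right)
qed

lemma span_box_scaleC:
  assumes "F \<in> span (range (\<lambda>(p, q). box p q))"
  shows "c *\<^sub>C F \<in> span (range (\<lambda>(p, q). box p q))"
  using assms
proof (induction rule: span_induct_alt)
  case base
  show ?case by (simp add: span_zero)
next
  case (step d x y)
  then obtain p q where "x = box p q" by auto
  then have mem: "c *\<^sub>C x \<in> range (\<lambda>(p, q). box p q)"
    by (intro range_eqI[of _ _ "(c *\<^sub>C p, q)"]) (simp add: box_scaleC)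
  have "d *\<^sub>R (c *\<^sub>C x) + c *\<^sub>C y \<in> span (range (\<lambda>(p, q). box p q))"
    by (rule span_add[OF span_scale[OF span_base[OF mem]] step(2)])
  also have "d *\<^sub>R (c *\<^sub>C x) + c *\<^sub>C y = c *\<^sub>C (d *\<^sub>R x + y)"
    by (simp add: scaleC_add_right scaleC_of_real[symmetric] scaleC_scaleC mult.commute)
  finally show ?case .
qed

text \<open>Real Stone--Weierstrass for the real functions whose complexification lies in the span.
  Points that differ in a coordinate are separated by the distance to that coordinate of one of
  them. Real and imaginary parts are approximated separately.\<close>

lemma box_dense:
  assumes compact: "compact (UNIV :: 'x::metric_space set)"
  shows "closure (span (range (\<lambda>(p, q). box p q :: ('x \<times> 'x) \<Rightarrow>\<^sub>C complex))) = UNIV"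
proof -
  let ?S = "span (range (\<lambda>(p, q). box p q :: ('x \<times> 'x) \<Rightarrow>\<^sub>C complex))"
  define R where "R = {f :: 'x \<times> 'x \<Rightarrow> real. \<exists>F\<in>?S. \<forall>z. apply_bcontfun F z = complex_of_real (f z)}"
  have base: "box p q \<in> ?S" for p q
    by (rule span_base, rule range_eqI[of _ _ "(p, q)"]) simp
  have dist_cont: "continuous_on UNIV (\<lambda>x :: 'x. complex_of_real (dist x a))" for a
    by (intro continuous_intros)
  note dist_apply = apply_Bcontfun_compact[OF compact dist_cont]
  have "function_ring_on R (UNIV :: ('x \<times> 'x) set)"
  proof
    show "compact (UNIV :: ('x \<times> 'x) set)"
      using compact_Times[OF compact compact] by simp
    show "continuous_on UNIV f" if "f \<in> R" for f
    proof -
      obtain F where "\<And>z. apply_bcontfun F z = complex_of_real (f z)"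
        using \<open>f \<in> R\<close> unfolding R_def by blast
      then have "f = (\<lambda>z. Re (apply_bcontfun F z))"
        by simp
      then show ?thesis
        by (metis continuous_on_Re continuous_on_apply_bcontfun)
    qed
    fix f g assume "f \<in> R" "g \<in> R"
    then obtain F G where F: "F \<in> ?S" "\<And>z. apply_bcontfun F z = complex_of_real (f z)"
      and G: "G \<in> ?S" "\<And>z. apply_bcontfun G z = complex_of_real (g z)"
      unfolding R_def by blast
    show "(\<lambda>z. f z + g z) \<in> R"
      unfolding R_def using F G by (auto intro!: bexI[of _ "F + G"] span_add)
    show "(\<lambda>z. f z * g z) \<in> R"
      unfolding R_def using F G by (auto intro!: bexI[of _ "F * G"] span_box_times simp: bcontfun_apply)
  next
    show "(\<lambda>_. c) \<in> R" for c
      unfolding R_def by (auto intro!: bexI[of _ "c *\<^sub>R box 1 1"] span_scale base simp: of_real_def)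
  next
    fix z w :: "'x \<times> 'x" assume "z \<noteq> w"
    show "\<exists>f\<in>R. f z \<noteq> f w"
    proof (cases "fst z = fst w")
      case True
      have "(\<lambda>v. dist (snd v) (snd w)) \<in> R"
        unfolding R_def
        by (auto intro!: bexI[of _ "box 1 (Bcontfun (\<lambda>x. complex_of_real (dist x (snd w))))"] base simp: dist_apply)
      then show ?thesis
        using \<open>z \<noteq> w\<close> True by (intro bexI) (auto simp: prod_eq_iff)
    next
      case False
      have "(\<lambda>v. dist (fst v) (fst w)) \<in> R"
        unfolding R_def
        by (auto intro!: bexI[of _ "box (Bcontfun (\<lambda>x. complex_of_real (dist x (fst w)))) 1"] base simp: dist_apply)
      then show ?thesis
        using False by (intro bexI) auto
    qed
  qed
  then interpret function_ring_on R UNIV .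
  have "F \<in> closure ?S" for F :: "('x \<times> 'x) \<Rightarrow>\<^sub>C complex"
    unfolding closure_approachable
  proof (intro allI impI)
    fix e :: real assume e: "e > 0"
    have c: "continuous_on UNIV (\<lambda>z. Re (apply_bcontfun F z))" "continuous_on UNIV (\<lambda>z. Im (apply_bcontfun F z))"
      by (intro continuous_intros continuous_on_apply_bcontfun)+
    \<comment> \<open>Thirds instead of halves, so that the non-strict sup-norm bound for the sum
      stays below \<open>e\<close>.\<close>
    have e3: "e / 3 > 0" using e by simp
    obtain g h where g: "g \<in> R" "\<And>z. \<bar>Re (apply_bcontfun F z) - g z\<bar> < e / 3"
      and h: "h \<in> R" "\<And>z. \<bar>Im (apply_bcontfun F z) - h z\<bar> < e / 3"
      using Stone_Weierstrass_basic[OF c(1) e3] Stone_Weierstrass_basic[OF c(2) e3] by blast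
    obtain G H where G: "G \<in> ?S" "\<And>z. apply_bcontfun G z = complex_of_real (g z)"
      and H: "H \<in> ?S" "\<And>z. apply_bcontfun H z = complex_of_real (h z)"
      using g(1) h(1) unfolding R_def by blast
    have "dist (G + \<i> *\<^sub>C H) F \<le> 2 * (e / 3)"
    proof (rule dist_bound)
      fix z
      have "cmod (apply_bcontfun F z - (complex_of_real (g z) + \<i> * complex_of_real (h z)))
          \<le> \<bar>Re (apply_bcontfun F z) - g z\<bar> + \<bar>Im (apply_bcontfun F z) - h z\<bar>"
        using cmod_le[of "apply_bcontfun F z - (complex_of_real (g z) + \<i> * complex_of_real (h z))"] by simp
      then show "dist (apply_bcontfun (G + \<i> *\<^sub>C H) z) (apply_bcontfun F z) \<le> 2 * (e / 3)"
        using g(2)[of z] h(2)[of z] by (simp add: bcontfun_apply G H dist_norm norm_minus_commute)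
    qed
    then have "dist (G + \<i> *\<^sub>C H) F < e"
      using e by simp
    moreover have "G + \<i> *\<^sub>C H \<in> ?S"
      by (intro span_add span_box_scaleC G H)
    ultimately show "\<exists>y\<in>?S. dist y F < e"
      by blast
  qed
  then show ?thesis
    by blast
qed

section \<open>Square-integrable functions\<close>

text \<open>The measurable sets over which \<open>f\<close> has integral zero form a Dynkin system;
  the last assumption puts the whole space into it. It is applied to closed sets and to measurable
  rectangles.\<close>

lemma (in sigma_finite_measure) AE_zero_if_generator_integrals_zero:
  fixes f :: "'a \<Rightarrow> complex"
  assumes f: "integrable M f"
    and G: "Int_stable G" "G \<subseteq> Pow (space M)" "sets M = sigma_sets (space M) G"
    and zero: "\<And>A. A \<in> G \<Longrightarrow> set_lebesgue_integral M A f = 0" "(\<integral>x. f x \<partial>M) = 0"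
  shows "AE x in M. f x = 0"
proof (rule density_zero[OF f])
  have int: "set_integrable M A f" if "A \<in> sets M" for A
    using that f unfolding set_integrable_def by (intro integrable_mult_indicator)
  fix A assume "A \<in> sets M"
  then have "A \<in> sigma_sets (space M) G"
    by (simp add: G)
  with G(1,2) show "set_lebesgue_integral M A f = 0"
  proof (induction rule: sigma_sets_induct_disjoint)
    case (compl A)
    then have A: "A \<in> sets M" by (simp add: G)
    have "set_lebesgue_integral M (A \<union> (space M - A)) f =
        set_lebesgue_integral M A f + set_lebesgue_integral M (space M - A) f"
      using A by (intro set_integral_Un int) auto
    moreover have "A \<union> (space M - A) = space M"
      using sets.sets_into_space[OF A] by auto
    ultimately show ?case
      using compl(2) zero(2) set_integral_space[OF f] by simp
  next
    case (union A)
    then have A: "A i \<in> sets M" for i by (auto simp: G)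
    have "set_lebesgue_integral M (\<Union>i. A i) f = (\<Sum>i. set_lebesgue_integral M (A i) f)"
      using union(1) A by (intro lebesgue_integral_countable_add int) (auto simp: disjoint_family_on_def)
    then show ?case
      using union by simp
  qed (use zero in \<open>auto simp: set_lebesgue_integral_def\<close>)
qed

lemma square_integrableD:
  assumes "f \<in> square_integrable M"
  shows "f \<in> borel_measurable M" "integrable M (\<lambda>x. (cmod (f x))\<^sup>2)"
  using assms by (auto simp: square_integrable_def)

lemma borel_measurable_cnj [measurable (raw)]:
  "f \<in> borel_measurable M \<Longrightarrow> (\<lambda>x. cnj (f x)) \<in> borel_measurable M"
  by (rule borel_measurable_continuous_on[where f = cnj]) (intro continuous_intros)

lemma square_integrable_cnj: "f \<in> square_integrable M \<Longrightarrow> (\<lambda>x. cnj (f x)) \<in> square_integrable M"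
  by (auto simp: square_integrable_def intro: borel_measurable_cnj)

lemma square_integrable_mult_integrable:
  assumes f: "f \<in> square_integrable M" and g: "g \<in> square_integrable M"
  shows "integrable M (\<lambda>x. f x * g x)"
proof (rule Bochner_Integration.integrable_bound)
  show "integrable M (\<lambda>x. (cmod (f x))\<^sup>2 + (cmod (g x))\<^sup>2)"
    using square_integrableD[OF f] square_integrableD[OF g] by (intro Bochner_Integration.integrable_add)
  show "(\<lambda>x. f x * g x) \<in> borel_measurable M"
    using square_integrableD[OF f] square_integrableD[OF g] by (intro borel_measurable_times)
  show "AE x in M. norm (f x * g x) \<le> norm ((cmod (f x))\<^sup>2 + (cmod (g x))\<^sup>2)"
  proof (rule AE_I2)
    fix x
    have "2 * (cmod (f x) * cmod (g x)) \<le> (cmod (f x))\<^sup>2 + (cmod (g x))\<^sup>2"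
      using sum_squares_bound[of "cmod (f x)" "cmod (g x)"] by simp
    then show "norm (f x * g x) \<le> norm ((cmod (f x))\<^sup>2 + (cmod (g x))\<^sup>2)"
      by (simp add: norm_mult) (smt (verit) mult_nonneg_nonneg norm_ge_zero)
  qed
qed

lemma square_integrable_add:
  assumes f: "f \<in> square_integrable M" and g: "g \<in> square_integrable M"
  shows "(\<lambda>x. f x + g x) \<in> square_integrable M"
proof -
  note m = square_integrableD(1)[OF f] square_integrableD(1)[OF g]
  have "integrable M (\<lambda>x. (cmod (f x + g x))\<^sup>2)"
  proof (rule Bochner_Integration.integrable_bound)
    show "integrable M (\<lambda>x. 2 * (cmod (f x))\<^sup>2 + 2 * (cmod (g x))\<^sup>2)"
      using square_integrableD[OF f] square_integrableD[OF g]
      by (intro Bochner_Integration.integrable_add integrable_mult_right)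
    show "(\<lambda>x. (cmod (f x + g x))\<^sup>2) \<in> borel_measurable M"
      using m by measurable
    show "AE x in M. norm ((cmod (f x + g x))\<^sup>2) \<le> norm (2 * (cmod (f x))\<^sup>2 + 2 * (cmod (g x))\<^sup>2)"
    proof (rule AE_I2)
      fix x
      have "(cmod (f x + g x))\<^sup>2 \<le> (cmod (f x) + cmod (g x))\<^sup>2"
        by (intro power_mono norm_triangle_ineq) simp
      also have "\<dots> \<le> 2 * (cmod (f x))\<^sup>2 + 2 * (cmod (g x))\<^sup>2"
        using sum_squares_bound[of "cmod (f x)" "cmod (g x)"] by (simp add: power2_sum)
      finally show "norm ((cmod (f x + g x))\<^sup>2) \<le> norm (2 * (cmod (f x))\<^sup>2 + 2 * (cmod (g x))\<^sup>2)"
        by simp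
    qed
  qed
  then show ?thesis
    using m by (auto simp: square_integrable_def)
qed

lemma square_integrable_bounded_mult:
  assumes f: "f \<in> borel_measurable M" "\<And>x. cmod (f x) \<le> B" and g: "g \<in> square_integrable M"
  shows "(\<lambda>x. f x * g x) \<in> square_integrable M"
proof -
  note m = f(1) square_integrableD(1)[OF g]
  have "integrable M (\<lambda>x. (cmod (f x * g x))\<^sup>2)"
  proof (rule Bochner_Integration.integrable_bound)
    show "integrable M (\<lambda>x. B\<^sup>2 * (cmod (g x))\<^sup>2)"
      using square_integrableD[OF g] by (intro integrable_mult_right)
    show "(\<lambda>x. (cmod (f x * g x))\<^sup>2) \<in> borel_measurable M"
      using m by measurable
    show "AE x in M. norm ((cmod (f x * g x))\<^sup>2) \<le> norm (B\<^sup>2 * (cmod (g x))\<^sup>2)"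
      by (rule AE_I2) (auto simp: norm_mult power_mult_distrib f(2) intro!: mult_right_mono power_mono)
  qed
  then show ?thesis
    using m by (auto simp: square_integrable_def)
qed

section \<open>The \<open>L\<^sup>2\<close>-space of a probability measure\<close>

text \<open>Measurability of continuous functions is assumed instead of
  \<open>sets M = sets borel\<close>, so that the locale also covers
  \<open>\<mu> \<Otimes>\<^sub>M \<mu>\<close>, whose sigma-algebra is given as a product.\<close>

locale cont_L2 = prob_space M + L2_space M cls
  for M :: "'z::metric_space measure" and cls :: "('z \<Rightarrow> complex) \<Rightarrow> 'h::chilbert_space" +
  assumes borel_measurable_bcontfun: "apply_bcontfun (f :: 'z \<Rightarrow>\<^sub>C complex) \<in> borel_measurable M"
begin

abbreviation "SQ \<equiv> square_integrable M"
abbreviation "rep \<equiv> L2_rep M cls"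
abbreviation "incl f \<equiv> cls (apply_bcontfun f)"
abbreviation "mult_op \<equiv> multiplication_op M cls"

definition conj_op :: "'h \<Rightarrow> 'h"
  where "conj_op \<xi> = cls (\<lambda>x. cnj (rep \<xi> x))"

lemma const_square_integrable: "(\<lambda>_. c) \<in> SQ"
  by (auto simp: square_integrable_def)

lemma bcontfun_square_integrable: "apply_bcontfun (f :: 'z \<Rightarrow>\<^sub>C complex) \<in> SQ"
  using square_integrable_bounded_mult[OF borel_measurable_bcontfun norm_bounded const_square_integrable[of 1]]
  by simp

lemma square_integrable_integrable: "f \<in> SQ \<Longrightarrow> integrable M f"
  using square_integrable_mult_integrable[OF _ const_square_integrable[of 1], of f] by simp

lemma square_integrable_scale: "f \<in> SQ \<Longrightarrow> (\<lambda>x. c * f x) \<in> SQ"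
  by (rule square_integrable_bounded_mult[where B = "cmod c"]) auto

lemma bcontfun_mult_square_integrable: "g \<in> SQ \<Longrightarrow> (\<lambda>x. apply_bcontfun f x * g x) \<in> SQ"
  by (rule square_integrable_bounded_mult[OF borel_measurable_bcontfun norm_bounded])

lemma rep_square_integrable: "rep \<xi> \<in> SQ"
  and cls_rep: "cls (rep \<xi>) = \<xi>"
proof -
  have "\<exists>f. f \<in> SQ \<and> cls f = \<xi>"
    using cls_surj by (metis UNIV_I imageE)
  then have "rep \<xi> \<in> SQ \<and> cls (rep \<xi>) = \<xi>"
    unfolding L2_rep_def by (rule someI_ex)
  then show "rep \<xi> \<in> SQ" "cls (rep \<xi>) = \<xi>"
    by auto
qed

lemma rep_cls: "f \<in> SQ \<Longrightarrow> AE x in M. rep (cls f) x = f x"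
  using cls_eq_iff[OF rep_square_integrable, of f "cls f"] by (simp only: cls_rep simp_thms)

lemma cls_cong_AE: "f \<in> SQ \<Longrightarrow> g \<in> SQ \<Longrightarrow> AE x in M. f x = g x \<Longrightarrow> cls f = cls g"
  by (simp add: cls_eq_iff)

lemma norm_cls_square: "f \<in> SQ \<Longrightarrow> (norm (cls f))\<^sup>2 = (\<integral>x. (cmod (f x))\<^sup>2 \<partial>M)"
proof -
  assume f: "f \<in> SQ"
  have "complex_of_real ((norm (cls f))\<^sup>2) = (\<integral>x. cnj (f x) * f x \<partial>M)"
    using cinner_cls[OF f f] by (simp add: cinner_self)
  also have "\<dots> = (\<integral>x. complex_of_real ((cmod (f x))\<^sup>2) \<partial>M)"
    by (simp only: complex_norm_square mult.commute)
  finally show ?thesis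
    by (simp only: integral_complex_of_real of_real_eq_iff)
qed

lemma norm_cls_le:
  assumes f: "f \<in> borel_measurable M" "\<And>x. cmod (f x) \<le> B" and B: "B \<ge> 0"
  shows "norm (cls f) \<le> B"
proof -
  have fS: "f \<in> SQ"
    using square_integrable_bounded_mult[OF f const_square_integrable[of 1]] by simp
  have "(norm (cls f))\<^sup>2 = (\<integral>x. (cmod (f x))\<^sup>2 \<partial>M)"
    by (rule norm_cls_square[OF fS])
  also have "\<dots> \<le> (\<integral>x. B\<^sup>2 \<partial>M)"
    using square_integrableD[OF fS] f(2) by (intro integral_mono power_mono) auto
  also have "\<dots> = B\<^sup>2"
    by (simp add: prob_space)
  finally show ?thesis
    using B by (rule power2_le_imp_le)
qed

lemma norm_incl_le: "norm (incl f) \<le> norm f"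
  by (rule norm_cls_le[OF borel_measurable_bcontfun norm_bounded norm_ge_zero])

lemma incl_add: "incl (f + g) = incl f + incl g"
  using cls_add[OF bcontfun_square_integrable bcontfun_square_integrable, of f g]
  by (simp add: plus_bcontfun.rep_eq[abs_def])

lemma incl_scaleC: "incl (c *\<^sub>C f) = c *\<^sub>C incl f"
  using cls_scaleC[OF bcontfun_square_integrable, of c f]
  by (simp add: scaleC_bcontfun.rep_eq[abs_def])

lemma bounded_clinear_incl: "bounded_clinear incl"
  by (rule bounded_clinearI[where C = 1, OF incl_add incl_scaleC]) (simp add: norm_incl_le)

lemma bounded_linear_incl: "bounded_linear incl"
  by (rule bounded_clinear_bounded_linear[OF bounded_clinear_incl])

lemma mult_op_cls:
  assumes g: "g \<in> SQ"
  shows "mult_op f (cls g) = cls (\<lambda>x. f x * g x)"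
  unfolding multiplication_op_def
  by (rule cls_cong_AE[OF bcontfun_mult_square_integrable[OF rep_square_integrable] bcontfun_mult_square_integrable[OF g]])
    (use rep_cls[OF g] in eventually_elim, simp)

lemma mult_op_incl: "mult_op p (incl q) = incl (p * q)"
  by (simp add: mult_op_cls[OF bcontfun_square_integrable] times_bcontfun.rep_eq)

lemma mult_op_incl_commute: "mult_op p (incl q) = mult_op q (incl p)"
  by (simp add: mult_op_cls[OF bcontfun_square_integrable] mult.commute)

lemma mult_op_add: "mult_op (f + g) \<xi> = mult_op f \<xi> + mult_op g \<xi>"
  using cls_add[OF bcontfun_mult_square_integrable[OF rep_square_integrable]
      bcontfun_mult_square_integrable[OF rep_square_integrable], of f \<xi> g \<xi>]
  by (simp add: multiplication_op_def distrib_right)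

lemma mult_op_scaleC: "mult_op (c *\<^sub>C f) \<xi> = c *\<^sub>C mult_op f \<xi>"
  using cls_scaleC[OF bcontfun_mult_square_integrable[OF rep_square_integrable], of c f \<xi>]
  by (simp add: multiplication_op_def scaleC_bcontfun.rep_eq mult.assoc)

lemma mult_op_scaleR: "mult_op (r *\<^sub>R f) \<xi> = r *\<^sub>R mult_op f \<xi>"
  using mult_op_scaleC[of "complex_of_real r"] by (simp add: scaleC_of_real)

lemma norm_mult_op_le: "norm (mult_op f \<xi>) \<le> norm f * norm \<xi>"
proof -
  note S = rep_square_integrable[of \<xi>]
  note fS = bcontfun_mult_square_integrable[OF S, of f]
  have "(norm (mult_op f \<xi>))\<^sup>2 = (\<integral>x. (cmod (f x * rep \<xi> x))\<^sup>2 \<partial>M)"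
    unfolding multiplication_op_def by (rule norm_cls_square[OF fS])
  also have "\<dots> \<le> (\<integral>x. (norm f)\<^sup>2 * (cmod (rep \<xi> x))\<^sup>2 \<partial>M)"
    using square_integrableD[OF fS] square_integrableD[OF S]
    by (intro integral_mono integrable_mult_right)
      (auto simp: norm_mult power_mult_distrib intro!: mult_right_mono power_mono norm_bounded)
  also have "\<dots> = (norm f * norm \<xi>)\<^sup>2"
    using norm_cls_square[OF S] by (simp add: cls_rep power_mult_distrib)
  finally show ?thesis
    by (rule power2_le_imp_le) simp
qed

lemma bounded_clinear_mult_op: "bounded_clinear (mult_op f)"
proof (rule bounded_clinearI[where C = "norm f"])
  show "mult_op f (\<xi> + \<eta>) = mult_op f \<xi> + mult_op f \<eta>" for \<xi> \<eta>
  proof -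
    note S = rep_square_integrable[of \<xi>] rep_square_integrable[of \<eta>]
    have "mult_op f (cls (\<lambda>x. rep \<xi> x + rep \<eta> x)) = cls (\<lambda>x. f x * rep \<xi> x + f x * rep \<eta> x)"
      by (simp add: mult_op_cls[OF square_integrable_add[OF S]] distrib_left)
    also have "\<dots> = mult_op f \<xi> + mult_op f \<eta>"
      unfolding multiplication_op_def using S by (intro cls_add bcontfun_mult_square_integrable)
    finally show ?thesis
      by (simp add: cls_add[OF S] cls_rep)
  qed
  show "mult_op f (c *\<^sub>C \<xi>) = c *\<^sub>C mult_op f \<xi>" for c \<xi>
  proof -
    note S = rep_square_integrable[of \<xi>]
    have "mult_op f (cls (\<lambda>x. c * rep \<xi> x)) = cls (\<lambda>x. c * (f x * rep \<xi> x))"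
      by (simp add: mult_op_cls[OF square_integrable_scale[OF S]] ac_simps)
    also have "\<dots> = c *\<^sub>C mult_op f \<xi>"
      unfolding multiplication_op_def using S by (intro cls_scaleC bcontfun_mult_square_integrable)
    finally show ?thesis
      by (simp add: cls_scaleC[OF S] cls_rep)
  qed
qed (rule norm_mult_op_le)

section \<open>Complex conjugation, and density of the continuous functions\<close>

lemma conj_op_cls:
  assumes f: "f \<in> SQ"
  shows "conj_op (cls f) = cls (\<lambda>x. cnj (f x))"
  unfolding conj_op_def
  by (rule cls_cong_AE[OF square_integrable_cnj[OF rep_square_integrable] square_integrable_cnj[OF f]])
    (use rep_cls[OF f] in eventually_elim, simp)

lemma conj_op_add: "conj_op (\<xi> + \<eta>) = conj_op \<xi> + conj_op \<eta>"
proof -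
  note S = rep_square_integrable[of \<xi>] rep_square_integrable[of \<eta>]
  show ?thesis
    using conj_op_cls[OF square_integrable_add[OF S]] cls_add[OF square_integrable_cnj[OF S(1)] square_integrable_cnj[OF S(2)]]
    by (simp add: cls_add[OF S] cls_rep) (simp add: conj_op_def)
qed

lemma conj_op_scaleC: "conj_op (c *\<^sub>C \<xi>) = cnj c *\<^sub>C conj_op \<xi>"
proof -
  note S = rep_square_integrable[of \<xi>]
  show ?thesis
    using conj_op_cls[OF square_integrable_scale[OF S]] cls_scaleC[OF square_integrable_cnj[OF S]]
    by (simp add: cls_scaleC[OF S] cls_rep) (simp add: conj_op_def)
qed

lemma conj_op_conj_op: "conj_op (conj_op \<xi>) = \<xi>"
  using conj_op_cls[OF square_integrable_cnj[OF rep_square_integrable[of \<xi>]]]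
  by (simp add: conj_op_def[symmetric] cls_rep)

lemma cinner_conj_op: "cinner (conj_op \<xi>) (conj_op \<eta>) = cinner \<eta> \<xi>"
proof -
  note S = rep_square_integrable[of \<xi>] rep_square_integrable[of \<eta>]
  have "cinner (conj_op \<xi>) (conj_op \<eta>) = (\<integral>x. rep \<xi> x * cnj (rep \<eta> x) \<partial>M)"
    unfolding conj_op_def using cinner_cls[OF square_integrable_cnj[OF S(1)] square_integrable_cnj[OF S(2)]] by simp
  also have "\<dots> = cinner (cls (rep \<eta>)) (cls (rep \<xi>))"
    unfolding cinner_cls[OF S(2,1)] by (simp add: mult.commute)
  finally show ?thesis
    by (simp add: cls_rep)
qed

lemma incl_star: "incl (star f) = conj_op (incl f)"
  by (simp add: conj_op_cls[OF bcontfun_square_integrable] star_bcontfun.rep_eq)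

lemma cinner_cls_rep: "f \<in> SQ \<Longrightarrow> cinner (cls f) \<xi> = (\<integral>x. cnj (f x) * rep \<xi> x \<partial>M)"
  using cinner_cls[OF _ rep_square_integrable, of f \<xi>] by (simp add: cls_rep)

lemma eq_zero_if_rep_AE_zero: "AE x in M. rep \<xi> x = 0 \<Longrightarrow> \<xi> = 0"
proof -
  assume "AE x in M. rep \<xi> x = 0"
  then have "cls (rep \<xi>) = cls (\<lambda>x. 0 * rep \<xi> x)"
    by (intro cls_cong_AE[OF rep_square_integrable square_integrable_scale[OF rep_square_integrable]]) auto
  then show ?thesis
    using cls_scaleC[OF rep_square_integrable, of 0 \<xi>] by (simp add: cls_rep)
qed

text \<open>A vector orthogonal to all continuous functions has integral zero over every closed set,
  by dominated convergence along continuous approximations of the indicator; closed sets generate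
  the Borel sets.\<close>

lemma incl_dense:
  assumes borel: "sets M = sets borel"
  shows "closure (span (range incl)) = UNIV"
proof (rule dense_span_if_orthogonal_trivial)
  fix c b assume "b \<in> range incl"
  then show "c *\<^sub>C b \<in> range incl"
    by (auto simp: incl_scaleC[symmetric])
next
  fix \<xi> :: 'h
  assume orth: "\<And>b. b \<in> range incl \<Longrightarrow> cinner b \<xi> = 0"
  note S = rep_square_integrable[of \<xi>]
  note int = square_integrable_integrable[OF S]
  have sp: "space M = UNIV"
    using sets_eq_imp_space_eq[OF borel] by simp
  have orth_fun: "(\<integral>x. apply_bcontfun f x * rep \<xi> x \<partial>M) = 0" for f
    using orth[OF rangeI[of _ "star f"]] unfolding cinner_cls_rep[OF bcontfun_square_integrable]
    by (simp add: star_bcontfun.rep_eq)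
  have "AE x in M. rep \<xi> x = 0"
  proof (rule AE_zero_if_generator_integrals_zero[OF int])
    show "Int_stable {C :: 'z set. closed C}"
      by (auto simp: Int_stable_def)
    show "sets M = sigma_sets (space M) {C. closed C}"
      unfolding borel sp borel_eq_closed by (simp add: sets_measure_of_conv)
    show "(\<integral>x. rep \<xi> x \<partial>M) = 0"
      using orth_fun[of 1] by simp
    show "set_lebesgue_integral M C (rep \<xi>) = 0" if "C \<in> {C. closed C}" for C
    proof (cases "C = {}")
      case False
      have C: "closed C" using that by simp
      \<comment> \<open>For \<open>n > 0\<close> these cut-offs are 1 on \<open>C\<close> and vanish
        at distance at least \<open>1 / n\<close> from it, so they converge to the indicator of the
        closed set \<open>C\<close>. The empty set is treated apart, since \<open>infdist\<close> to
        it is 0 by convention.\<close>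
      define \<phi> where "\<phi> n x = complex_of_real (max 0 (1 - real n * infdist x C))" for n x
      have cont: "continuous_on UNIV (\<phi> n)" for n
        unfolding \<phi>_def by (intro continuous_intros continuous_on_infdist)
      have bound: "cmod (\<phi> n x) \<le> 1" for n x
        unfolding \<phi>_def norm_of_real by (auto simp: infdist_nonneg)
      have \<phi>: "apply_bcontfun (Bcontfun (\<phi> n)) = \<phi> n" for n
        by (rule Bcontfun_inverse[OF bcontfun_normI[OF cont bound]])
      have "(\<lambda>n. \<integral>x. \<phi> n x * rep \<xi> x \<partial>M) \<longlonglongrightarrow> (\<integral>x. indicator C x *\<^sub>R rep \<xi> x \<partial>M)"
      proof (rule integral_dominated_convergence[where w = "\<lambda>x. cmod (rep \<xi> x)"])
        show "(\<lambda>x. indicator C x *\<^sub>R rep \<xi> x) \<in> borel_measurable M"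
          using borel_closed[OF C] square_integrableD(1)[OF S]
          by (intro borel_measurable_scaleR borel_measurable_indicator) (simp_all add: borel)
        show "(\<lambda>x. \<phi> n x * rep \<xi> x) \<in> borel_measurable M" for n
          using borel_measurable_bcontfun[of "Bcontfun (\<phi> n)"] square_integrableD(1)[OF S]
          by (simp add: \<phi> borel_measurable_times)
        show "integrable M (\<lambda>x. cmod (rep \<xi> x))"
          by (rule integrable_norm[OF int])
        show "AE x in M. norm (\<phi> n x * rep \<xi> x) \<le> cmod (rep \<xi> x)" for n
          by (rule AE_I2) (simp add: norm_mult mult_left_le_one_le bound)
        show "AE x in M. (\<lambda>n. \<phi> n x * rep \<xi> x) \<longlonglongrightarrow> indicator C x *\<^sub>R rep \<xi> x"
        proof (rule AE_I2)
          fix x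
          have "(\<lambda>n. \<phi> n x) \<longlonglongrightarrow> indicator C x"
          proof (cases "x \<in> C")
            case True
            then show ?thesis by (simp add: \<phi>_def)
          next
            case notin: False
            then have pos: "infdist x C > 0"
              using C False by (simp add: in_closed_iff_infdist_zero infdist_nonneg order_less_le)
            obtain N where N: "1 / infdist x C < real N"
              using reals_Archimedean2 by blast
            have "\<phi> n x = 0" if "n \<ge> N" for n
            proof -
              have "1 / infdist x C \<le> real n"
                using N that by linarith
              then have "1 \<le> real n * infdist x C"
                using pos by (simp add: field_simps)
              then show ?thesis by (simp add: \<phi>_def)
            qed
            then show ?thesis
              using notin by (intro tendsto_eventually) (auto simp: eventually_sequentially)
          qed
          then have "(\<lambda>n. \<phi> n x * rep \<xi> x) \<longlonglongrightarrow> indicator C x * rep \<xi> x"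
            by (intro tendsto_mult tendsto_const)
          then show "(\<lambda>n. \<phi> n x * rep \<xi> x) \<longlonglongrightarrow> indicator C x *\<^sub>R rep \<xi> x"
            by (cases "x \<in> C") auto
        qed
      qed
      moreover have "(\<integral>x. \<phi> n x * rep \<xi> x \<partial>M) = 0" for n
        using orth_fun[of "Bcontfun (\<phi> n)"] by (simp add: \<phi>)
      ultimately show ?thesis
        unfolding set_lebesgue_integral_def by (simp add: LIMSEQ_const_iff)
    qed (simp add: set_lebesgue_integral_def)
  qed (simp add: sp)
  then show "\<xi> = 0"
    by (rule eq_zero_if_rep_AE_zero)
qed

end

section \<open>The \<open>L\<^sup>2\<close>-space of the square and kernel operators\<close>

text \<open>Continuous functions on the square are uniform limits of sums of products
  \<open>p(x) q(y)\<close>, which are measurable for the product sigma-algebra. The product is thus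
  never compared with the Borel sigma-algebra of the square.\<close>

lemma borel_measurable_pair_bcontfun:
  fixes \<mu> :: "'x::metric_space measure" and F :: "('x \<times> 'x) \<Rightarrow>\<^sub>C complex"
  assumes compact: "compact (UNIV :: 'x set)" and borel: "sets \<mu> = sets borel"
  shows "apply_bcontfun F \<in> borel_measurable (\<mu> \<Otimes>\<^sub>M \<mu>)"
proof -
  have one: "apply_bcontfun p \<in> borel_measurable \<mu>" for p :: "'x \<Rightarrow>\<^sub>C complex"
    using borel_measurable_continuous_onI[OF continuous_on_apply_bcontfun[of UNIV p]]
    by (simp cong: measurable_cong_sets add: borel)
  have span: "apply_bcontfun G \<in> borel_measurable (\<mu> \<Otimes>\<^sub>M \<mu>)"
    if "G \<in> span (range (\<lambda>(p, q). box p q))" for G :: "('x \<times> 'x) \<Rightarrow>\<^sub>C complex"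
    using that
  proof (induction rule: span_induct_alt)
    case base
    have "apply_bcontfun 0 = (\<lambda>z :: 'x \<times> 'x. 0 :: complex)"
      by (simp add: zero_bcontfun.rep_eq fun_eq_iff)
    then show ?case by simp
  next
    case (step c x y)
    then obtain p q where x: "x = box p q" by auto
    have "(\<lambda>z. apply_bcontfun p (fst z) * apply_bcontfun q (snd z)) \<in> borel_measurable (\<mu> \<Otimes>\<^sub>M \<mu>)"
      by (intro borel_measurable_times measurable_compose[OF measurable_fst one] measurable_compose[OF measurable_snd one])
    then have "(\<lambda>z. c *\<^sub>R (apply_bcontfun p (fst z) * apply_bcontfun q (snd z)) + apply_bcontfun y z) \<in> borel_measurable (\<mu> \<Otimes>\<^sub>M \<mu>)"
      using step(2) by (intro borel_measurable_add borel_measurable_scaleR borel_measurable_const)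
    moreover have "apply_bcontfun (c *\<^sub>R x + y) = (\<lambda>z. c *\<^sub>R (apply_bcontfun p (fst z) * apply_bcontfun q (snd z)) + apply_bcontfun y z)"
      by (auto simp: fun_eq_iff x)
    ultimately show ?case by (simp only:)
  qed
  have "F \<in> closure (span (range (\<lambda>(p, q). box p q)))"
    using box_dense[OF compact] by simp
  then obtain G where G: "\<And>n. G n \<in> span (range (\<lambda>(p, q). box p q))" "G \<longlonglongrightarrow> F"
    unfolding closure_sequential by blast
  show ?thesis
  proof (rule borel_measurable_LIMSEQ_metric)
    show "apply_bcontfun (G n) \<in> borel_measurable (\<mu> \<Otimes>\<^sub>M \<mu>)" for n
      by (rule span[OF G(1)])
    show "(\<lambda>n. apply_bcontfun (G n) z) \<longlonglongrightarrow> apply_bcontfun F z" for z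
      using tendsto_uniform_limitI[OF tendsto_bcontfun_uniform_limit[OF G(2)]] by simp
  qed
qed

lemma (in pair_sigma_finite)
  fixes f :: "'a \<Rightarrow> complex" and g :: "'b \<Rightarrow> complex"
  assumes f: "integrable M1 f" and g: "integrable M2 g"
  shows integrable_tensor: "integrable (M1 \<Otimes>\<^sub>M M2) (\<lambda>(x, y). f x * g y)"
    and integral_tensor: "(\<integral>(x, y). f x * g y \<partial>(M1 \<Otimes>\<^sub>M M2)) = (\<integral>x. f x \<partial>M1) * (\<integral>y. g y \<partial>M2)"
proof -
  have m: "(\<lambda>(x, y). f x * g y) \<in> borel_measurable (M1 \<Otimes>\<^sub>M M2)"
    using borel_measurable_integrable[OF f] borel_measurable_integrable[OF g] by measurable
  show int: "integrable (M1 \<Otimes>\<^sub>M M2) (\<lambda>(x, y). f x * g y)"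
  proof (rule Fubini_integrable[OF m])
    show "integrable M1 (\<lambda>x. \<integral>y. norm (case (x, y) of (x, y) \<Rightarrow> f x * g y) \<partial>M2)"
      using integrable_mult_left[OF integrable_norm[OF f], of "\<integral>y. norm (g y) \<partial>M2"]
      by (simp add: norm_mult)
  qed (use g in simp)
  show "(\<integral>(x, y). f x * g y \<partial>(M1 \<Otimes>\<^sub>M M2)) = (\<integral>x. f x \<partial>M1) * (\<integral>y. g y \<partial>M2)"
    using integral_fst'[OF int] by simp
qed

locale square_L2 = X: cont_L2 \<mu> cls + XX: cont_L2 "\<mu> \<Otimes>\<^sub>M \<mu>" cls2
  for \<mu> :: "'x::metric_space measure" and cls :: "('x \<Rightarrow> complex) \<Rightarrow> 'h::chilbert_space"
    and cls2 :: "('x \<times> 'x \<Rightarrow> complex) \<Rightarrow> 'k::chilbert_space" +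
  assumes compact: "compact (UNIV :: 'x set)" and borel: "sets \<mu> = sets borel"
begin

sublocale pair_sigma_finite \<mu> \<mu>
  by unfold_locales

abbreviation "tn \<equiv> L2_tensor \<mu> cls cls2"
abbreviation "kop \<equiv> kernel_op \<mu> cls"

lemma space_\<mu> [simp]: "space \<mu> = UNIV"
  using sets_eq_imp_space_eq[OF borel] by simp

lemma tensor_square_integrable:
  assumes f: "f \<in> X.SQ" and g: "g \<in> X.SQ"
  shows "(\<lambda>(x, y). f x * g y) \<in> XX.SQ"
proof -
  have m: "(\<lambda>(x, y). f x * g y) \<in> borel_measurable (\<mu> \<Otimes>\<^sub>M \<mu>)"
    using square_integrableD(1)[OF f] square_integrableD(1)[OF g] by measurable
  have "integrable \<mu> (\<lambda>x. complex_of_real ((cmod (f x))\<^sup>2))" "integrable \<mu> (\<lambda>x. complex_of_real ((cmod (g x))\<^sup>2))"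
    by (rule integrable_of_real[OF square_integrableD(2)[OF f]] integrable_of_real[OF square_integrableD(2)[OF g]])+
  from integrable_norm[OF integrable_tensor[OF this]]
  have "integrable (\<mu> \<Otimes>\<^sub>M \<mu>) (\<lambda>z. (cmod (case z of (x, y) \<Rightarrow> f x * g y))\<^sup>2)"
    by (simp add: case_prod_unfold norm_mult norm_power power_mult_distrib)
  then show ?thesis
    using m by (simp add: square_integrable_def)
qed

lemma tn_cls:
  assumes f: "f \<in> X.SQ" and g: "g \<in> X.SQ"
  shows "tn (cls f) (cls g) = cls2 (\<lambda>(x, y). f x * g y)"
  unfolding L2_tensor_def
proof (rule XX.cls_cong_AE[OF tensor_square_integrable[OF X.rep_square_integrable X.rep_square_integrable]
      tensor_square_integrable[OF f g]])
  let ?P = "\<lambda>z. (case z of (x, y) \<Rightarrow> X.rep (cls f) x * X.rep (cls g) y) = (case z of (x, y) \<Rightarrow> f x * g y)"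
  show "AE z in \<mu> \<Otimes>\<^sub>M \<mu>. ?P z"
  proof (rule AE_pair_measure)
    have "(\<lambda>z. (case z of (x, y) \<Rightarrow> X.rep (cls f) x * X.rep (cls g) y)) \<in> borel_measurable (\<mu> \<Otimes>\<^sub>M \<mu>)"
      "(\<lambda>z. (case z of (x, y) \<Rightarrow> f x * g y)) \<in> borel_measurable (\<mu> \<Otimes>\<^sub>M \<mu>)"
      using tensor_square_integrable[OF X.rep_square_integrable X.rep_square_integrable]
        tensor_square_integrable[OF f g] by (auto dest: square_integrableD)
    then show "{z \<in> space (\<mu> \<Otimes>\<^sub>M \<mu>). ?P z} \<in> sets (\<mu> \<Otimes>\<^sub>M \<mu>)"
      by measurable
    show "AE x in \<mu>. AE y in \<mu>. ?P (x, y)"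
      using X.rep_cls[OF f]
    proof eventually_elim
      case (elim x)
      show ?case
        using X.rep_cls[OF g] by eventually_elim (simp add: elim)
    qed
  qed
qed

lemma tn_reps: "tn \<xi> \<eta> = cls2 (\<lambda>(x, y). X.rep \<xi> x * X.rep \<eta> y)"
  by (simp add: L2_tensor_def)

lemmas tensor_rep = tensor_square_integrable[OF X.rep_square_integrable X.rep_square_integrable]

lemma tn_add_left: "tn (\<xi> + \<xi>') \<eta> = tn \<xi> \<eta> + tn \<xi>' \<eta>"
proof -
  note S = X.rep_square_integrable
  have "tn (cls (\<lambda>x. X.rep \<xi> x + X.rep \<xi>' x)) (cls (X.rep \<eta>)) = cls2 (\<lambda>z. (case z of (x, y) \<Rightarrow> X.rep \<xi> x * X.rep \<eta> y) + (case z of (x, y) \<Rightarrow> X.rep \<xi>' x * X.rep \<eta> y))"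
    unfolding tn_cls[OF square_integrable_add[OF S S] S] by (simp add: case_prod_unfold distrib_right)
  also have "\<dots> = tn \<xi> \<eta> + tn \<xi>' \<eta>"
    unfolding tn_reps by (rule XX.cls_add[OF tensor_rep tensor_rep])
  finally show ?thesis
    by (simp add: X.cls_add[OF S S] X.cls_rep)
qed

lemma tn_add_right: "tn \<xi> (\<eta> + \<eta>') = tn \<xi> \<eta> + tn \<xi> \<eta>'"
proof -
  note S = X.rep_square_integrable
  have "tn (cls (X.rep \<xi>)) (cls (\<lambda>x. X.rep \<eta> x + X.rep \<eta>' x)) = cls2 (\<lambda>z. (case z of (x, y) \<Rightarrow> X.rep \<xi> x * X.rep \<eta> y) + (case z of (x, y) \<Rightarrow> X.rep \<xi> x * X.rep \<eta>' y))"
    unfolding tn_cls[OF S square_integrable_add[OF S S]] by (simp add: case_prod_unfold distrib_left)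
  also have "\<dots> = tn \<xi> \<eta> + tn \<xi> \<eta>'"
    unfolding tn_reps by (rule XX.cls_add[OF tensor_rep tensor_rep])
  finally show ?thesis
    by (simp add: X.cls_add[OF S S] X.cls_rep)
qed

lemma tn_scaleC_left: "tn (c *\<^sub>C \<xi>) \<eta> = c *\<^sub>C tn \<xi> \<eta>"
proof -
  note S = X.rep_square_integrable
  have "tn (cls (\<lambda>x. c * X.rep \<xi> x)) (cls (X.rep \<eta>)) = cls2 (\<lambda>z. c * (case z of (x, y) \<Rightarrow> X.rep \<xi> x * X.rep \<eta> y))"
    unfolding tn_cls[OF X.square_integrable_scale[OF S] S] by (simp add: case_prod_unfold mult.assoc)
  also have "\<dots> = c *\<^sub>C tn \<xi> \<eta>"
    unfolding tn_reps by (rule XX.cls_scaleC[OF tensor_rep])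
  finally show ?thesis
    by (simp add: X.cls_scaleC[OF S] X.cls_rep)
qed

lemma tn_scaleC_right: "tn \<xi> (c *\<^sub>C \<eta>) = c *\<^sub>C tn \<xi> \<eta>"
proof -
  note S = X.rep_square_integrable
  have "tn (cls (X.rep \<xi>)) (cls (\<lambda>x. c * X.rep \<eta> x)) = cls2 (\<lambda>z. c * (case z of (x, y) \<Rightarrow> X.rep \<xi> x * X.rep \<eta> y))"
    unfolding tn_cls[OF S X.square_integrable_scale[OF S]] by (simp add: case_prod_unfold ac_simps)
  also have "\<dots> = c *\<^sub>C tn \<xi> \<eta>"
    unfolding tn_reps by (rule XX.cls_scaleC[OF tensor_rep])
  finally show ?thesis
    by (simp add: X.cls_scaleC[OF S] X.cls_rep)
qed

lemma cinner_tn: "cinner (tn \<xi> \<eta>) (tn \<xi>' \<eta>') = cinner \<xi> \<xi>' * cinner \<eta> \<eta>'"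
proof -
  note S = X.rep_square_integrable
  note int = square_integrable_mult_integrable[OF square_integrable_cnj[OF S] S]
  have "cinner (tn \<xi> \<eta>) (tn \<xi>' \<eta>') =
      (\<integral>z. (case z of (x, y) \<Rightarrow> (cnj (X.rep \<xi> x) * X.rep \<xi>' x) * (cnj (X.rep \<eta> y) * X.rep \<eta>' y)) \<partial>(\<mu> \<Otimes>\<^sub>M \<mu>))"
    unfolding tn_reps XX.cinner_cls[OF tensor_rep tensor_rep] by (simp add: case_prod_unfold ac_simps)
  also have "\<dots> = (\<integral>x. cnj (X.rep \<xi> x) * X.rep \<xi>' x \<partial>\<mu>) * (\<integral>y. cnj (X.rep \<eta> y) * X.rep \<eta>' y \<partial>\<mu>)"
    by (rule integral_tensor[OF int int])
  also have "\<dots> = cinner \<xi> \<xi>' * cinner \<eta> \<eta>'"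
    unfolding X.cinner_cls[OF S S, symmetric] by (simp add: X.cls_rep)
  finally show ?thesis .
qed

text \<open>Pairing with tensors of indicator functions gives integral zero over all measurable
  rectangles, and these generate the product sigma-algebra.\<close>

lemma tn_dense: "closure (span (range (\<lambda>(\<xi>, \<eta>). tn \<xi> \<eta>))) = UNIV"
proof (rule dense_span_if_orthogonal_trivial)
  fix c b assume "b \<in> range (\<lambda>(\<xi>, \<eta>). tn \<xi> \<eta>)"
  then obtain \<xi> \<eta> where b: "b = tn \<xi> \<eta>" by auto
  show "c *\<^sub>C b \<in> range (\<lambda>(\<xi>, \<eta>). tn \<xi> \<eta>)"
    by (rule range_eqI[of _ _ "(c *\<^sub>C \<xi>, \<eta>)"]) (simp add: b tn_scaleC_left)
next
  fix x :: 'k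
  assume orth: "\<And>b. b \<in> range (\<lambda>(\<xi>, \<eta>). tn \<xi> \<eta>) \<Longrightarrow> cinner b x = 0"
  have ind: "(\<lambda>x. indicator A x :: complex) \<in> X.SQ" if "A \<in> sets \<mu>" for A
    using square_integrable_bounded_mult[OF borel_measurable_indicator[OF that] _ X.const_square_integrable[of 1], where B = 1]
    by (simp add: indicator_def)
  have rect: "set_lebesgue_integral (\<mu> \<Otimes>\<^sub>M \<mu>) (A \<times> B) (XX.rep x) = 0" if A: "A \<in> sets \<mu>" and B: "B \<in> sets \<mu>" for A B
  proof -
    have "0 = cinner (tn (cls (indicator A)) (cls (indicator B))) x"
      by (rule orth[symmetric]) (rule range_eqI[of _ _ "(cls (indicator A), cls (indicator B))"], simp)
    also have "\<dots> = (\<integral>z. cnj (case z of (x, y) \<Rightarrow> indicator A x * indicator B y) * XX.rep x z \<partial>(\<mu> \<Otimes>\<^sub>M \<mu>))"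
      unfolding tn_cls[OF ind[OF A] ind[OF B]]
      by (rule XX.cinner_cls_rep[OF tensor_square_integrable[OF ind[OF A] ind[OF B]]])
    also have "\<dots> = set_lebesgue_integral (\<mu> \<Otimes>\<^sub>M \<mu>) (A \<times> B) (XX.rep x)"
      unfolding set_lebesgue_integral_def
      by (rule Bochner_Integration.integral_cong) (auto simp: indicator_def)
    finally show ?thesis by simp
  qed
  have "AE z in \<mu> \<Otimes>\<^sub>M \<mu>. XX.rep x z = 0"
  proof (rule XX.AE_zero_if_generator_integrals_zero[OF XX.square_integrable_integrable[OF XX.rep_square_integrable]])
    show "Int_stable {a \<times> b | a b. a \<in> sets \<mu> \<and> b \<in> sets \<mu>}"
      by (rule Int_stable_pair_measure_generator)
    show "sets (\<mu> \<Otimes>\<^sub>M \<mu>) = sigma_sets (space (\<mu> \<Otimes>\<^sub>M \<mu>)) {a \<times> b | a b. a \<in> sets \<mu> \<and> b \<in> sets \<mu>}"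
      by (simp only: sets_pair_measure space_pair_measure)
    show "set_lebesgue_integral (\<mu> \<Otimes>\<^sub>M \<mu>) C (XX.rep x) = 0" if "C \<in> {a \<times> b | a b. a \<in> sets \<mu> \<and> b \<in> sets \<mu>}" for C
      using that rect by auto
    have "UNIV \<in> sets \<mu>"
      using sets.top[of \<mu>] by simp
    from rect[OF this this] show "(\<integral>z. XX.rep x z \<partial>(\<mu> \<Otimes>\<^sub>M \<mu>)) = 0"
      by (simp add: set_lebesgue_integral_def)
  qed (simp add: space_pair_measure)
  then show "x = 0"
    by (rule XX.eq_zero_if_rep_AE_zero)
qed

lemma incl2_box: "XX.incl (box p q) = tn (X.incl p) (X.incl q)"
proof -
  have "apply_bcontfun (box p q) = (\<lambda>(x, y). p x * q y)"
    by (auto simp: fun_eq_iff)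
  then show ?thesis
    by (simp add: tn_cls[OF X.bcontfun_square_integrable X.bcontfun_square_integrable])
qed

lemma mult_op2_box: "XX.mult_op (box p q) (tn \<xi> \<eta>) = tn (X.mult_op p \<xi>) (X.mult_op q \<eta>)"
proof -
  note S = X.bcontfun_mult_square_integrable[OF X.rep_square_integrable]
  have "XX.mult_op (box p q) (tn \<xi> \<eta>) = cls2 (\<lambda>z. apply_bcontfun (box p q) z * (case z of (x, y) \<Rightarrow> X.rep \<xi> x * X.rep \<eta> y))"
    unfolding tn_reps by (rule XX.mult_op_cls[OF tensor_rep])
  also have "(\<lambda>z. apply_bcontfun (box p q) z * (case z of (x, y) \<Rightarrow> X.rep \<xi> x * X.rep \<eta> y)) =
      (\<lambda>(x, y). (p x * X.rep \<xi> x) * (q y * X.rep \<eta> y))"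
    by (auto simp: fun_eq_iff)
  also have "cls2 \<dots> = tn (X.mult_op p \<xi>) (X.mult_op q \<eta>)"
    unfolding multiplication_op_def by (rule tn_cls[OF S S, symmetric])
  finally show ?thesis .
qed

section \<open>Kernel operators and their kernel vectors\<close>

definition slice :: "(('x \<times> 'x) \<Rightarrow>\<^sub>C complex) \<Rightarrow> 'x \<Rightarrow> 'x \<Rightarrow>\<^sub>C complex"
  where "slice f x = Bcontfun (\<lambda>y. f (x, y))"

lemma slice_apply [simp]: "apply_bcontfun (slice f x) y = f (x, y)"
proof -
  have "continuous_on UNIV (\<lambda>y. f (x, y))"
    by (rule continuous_on_compose2[OF continuous_on_apply_bcontfun[of UNIV]]) (auto intro!: continuous_intros)
  then show ?thesis
    by (simp add: slice_def apply_Bcontfun_compact[OF compact])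
qed

text \<open>The Riesz vector of the functional that evaluates the image of the kernel operator at
  \<open>x\<close>. The \<open>star\<close> compensates for \<open>cinner\<close> being
  conjugate-linear in its first argument.\<close>

definition kernel_vector :: "(('x \<times> 'x) \<Rightarrow>\<^sub>C complex) \<Rightarrow> 'x \<Rightarrow> 'h"
  where "kernel_vector f x = X.incl (star (slice f x))"

lemma norm_kernel_vector: "norm (kernel_vector f x) \<le> norm f"
proof -
  have "norm (star (slice f x)) \<le> norm f"
    by (rule norm_bound) (simp add: star_bcontfun.rep_eq norm_bounded)
  then show ?thesis
    unfolding kernel_vector_def using X.norm_incl_le order_trans by blast
qed

text \<open>Uniform continuity on the compact square makes \<open>slice f x\<close> depend
  continuously on \<open>x\<close> in the sup norm. The continuity of the kernels in
  \<open>sandwich_kernel\<close> rests on this.\<close>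

lemma continuous_kernel_vector: "continuous_on UNIV (kernel_vector f)"
proof -
  have uc: "uniformly_continuous_on UNIV (apply_bcontfun f)"
    using compact_uniformly_continuous[OF continuous_on_apply_bcontfun[of UNIV f]] compact_Times[OF compact compact]
    by simp
  have "continuous_on UNIV (slice f)"
    unfolding continuous_on_iff
  proof (intro ballI allI impI)
    fix x :: 'x and e :: real assume "e > 0"
    then obtain d where d: "d > 0" "\<And>z w. dist z w < d \<Longrightarrow> dist (f z) (f w) < e / 2"
      using uc unfolding uniformly_continuous_on_def by (metis UNIV_I half_gt_zero)
    have "dist (slice f x') (slice f x) < e" if "dist x' x < d" for x'
    proof -
      have "dist (slice f x') (slice f x) \<le> e / 2"
      proof (rule dist_bound)
        fix y :: 'x
        have "dist (x', y) (x, y) < d" using that by (simp add: dist_prod_def)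
        from d(2)[OF this] show "dist (apply_bcontfun (slice f x') y) (apply_bcontfun (slice f x) y) \<le> e / 2" by simp
      qed
      then show ?thesis using \<open>e > 0\<close> by simp
    qed
    with d(1) show "\<exists>d>0. \<forall>x'\<in>UNIV. dist x' x < d \<longrightarrow> dist (slice f x') (slice f x) < e"
      by blast
  qed
  then show ?thesis
    unfolding kernel_vector_def
    by (intro bounded_linear.continuous_on[OF X.bounded_linear_incl] continuous_intros)
qed

lemma cinner_kernel_vector: "cinner (kernel_vector f x) \<xi> = (\<integral>y. f (x, y) * X.rep \<xi> y \<partial>\<mu>)"
  unfolding kernel_vector_def X.cinner_cls_rep[OF X.bcontfun_square_integrable]
  by (simp add: star_bcontfun.rep_eq)

lemma kernel_op_eq: "kop f \<xi> = cls (\<lambda>x. cinner (kernel_vector f x) \<xi>)"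
  by (simp add: kernel_op_def cinner_kernel_vector)

lemma continuous_cinner_vector:
  assumes "continuous_on UNIV v"
  shows "continuous_on UNIV (\<lambda>x. cinner (v x) \<xi>)"
  by (rule bounded_linear.continuous_on[OF bounded_bilinear.bounded_linear_left[OF bounded_bilinear_cinner] assms])

lemma cinner_vector_square_integrable:
  assumes v: "continuous_on UNIV v"
  shows "(\<lambda>x :: 'x. cinner (v x) \<xi>) \<in> X.SQ"
  using X.bcontfun_square_integrable[of "Bcontfun (\<lambda>x. cinner (v x) \<xi>)"]
  by (simp add: apply_Bcontfun_compact[OF compact continuous_cinner_vector[OF v]])

lemma bounded_clinear_kernel_op: "bounded_clinear (kop f)"
  and norm_kernel_op_le: "norm (kop f \<xi>) \<le> norm f * norm \<xi>"
proof -
  note S = cinner_vector_square_integrable[OF continuous_kernel_vector]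
  show bound: "norm (kop f \<xi>) \<le> norm f * norm \<xi>" for \<xi>
    unfolding kernel_op_eq
  proof (rule X.norm_cls_le)
    show "(\<lambda>x. cinner (kernel_vector f x) \<xi>) \<in> borel_measurable \<mu>"
      using S by (rule square_integrableD)
    show "cmod (cinner (kernel_vector f x) \<xi>) \<le> norm f * norm \<xi>" for x
      by (intro order_trans[OF cauchy_schwarz] mult_right_mono norm_kernel_vector) simp
  qed simp
  show "bounded_clinear (kop f)"
    by (rule bounded_clinearI[where C = "norm f", OF _ _ bound])
      (simp_all add: kernel_op_eq cinner_add_right cinner_scaleC_right X.cls_add[OF S S] X.cls_scaleC[OF S])
qed

text \<open>Fubini. Elementary tensors are linear in both factors, so \<open>\<eta>\<close> enters
  the pairing conjugated, whence \<open>conj_op\<close>. The identity links \<open>f\<close> as a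
  vector with \<open>f\<close> as an operator, in the form demanded by
  \<open>op_Z_fixed_iff\<close>.\<close>

lemma cinner_tn_incl: "cinner (tn \<xi> \<eta>) (XX.incl f) = cinner \<xi> (kop f (X.conj_op \<eta>))"
proof -
  note S = X.rep_square_integrable
  have rc: "AE y in \<mu>. X.rep (X.conj_op \<eta>) y = cnj (X.rep \<eta> y)"
    unfolding X.conj_op_def by (rule X.rep_cls[OF square_integrable_cnj[OF S]])
  let ?F = "\<lambda>z. cnj (case z of (x, y) \<Rightarrow> X.rep \<xi> x * X.rep \<eta> y) * f z"
  have int: "integrable (\<mu> \<Otimes>\<^sub>M \<mu>) ?F"
    by (rule square_integrable_mult_integrable[OF square_integrable_cnj[OF tensor_rep] XX.bcontfun_square_integrable])
  have inner: "(\<integral>y. ?F (x, y) \<partial>\<mu>) = cnj (X.rep \<xi> x) * cinner (kernel_vector f x) (X.conj_op \<eta>)" for x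
  proof -
    have "(\<integral>y. ?F (x, y) \<partial>\<mu>) = (\<integral>y. cnj (X.rep \<xi> x) * (f (x, y) * cnj (X.rep \<eta> y)) \<partial>\<mu>)"
      by (simp add: ac_simps)
    also have "\<dots> = cnj (X.rep \<xi> x) * (\<integral>y. f (x, y) * cnj (X.rep \<eta> y) \<partial>\<mu>)"
      by (rule integral_mult_right_zero)
    also have "(\<integral>y. f (x, y) * cnj (X.rep \<eta> y) \<partial>\<mu>) = (\<integral>y. f (x, y) * X.rep (X.conj_op \<eta>) y \<partial>\<mu>)"
    proof (rule integral_cong_AE)
      have m: "(\<lambda>y. f (x, y)) \<in> borel_measurable \<mu>"
        using X.borel_measurable_bcontfun[of "slice f x"] by (simp add: slice_apply[abs_def] cong: measurable_cong)
      show "(\<lambda>y. f (x, y) * cnj (X.rep \<eta> y)) \<in> borel_measurable \<mu>"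
        using m square_integrableD(1)[OF S[of \<eta>]] by (intro borel_measurable_times borel_measurable_cnj)
      show "(\<lambda>y. f (x, y) * X.rep (X.conj_op \<eta>) y) \<in> borel_measurable \<mu>"
        using m square_integrableD(1)[OF S[of "X.conj_op \<eta>"]] by (intro borel_measurable_times)
      show "AE y in \<mu>. f (x, y) * cnj (X.rep \<eta> y) = f (x, y) * X.rep (X.conj_op \<eta>) y"
        using rc by eventually_elim simp
    qed
    finally show ?thesis
      by (simp add: cinner_kernel_vector)
  qed
  have "cinner (tn \<xi> \<eta>) (XX.incl f) = (\<integral>z. ?F z \<partial>(\<mu> \<Otimes>\<^sub>M \<mu>))"
    unfolding tn_reps by (rule XX.cinner_cls[OF tensor_rep XX.bcontfun_square_integrable])
  also have "\<dots> = (\<integral>x. cnj (X.rep \<xi> x) * cinner (kernel_vector f x) (X.conj_op \<eta>) \<partial>\<mu>)"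
    unfolding integral_fst'[OF int, symmetric] inner ..
  also have "\<dots> = cinner (cls (X.rep \<xi>)) (kop f (X.conj_op \<eta>))"
    unfolding kernel_op_eq
    by (rule X.cinner_cls[OF S cinner_vector_square_integrable[OF continuous_kernel_vector], symmetric])
  finally show ?thesis
    by (simp add: X.cls_rep)
qed

end

section \<open>The unitary of an action\<close>

text \<open>\<open>associated_unitary\<close> only asserts the existence of the canonical map; here
  it is named, so that elements of \<open>C(X) \<otimes> C(G)\<close> such as
  \<open>\<beta> q * y\<close> can be treated as vectors of the module.\<close>

locale action_L2 = square_L2 \<mu> cls cls2 + E: unitary_tensor act ip tens U
    + F: hilbert_tensor act2 ip2 tens2 + T: min_tensor tX
  for \<mu> :: "'x::metric_space measure" and cls :: "('x \<Rightarrow> complex) \<Rightarrow> 'h::chilbert_space"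
    and cls2 :: "('x \<times> 'x \<Rightarrow> complex) \<Rightarrow> 'k::chilbert_space"
    and act :: "'e::{complex_normed_vector, banach} \<Rightarrow> 'a::cstar_algebra \<Rightarrow> 'e"
    and ip :: "'e \<Rightarrow> 'e \<Rightarrow> 'a"
    and tens :: "'h \<Rightarrow> 'a \<Rightarrow> 'e"
    and U :: "'e \<Rightarrow> 'e"
    and act2 :: "'f::{complex_normed_vector, banach} \<Rightarrow> 'a \<Rightarrow> 'f"
    and ip2 :: "'f \<Rightarrow> 'f \<Rightarrow> 'a"
    and tens2 :: "'k \<Rightarrow> 'a \<Rightarrow> 'f"
    and tX :: "('x \<Rightarrow>\<^sub>C complex) \<Rightarrow> 'a \<Rightarrow> 'p::cstar_algebra" +
  fixes \<beta> :: "('x \<Rightarrow>\<^sub>C complex) \<Rightarrow> 'p" and \<kappa> :: "'p \<Rightarrow> 'e"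
  assumes \<beta>_hom: "unital_star_hom \<beta>"
    and podles: "closure (span {\<beta> f * tX 1 a |f a. True}) = UNIV"
    and \<kappa>: "extends_to (\<lambda>(f, a). tX f a) (\<lambda>(f, a). tens (cls (apply_bcontfun f)) a) \<kappa>"
    and U_\<kappa>: "U (tens (cls (apply_bcontfun f)) a) = \<kappa> (\<beta> f * tX 1 a)"
begin

section \<open>What multiplicativity and the involution of \<open>\<beta>\<close> mean for
  \<open>U\<close>\<close>

lemma \<kappa>_tX: "\<kappa> (tX f a) = tens (X.incl f) a"
  and bounded_linear_\<kappa>: "bounded_linear \<kappa>"
  using \<kappa> by (auto simp: extends_to_def bounded_clinear_def)

lemma eq_on_tX:
  assumes "bounded_linear S" "bounded_linear R" "\<And>f a. S (tX f a) = R (tX f a)"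
  shows "S z = R z"
  by (rule bounded_linear_eqI[OF assms(1,2) T.dense]) (use assms(3) in auto)

lemma U_\<kappa>_unit: "U (tens (X.incl f) 1) = \<kappa> (\<beta> f)"
  by (simp add: U_\<kappa> T.one)

text \<open>On \<open>f \<otimes> a\<close> both sides are \<open>\<langle>f, g\<rangle>\<close>
  times \<open>star a\<close>. The involution is transported to the module at the level of matrix
  coefficients, which is where \<open>U_real\<close> uses it.\<close>

lemma star_ip_\<kappa>: "star (ip (tens (X.incl g) 1) (\<kappa> z)) = ip (tens (X.incl (star g)) 1) (\<kappa> (star z))"
proof (rule eq_on_tX[of "\<lambda>z. star (ip (tens (X.incl g) 1) (\<kappa> z))"
      "\<lambda>z. ip (tens (X.incl (star g)) 1) (\<kappa> (star z))"])
  show "bounded_linear (\<lambda>z. star (ip (tens (X.incl g) 1) (\<kappa> z)))"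
    by (rule bounded_linear_compose[OF bounded_linear_star bounded_linear_compose[OF
          E.bounded_linear_ip_right bounded_linear_\<kappa>]])
  show "bounded_linear (\<lambda>z. ip (tens (X.incl (star g)) 1) (\<kappa> (star z)))"
    by (rule bounded_linear_compose[OF E.bounded_linear_ip_right
          bounded_linear_compose[OF bounded_linear_\<kappa> bounded_linear_star]])
  show "star (ip (tens (X.incl g) 1) (\<kappa> (tX f a))) = ip (tens (X.incl (star g)) 1) (\<kappa> (star (tX f a)))" for f a
    unfolding T.star \<kappa>_tX E.ip_tens X.incl_star X.cinner_conj_op star_scaleC
    by (simp add: cinner_commute[of "X.incl f"])
qed

lemma bounded_linear_conj_op: "bounded_linear X.conj_op"
proof (rule bounded_linear_intro[where K = 1])
  show "X.conj_op (r *\<^sub>R x) = r *\<^sub>R X.conj_op x" for r x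
    using X.conj_op_scaleC[of "complex_of_real r" x] by (simp add: scaleC_of_real)
  show "norm (X.conj_op x) \<le> norm x * 1" for x
    by (simp add: norm_eq_sqrt_cinner X.cinner_conj_op)
qed (rule X.conj_op_add)

text \<open>Here \<open>\<beta>\<close> preserving the involution enters:
  \<open>U (f \<otimes> 1) = \<kappa> (\<beta> f)\<close> and
  \<open>\<beta> (star f) = star (\<beta> f)\<close>. Density in each variable leads from continuous
  functions to all vectors.\<close>

lemma U_real:
  "ip (tens (X.conj_op \<eta>) 1) (U (tens (X.conj_op \<xi>) 1)) = star (ip (tens \<eta> 1) (U (tens \<xi> 1)))"
proof -
  note dense = X.incl_dense[OF borel]
  note tl = E.bounded_linear_tens_left[of 1]
  have elem: "ip (tens (X.conj_op (X.incl g)) 1) (U (tens (X.conj_op (X.incl h)) 1)) = star (ip (tens (X.incl g) 1) (U (tens (X.incl h) 1)))" for g h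
    using \<beta>_hom unfolding X.incl_star[symmetric] U_\<kappa>_unit star_ip_\<kappa> by (simp add: unital_star_hom_def)
  have elem1: "ip (tens (X.conj_op (X.incl g)) 1) (U (tens (X.conj_op \<xi>) 1)) = star (ip (tens (X.incl g) 1) (U (tens \<xi> 1)))" for g \<xi>
  proof (rule bounded_linear_eqI[OF _ _ dense, of _ "\<lambda>\<xi>. star (ip (tens (X.incl g) 1) (U (tens \<xi> 1)))"])
    show "bounded_linear (\<lambda>\<xi>. ip (tens (X.conj_op (X.incl g)) 1) (U (tens (X.conj_op \<xi>) 1)))"
      by (rule bounded_linear_compose[OF E.bounded_linear_ip_right
            bounded_linear_compose[OF E.bounded_linear_U bounded_linear_compose[OF tl bounded_linear_conj_op]]])
    show "bounded_linear (\<lambda>\<xi>. star (ip (tens (X.incl g) 1) (U (tens \<xi> 1))))"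
      by (rule bounded_linear_compose[OF bounded_linear_star bounded_linear_compose[OF
            E.bounded_linear_ip_right bounded_linear_compose[OF E.bounded_linear_U tl]]])
  qed (use elem in auto)
  show ?thesis
  proof (rule bounded_linear_eqI[OF _ _ dense, of _ "\<lambda>\<eta>. star (ip (tens \<eta> 1) (U (tens \<xi> 1)))"])
    show "bounded_linear (\<lambda>\<eta>. ip (tens (X.conj_op \<eta>) 1) (U (tens (X.conj_op \<xi>) 1)))"
      by (rule bounded_linear_compose[OF E.bounded_linear_ip_left bounded_linear_compose[OF tl bounded_linear_conj_op]])
    show "bounded_linear (\<lambda>\<eta>. star (ip (tens \<eta> 1) (U (tens \<xi> 1))))"
      by (rule bounded_linear_compose[OF bounded_linear_star bounded_linear_compose[OF E.bounded_linear_ip_left tl]])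
  qed (use elem1 in auto)
qed

text \<open>Commutativity of \<open>C(X)\<close> enters: right multiplication by \<open>p\<close> in
  the first leg is the multiplication operator of \<open>p\<close>, while right multiplication by
  \<open>a\<close> is the module action.\<close>

lemma \<kappa>_mult_tX: "\<kappa> (z * tX p a) = act (amplification tens (X.mult_op p) (\<kappa> z)) a"
proof (rule eq_on_tX[of "\<lambda>z. \<kappa> (z * tX p a)"
      "\<lambda>z. act (amplification tens (X.mult_op p) (\<kappa> z)) a"])
  note bm = X.bounded_clinear_mult_op[of p]
  show "bounded_linear (\<lambda>z. \<kappa> (z * tX p a))"
    by (rule bounded_linear_compose[OF bounded_linear_\<kappa> bounded_linear_mult_left])
  show "bounded_linear (\<lambda>z. act (amplification tens (X.mult_op p) (\<kappa> z)) a)"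
    by (rule bounded_linear_compose[OF E.bounded_linear_act
          bounded_linear_compose[OF E.bounded_linear_amplification[OF bm] bounded_linear_\<kappa>]])
  show "\<kappa> (tX q b * tX p a) = act (amplification tens (X.mult_op p) (\<kappa> (tX q b))) a" for q b
    unfolding T.mult \<kappa>_tX E.amplification_tens[OF bm] E.act_tens X.mult_op_incl_commute[of p]
    by (simp only: X.mult_op_incl)
qed

text \<open>On the vectors \<open>\<beta> k (1 \<otimes> a)\<close> the inverse of \<open>U\<close>
  is explicit, with value \<open>k \<otimes> a\<close>, and \<open>\<beta>\<close> is
  multiplicative. The density condition on the action extends the formula to all
  \<open>y\<close>.\<close>

lemma U_mult_inv_\<kappa>: "U (amplification tens (X.mult_op q) (inv U (\<kappa> y))) = \<kappa> (\<beta> q * y)"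
proof (rule bounded_linear_eqI[OF _ _ podles,
      of "\<lambda>y. U (amplification tens (X.mult_op q) (inv U (\<kappa> y)))" "\<lambda>y. \<kappa> (\<beta> q * y)"])
  note bm = X.bounded_clinear_mult_op[of q]
  show "bounded_linear (\<lambda>y. U (amplification tens (X.mult_op q) (inv U (\<kappa> y))))"
    by (rule bounded_linear_compose[OF E.bounded_linear_U bounded_linear_compose[OF
            E.bounded_linear_amplification[OF bm] bounded_linear_compose[OF E.bounded_linear_inv_U bounded_linear_\<kappa>]]])
  show "bounded_linear (\<lambda>y. \<kappa> (\<beta> q * y))"
    by (rule bounded_linear_compose[OF bounded_linear_\<kappa> bounded_linear_mult_right])
  fix y assume "y \<in> {\<beta> f * tX 1 a |f a. True}"
  then obtain k a where y: "y = \<beta> k * tX 1 a" by blast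
  have "\<beta> (q * k) = \<beta> q * \<beta> k"
    using \<beta>_hom by (simp add: unital_star_hom_def)
  moreover have "U (amplification tens (X.mult_op q) (inv U (\<kappa> y))) = U (tens (X.incl (q * k)) a)"
    unfolding y U_\<kappa>[symmetric] E.inv_U E.amplification_tens[OF bm] X.mult_op_incl ..
  ultimately show "U (amplification tens (X.mult_op q) (inv U (\<kappa> y))) = \<kappa> (\<beta> q * y)"
    by (simp only: U_\<kappa> y mult.assoc)
qed

text \<open>The product of \<open>\<beta> q\<close> and \<open>p \<otimes> a\<close> is read in two
  ways: as left multiplication by \<open>\<beta> q\<close>, which is conjugation by
  \<open>U\<close>, and as right multiplication by \<open>p \<otimes> a\<close>.\<close>

lemma U_mult:
  "U (amplification tens (X.mult_op q) (inv U (tens (X.incl p) a))) =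
    amplification tens (X.mult_op p) (U (tens (X.incl q) a))"
proof -
  have U: "U (tens (X.incl q) a) = act (\<kappa> (\<beta> q)) a"
    using E.U_act[of "tens (X.incl q) 1" a] by (simp add: E.act_tens U_\<kappa>_unit)
  have "U (amplification tens (X.mult_op q) (inv U (tens (X.incl p) a))) = \<kappa> (\<beta> q * tX p a)"
    using U_mult_inv_\<kappa>[of q "tX p a"] by (simp add: \<kappa>_tX)
  then show ?thesis
    by (simp only: \<kappa>_mult_tX U E.amplification_act[OF X.bounded_clinear_mult_op])
qed

lemma U_unit: "U (tens (X.incl 1) a) = tens (X.incl 1) a"
  using \<beta>_hom \<kappa>_tX[of 1 a] unfolding U_\<kappa> by (simp add: unital_star_hom_def)

lemma box_one: "box 1 1 = (1 :: ('x \<times> 'x) \<Rightarrow>\<^sub>C complex)"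
  by (rule bcontfun_eqI) auto

lemma leg_pair: "leg_pair act ip tens U act2 ip2 tens2 tn"
  by (intro leg_pair.intro E.unitary_tensor_axioms F.hilbert_tensor_axioms leg_pair_axioms.intro
      tn_add_left tn_add_right tn_scaleC_left tn_scaleC_right cinner_tn tn_dense)

lemma mult_op2_unit: "XX.mult_op f (tn (X.incl 1) (X.incl 1)) = XX.incl f"
  unfolding incl2_box[symmetric] box_one XX.mult_op_incl by simp

sublocale real_leg_pair act ip tens U act2 ip2 tens2 tn X.conj_op
  by (intro real_leg_pair.intro leg_pair real_leg_pair_axioms.intro X.conj_op_add X.conj_op_scaleC
      X.conj_op_conj_op X.cinner_conj_op U_real)

sublocale function_legs act ip tens U act2 ip2 tens2 tn X.incl X.mult_op XX.incl XX.mult_op box 1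
  by (intro function_legs.intro leg_pair function_legs_axioms.intro X.bounded_clinear_mult_op
      X.mult_op_incl_commute U_mult X.incl_dense[OF borel] XX.bounded_clinear_mult_op XX.mult_op_add
      XX.mult_op_scaleR XX.norm_mult_op_le XX.bounded_linear_incl mult_op2_box incl2_box
      box_dense[OF compact] U_unit mult_op2_unit)

section \<open>Equivalent descriptions of membership in the orbital algebra\<close>

abbreviation "orb \<equiv> orbital_algebra \<mu> cls2 tn tens tens2 ip2 U"

lemma orbital_iff_commutes:
  "f \<in> orb \<longleftrightarrow> (\<forall>x. W (M f x) = M f (W x)) \<and> (\<forall>x. op_Z tn tens tens2 U (M f x) = M f (op_Z tn tens tens2 U x))"
proof -
  have "f \<in> orb \<longleftrightarrow> W \<circ> M f \<circ> module_adjoint ip2 W = M f \<and>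
      op_Z tn tens tens2 U \<circ> M f \<circ> module_adjoint ip2 (op_Z tn tens tens2 U) = M f"
    by (auto simp: orbital_algebra_def Let_def)
  then show ?thesis
    unfolding op_W_conjugation_iff_commutes op_Z_conjugation_iff_commutes .
qed

lemma orbital_iff_fixed:
  "f \<in> orb \<longleftrightarrow> W (tens2 (XX.incl f) 1) = tens2 (XX.incl f) 1 \<and>
    op_Z tn tens tens2 U (tens2 (XX.incl f) 1) = tens2 (XX.incl f) 1"
  unfolding orbital_iff_commutes op_W_conjugation_iff_commutes[symmetric] op_Z_conjugation_iff_commutes[symmetric]
    op_W_conjugation_iff_fixed op_Z_conjugation_iff_fixed ..

text \<open>\<open>op_Z_fixed_iff\<close> translates fixing by \<open>Z\<close>; in the converse
  direction \<open>op_W_fixed\<close> supplies the equation for \<open>W\<close>. Both apply because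
  \<open>cinner_tn_incl\<close> identifies \<open>kop f\<close> as the operator of the vector
  \<open>f\<close>.\<close>

lemma orbital_iff_intertwiner: "f \<in> orb \<longleftrightarrow> kop f \<in> intertwiners tens U"
  unfolding orbital_iff_fixed
  using op_Z_fixed_iff[OF bounded_clinear_kernel_op cinner_tn_incl] op_W_fixed[OF _ cinner_tn_incl]
  by blast

lemma norm_incl_one: "norm (X.incl 1) = 1"
  using X.norm_cls_square[OF X.bcontfun_square_integrable, of 1] X.prob_space
  by (simp add: power2_eq_1_iff) (smt (verit) norm_ge_zero)

text \<open>No Hahn--Banach theorem is needed: \<open>\<kappa>(1 \<otimes> a) = 1 \<otimes> a\<close> shows that \<open>1 \<otimes> a \<noteq> 0\<close> for \<open>a \<noteq> 0\<close>,
  and the norm on \<open>C(X) \<otimes> C(G)\<close> is computed from product functionals.\<close>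

lemma functionals_separate:
  assumes all: "\<And>\<phi> :: 'a \<Rightarrow> complex. bounded_clinear \<phi> \<Longrightarrow> \<phi> a = 0"
  shows "a = 0"
proof (rule ccontr)
  assume "a \<noteq> 0"
  define z where "z = tX 1 a"
  have "norm (\<kappa> z) = norm a"
    by (simp add: z_def \<kappa>_tX E.norm_tens norm_incl_one)
  then have "z \<noteq> 0"
    using \<open>a \<noteq> 0\<close> bounded_clinear_zero[of \<kappa>] \<kappa> by (auto simp: extends_to_def)
  define S where "S w = {Re (\<omega> (star y * star w * w * y)) |\<omega> y.
        (\<exists>\<phi> \<psi>. state \<phi> \<and> state \<psi> \<and> product_functional tX \<phi> \<psi> \<omega>) \<and> \<omega> (star y * y) = 1}" for w
  have norm_S: "(norm w)\<^sup>2 = Sup (S w)" for w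
    unfolding S_def by (rule T.norm_min)
  \<comment> \<open>Whether \<open>S w\<close> is empty does not depend on \<open>w\<close>. If it
    were empty, the squared norms of 0 and of 1 would both be the supremum of the empty set.\<close>
  have S_ne: "S w \<noteq> {}" for w
  proof
    assume "S w = {}"
    then have "S 0 = {}" "S 1 = {}"
      unfolding S_def by blast+
    then show False
      using norm_S[of 0] norm_S[of 1] by simp
  qed
  have "S z \<subseteq> {0}"
  proof
    fix r assume "r \<in> S z"
    then obtain \<omega> y \<phi> \<psi> where r: "r = Re (\<omega> (star y * star z * z * y))"
      and st: "state \<phi>" "state \<psi>" and \<omega>: "product_functional tX \<phi> \<psi> \<omega>"
      unfolding S_def by blast
    have \<omega>_tX: "\<omega> (tX f b) = \<phi> f * \<psi> b" and bl\<omega>: "bounded_linear \<omega>" for f b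
      using \<omega> by (auto simp: product_functional_def extends_to_def bounded_clinear_def)
    have \<psi>: "bounded_clinear \<psi>"
      using st by (simp add: state_def)
    \<comment> \<open>The hypothesis is applied to the functional obtained from
      \<open>\<psi>\<close> by multiplying with fixed elements on both sides. Hence product
      functionals vanish on \<open>star z * z\<close> placed between elementary tensors, and by
      density between arbitrary elements.\<close>
    have \<psi>0: "\<psi> (star c * star a * a * b) = 0" for c b
    proof (rule all[of "\<lambda>d. \<psi> (star c * star a * d * b)"])
      have "bounded_clinear (\<lambda>d. star c * star a * d * b)"
      proof (rule bounded_clinearI[where C = "norm (star c * star a) * norm b"])
        show "norm (star c * star a * x * b) \<le> norm (star c * star a) * norm b * norm x" for x
          using mult_right_mono[OF norm_mult_ineq[of "star c * star a" x] norm_ge_zero[of b]]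
            norm_mult_ineq[of "star c * star a * x" b] by (simp add: ac_simps)
      qed (simp_all add: distrib_left distrib_right scaleC_mult_left scaleC_mult_right)
      then show "bounded_clinear (\<lambda>d. \<psi> (star c * star a * d * b))"
        by (rule bounded_clinear_compose[OF \<psi>])
    qed
    have z_elem: "star (tX g c) * star z * z * tX f b = tX (star g * f) (star c * star a * a * b)" for g c f b
    proof -
      have "star (1 :: 'x \<Rightarrow>\<^sub>C complex) = 1"
        by (rule star_one)
      then show ?thesis
        by (simp add: z_def T.star T.mult mult.assoc)
    qed
    have z1: "\<omega> (star (tX g c) * star z * z * x) = 0" for g c x
    proof (rule eq_on_tX[of "\<lambda>x. \<omega> (star (tX g c) * star z * z * x)" "\<lambda>_. 0"])
      show "bounded_linear (\<lambda>x. \<omega> (star (tX g c) * star z * z * x))"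
        by (rule bounded_linear_compose[OF bl\<omega> bounded_linear_mult_right])
      show "\<omega> (star (tX g c) * star z * z * tX f b) = 0" for f b
        by (simp only: z_elem \<omega>_tX \<psi>0 mult_zero_right)
    qed (rule bounded_linear_zero)
    have "\<omega> (star y * (star z * z * y)) = 0"
    proof (rule eq_on_tX[of "\<lambda>y'. \<omega> (star y' * (star z * z * y))" "\<lambda>_. 0"])
      show "bounded_linear (\<lambda>y'. \<omega> (star y' * (star z * z * y)))"
        by (rule bounded_linear_compose[OF bl\<omega> bounded_linear_compose[OF bounded_linear_mult_left bounded_linear_star]])
      show "\<omega> (star (tX g c) * (star z * z * y)) = 0" for g c
        using z1[of g c y] by (simp only: mult.assoc)
    qed (rule bounded_linear_zero)
    then show "r \<in> {0}"
      by (simp add: r mult.assoc)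
  qed
  then have "S z = {0}"
    using S_ne[of z] by blast
  then show False
    using norm_S[of z] \<open>z \<noteq> 0\<close> by simp
qed

end

section \<open>An approximate unit in the orbital algebra\<close>

lemma (in cont_L2) mult_op_times: "mult_op (f * g) \<xi> = mult_op f (mult_op g \<xi>)"
  unfolding multiplication_op_def[of M cls g] mult_op_cls[OF bcontfun_mult_square_integrable[OF rep_square_integrable]]
  by (simp add: multiplication_op_def times_bcontfun.rep_eq mult.assoc)

context action_L2
begin

lemma M_times: "M (f * g) x = M f (M g x)"
proof -
  have "XX.mult_op (f * g) = (\<lambda>\<xi>. XX.mult_op f (XX.mult_op g \<xi>))"
    by (rule ext) (rule XX.mult_op_times)
  then show ?thesis
    by (simp only: F.amplification_compose[OF XX.bounded_clinear_mult_op XX.bounded_clinear_mult_op])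
qed

lemma M_add: "M (f + g) x = M f x + M g x"
  by (rule linear_add[OF bounded_linear.linear[OF bounded_linear_M_function]])

lemma M_scaleR: "M (r *\<^sub>R f) x = r *\<^sub>R M f x"
  by (rule linear_cmul[OF bounded_linear.linear[OF bounded_linear_M_function]])

lemma M_one: "M 1 x = x"
proof -
  have "XX.mult_op 1 = (\<lambda>\<xi>. \<xi>)"
    by (rule ext) (simp add: multiplication_op_def XX.cls_rep)
  then show ?thesis
    by (simp only: F.amplification_ident)
qed

lemma bounded_linear_W: "bounded_linear W"
  by (rule unitary_tensor.bounded_linear_U[OF unitary_op_W])

lemma bounded_linear_Z: "bounded_linear (op_Z tn tens tens2 U)"
  using unitary_tensor.bounded_linear_U[OF leg_pair.unitary_op_W[OF leg_pair_swap]] by (simp only: op_W_swap)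

lemma orb_times: "f \<in> orb \<Longrightarrow> g \<in> orb \<Longrightarrow> f * g \<in> orb"
  by (simp add: orbital_iff_commutes M_times)

lemma orb_one: "1 \<in> orb"
  by (simp add: orbital_iff_commutes M_one)

lemma orb_add: "f \<in> orb \<Longrightarrow> g \<in> orb \<Longrightarrow> f + g \<in> orb"
  using bounded_linear_W bounded_linear_Z
  by (simp add: orbital_iff_commutes M_add linear_add[OF bounded_linear.linear])

lemma orb_scaleR: "f \<in> orb \<Longrightarrow> r *\<^sub>R f \<in> orb"
  using bounded_linear_W bounded_linear_Z
  by (simp add: orbital_iff_commutes M_scaleR linear_cmul[OF bounded_linear.linear])

lemma orb_power: "f \<in> orb \<Longrightarrow> f ^ n \<in> orb"
  by (induction n) (simp_all add: orb_one orb_times)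

text \<open>Since \<open>M\<close> is multiplicative, \<open>M g\<close> is the inverse of
  \<open>M f\<close>, and whatever commutes with an invertible operator commutes with its inverse.
  This admits reciprocals of normalising functions.\<close>

lemma orb_inverse:
  assumes f: "f \<in> orb" and gf: "g * f = 1"
  shows "g \<in> orb"
proof -
  have fg: "f * g = 1"
    using gf by (metis bcontfun_eqI mult.commute times_bcontfun.rep_eq)
  have "V (M g x) = M g (V x)" if "\<And>x. V (M f x) = M f (V x)" for V x
  proof -
    have "V (M g x) = M g (M f (V (M g x)))"
      by (simp only: M_times[symmetric] gf M_one)
    also have "\<dots> = M g (V x)"
      by (simp only: that[symmetric] M_times[symmetric] fg M_one)
    finally show ?thesis .
  qed
  then show ?thesis
    using f by (simp add: orbital_iff_commutes)
qed

text \<open>For a kernel that depends on the first variable only, the second leg carries the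
  constant function, which \<open>U\<close> fixes; the first leg is fixed by assumption.\<close>

lemma orb_box_invariant:
  assumes inv: "U (tens (X.incl p) 1) = tens (X.incl p) 1"
  shows "box p 1 \<in> orb"
proof -
  have 23: "L23 (tens2 (tn (X.incl p) (X.incl 1)) 1) = tens2 (tn (X.incl p) (X.incl 1)) 1"
    unfolding P1_tens[symmetric] leg23_P1 U_unit ..
  have 13: "L13 (tens2 (tn (X.incl p) (X.incl 1)) 1) = tens2 (tn (X.incl p) (X.incl 1)) 1"
    unfolding P2_tens[symmetric] leg13_P2 inv ..
  show ?thesis
    unfolding orbital_iff_fixed incl2_box by (simp add: op_W_def op_Z_def 23 13)
qed

section \<open>Continuous representatives of the images of kernel operators\<close>

definition kernel_fun :: "(('x \<times> 'x) \<Rightarrow>\<^sub>C complex) \<Rightarrow> 'h \<Rightarrow> 'x \<Rightarrow>\<^sub>C complex"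
  where "kernel_fun f \<xi> = Bcontfun (\<lambda>x. cinner (kernel_vector f x) \<xi>)"

lemma kernel_fun_apply: "apply_bcontfun (kernel_fun f \<xi>) = (\<lambda>x. cinner (kernel_vector f x) \<xi>)"
  unfolding kernel_fun_def
  by (rule apply_Bcontfun_compact[OF compact continuous_cinner_vector[OF continuous_kernel_vector]])

lemma kernel_op_fun: "kop f \<xi> = X.incl (kernel_fun f \<xi>)"
  by (simp add: kernel_op_eq kernel_fun_apply)

lemma kernel_fun_incl: "apply_bcontfun (kernel_fun f (X.incl \<eta>)) x = (\<integral>y. f (x, y) * \<eta> y \<partial>\<mu>)"
  unfolding kernel_fun_apply kernel_vector_def X.cinner_cls[OF X.bcontfun_square_integrable X.bcontfun_square_integrable]
  by (simp add: star_bcontfun.rep_eq)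

text \<open>The function represents \<open>\<rho>(f)\<close> applied to the constant function, and
  an intertwiner sends vectors fixed by \<open>U\<close> to vectors fixed by
  \<open>U\<close>.\<close>

lemma kernel_fun_incl_one_invariant:
  assumes f: "f \<in> orb"
  shows "U (tens (X.incl (kernel_fun f (X.incl 1))) 1) = tens (X.incl (kernel_fun f (X.incl 1))) 1"
proof -
  have k: "kop f \<in> intertwiners tens U"
    using f by (simp add: orbital_iff_intertwiner)
  show ?thesis
    using E.intertwinersD(2)[OF k, of "tens (X.incl 1) 1"]
    unfolding E.amplification_tens[OF bounded_clinear_kernel_op] U_unit kernel_op_fun[symmetric] .
qed

end

text \<open>By compactness every ball of radius \<open>r\<close> contains one of finitely many balls
  of radius \<open>r / 2\<close>, and these have positive measure because the support is
  full.\<close>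

lemma ball_measure_lower_bound:
  fixes \<mu> :: "'x::metric_space measure"
  assumes compact: "compact (UNIV :: 'x set)" and faithful: "faithful_borel_prob \<mu>" and r: "r > 0"
  shows "\<exists>c>0. \<forall>x. c \<le> measure \<mu> (ball x r)"
proof -
  interpret prob_space \<mu>
    using faithful by (simp add: faithful_borel_prob_def)
  have sets: "ball x s \<in> sets \<mu>" for x s
    using faithful by (simp add: faithful_borel_prob_def)
  have pos: "measure \<mu> (ball x s) > 0" if "s > 0" for x s
  proof -
    have "emeasure \<mu> (ball x s) > 0"
      using faithful that centre_in_ball unfolding faithful_borel_prob_def by (metis emptyE open_ball)
    then show ?thesis
      by (simp add: emeasure_eq_measure)
  qed
  obtain K :: "'x set" where K: "finite K" "UNIV \<subseteq> (\<Union>x\<in>K. ball x (r / 2))"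
    using compact r unfolding compact_eq_totally_bounded by (meson half_gt_zero)
  then have "K \<noteq> {}" by auto
  define c where "c = Min ((\<lambda>x. measure \<mu> (ball x (r / 2))) ` K)"
  have "c > 0"
    using K(1) \<open>K \<noteq> {}\<close> pos r by (simp add: c_def)
  moreover have "c \<le> measure \<mu> (ball x r)" for x
  proof -
    obtain z where z: "z \<in> K" "x \<in> ball z (r / 2)"
      using K(2) by blast
    have "c \<le> measure \<mu> (ball z (r / 2))"
      using K(1) z(1) by (simp add: c_def)
    also have "\<dots> \<le> measure \<mu> (ball x r)"
    proof (rule finite_measure_mono[OF _ sets])
      show "ball z (r / 2) \<subseteq> ball x r"
      proof
        fix y assume "y \<in> ball z (r / 2)"
        then have "dist x y < r / 2 + r / 2"
          using z(2) dist_triangle[of x y z] by (simp add: dist_commute)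
        then show "y \<in> ball x r" by simp
      qed
    qed
    finally show ?thesis .
  qed
  ultimately show ?thesis by blast
qed

context action_L2
begin

definition dist_fun :: "('x \<times> 'x) \<Rightarrow>\<^sub>C complex"
  where "dist_fun = Bcontfun (\<lambda>(x, y). complex_of_real (dist x y))"

lemma dist_fun_apply: "apply_bcontfun dist_fun = (\<lambda>(x, y). complex_of_real (dist x y))"
  unfolding dist_fun_def
proof (rule apply_Bcontfun_compact)
  show "compact (UNIV :: ('x \<times> 'x) set)"
    using compact_Times[OF compact compact] by simp
  show "continuous_on UNIV (\<lambda>(x :: 'x, y). complex_of_real (dist x y))"
    unfolding case_prod_unfold by (intro continuous_intros)
qed

lemma dist_fun_orb:
  assumes "isometric cls2 tn tens tens2 U"
  shows "dist_fun \<in> orb"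
  using assms by (simp add: isometric_def orbital_iff_fixed Let_def dist_fun_apply)

text \<open>The powers of \<open>1 - d/D\<close> concentrate on the diagonal. Since the balls of a given radius need not
  have equal measure, they are normalised in the first variable; the normalising function is invariant,
  so this does not lead out of the orbital algebra.\<close>

lemma approximate_unit:
  assumes faithful: "faithful_borel_prob \<mu>" and iso: "isometric cls2 tn tens tens2 U"
  shows "\<exists>F. (\<forall>n. F n \<in> orb) \<and> (\<forall>\<eta>. (\<lambda>n. kop (F n) (X.incl \<eta>)) \<longlonglongrightarrow> X.incl \<eta>)"
proof -
  \<comment> \<open>The summand 1 makes \<open>dist x y < D\<close> strict, so that \<open>t\<close>
    and all its integrals \<open>m n x\<close> are strictly positive; it also gives
    \<open>D > 0\<close> on a one-point space.\<close>
  define D where "D = norm dist_fun + 1"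
  have dist_D: "dist x y < D" for x y :: 'x
    using norm_bounded[of dist_fun "(x, y)"] by (simp add: dist_fun_apply D_def)
  have D: "D > 0"
    unfolding D_def by (rule add_nonneg_pos) auto
  define t where "t x y = 1 - dist x y / D" for x y :: 'x
  have t_pos: "0 < t x y" and t_le: "t x y \<le> 1" for x y
    using dist_D[of x y] D by (auto simp: t_def field_simps)
  define k where "k n = (1 + (- (1 / D)) *\<^sub>R dist_fun) ^ n" for n
  have "apply_bcontfun (1 + (- (1 / D)) *\<^sub>R dist_fun) (x, y) = complex_of_real (t x y)" for x y
    by (simp add: t_def dist_fun_apply scaleR_conv_of_real[where 'a = complex])
  then have k_apply: "apply_bcontfun (k n) (x, y) = complex_of_real (t x y ^ n)" for n x y
    unfolding k_def by (induction n) (simp_all add: times_bcontfun.rep_eq)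
  have k_orb: "k n \<in> orb" for n
    unfolding k_def by (intro orb_power orb_add orb_one orb_scaleR dist_fun_orb[OF iso])
  have t_meas: "(\<lambda>y. t x y ^ n) \<in> borel_measurable \<mu>" for x n
  proof -
    have "(\<lambda>y. Re (apply_bcontfun (slice (k n) x) y)) \<in> borel_measurable \<mu>"
      using X.borel_measurable_bcontfun[of "slice (k n) x"] by measurable
    then show ?thesis
      by (simp add: k_apply)
  qed
  have t_int: "integrable \<mu> (\<lambda>y. t x y ^ n)" for x n
    by (rule X.integrable_const_bound[where B = 1, OF AE_I2 t_meas])
      (use t_pos[of x] t_le[of x] in \<open>simp add: power_le_one less_imp_le\<close>)
  define m where "m n x = (\<integral>y. t x y ^ n \<partial>\<mu>)" for n x
  have m_pos: "m n x > 0" for n x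
  proof -
    have "m n x \<noteq> 0"
    proof
      assume "m n x = 0"
      then have "AE y in \<mu>. t x y ^ n = 0"
        using integral_nonneg_eq_0_iff_AE[OF t_int[of x n]] t_pos by (simp add: m_def less_imp_le)
      then have "AE y in \<mu>. False"
        using t_pos by (simp add: less_imp_neq[symmetric] order_less_imp_not_eq2)
      then show False
        using X.AE_False by simp
    qed
    moreover have "m n x \<ge> 0"
      unfolding m_def using t_pos by (intro Bochner_Integration.integral_nonneg) (simp add: less_imp_le)
    ultimately show ?thesis by simp
  qed
  \<comment> \<open>The function \<open>m n\<close> as an element of \<open>C(X)\<close>, obtained
    by applying the kernel operator of \<open>k n\<close> to 1. It is invariant because
    \<open>k n\<close> lies in the orbital algebra; its reciprocal \<open>R n\<close> is then
    reached through \<open>orb_inverse\<close>.\<close>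
  define N where "N n = kernel_fun (k n) (X.incl 1)" for n
  have N_apply: "apply_bcontfun (N n) x = complex_of_real (m n x)" for n x
    by (simp only: N_def kernel_fun_incl k_apply m_def bcontfun_one_apply mult_1_right integral_complex_of_real)
  define R where "R n = Bcontfun (\<lambda>x. inverse (apply_bcontfun (N n) x))" for n
  have R_apply: "apply_bcontfun (R n) x = complex_of_real (inverse (m n x))" for n x
  proof -
    have "continuous_on UNIV (\<lambda>x. inverse (apply_bcontfun (N n) x))"
      using m_pos by (intro continuous_on_inverse continuous_on_apply_bcontfun) (auto simp: N_apply less_imp_neq[symmetric])
    then show ?thesis
      by (simp add: R_def apply_Bcontfun_compact[OF compact] N_apply)
  qed
  have "box (R n) 1 \<in> orb" for n
  proof (rule orb_inverse)
    show "box (N n) 1 \<in> orb"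
      unfolding N_def by (rule orb_box_invariant[OF kernel_fun_incl_one_invariant[OF k_orb]])
    have "apply_bcontfun (box (R n) 1 * box (N n) 1) (x, y) = 1" for x y
      using m_pos[of n x] by (simp add: times_bcontfun.rep_eq R_apply N_apply flip: of_real_mult)
    then show "box (R n) 1 * box (N n) 1 = 1"
      by (intro bcontfun_eqI) auto
  qed
  then have F_orb: "box (R n) 1 * k n \<in> orb" for n
    by (intro orb_times k_orb)
  have "(\<lambda>n. kop (box (R n) 1 * k n) (X.incl \<eta>)) \<longlonglongrightarrow> X.incl \<eta>" for \<eta>
  proof (rule tendstoI)
    fix e :: real assume e: "e > 0"
    have "uniformly_continuous_on UNIV (apply_bcontfun \<eta>)"
      by (rule compact_uniformly_continuous[OF continuous_on_apply_bcontfun compact])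
    then obtain \<delta> where \<delta>: "\<delta> > 0" "\<And>x y. dist y x < \<delta> \<Longrightarrow> dist (\<eta> y) (\<eta> x) < e / 3"
      unfolding uniformly_continuous_on_def using e by (metis UNIV_I divide_pos_pos zero_less_numeral)
    define s where "s = min \<delta> D"
    have s: "0 < s" "s \<le> D" "s \<le> \<delta>"
      using \<delta>(1) D by (auto simp: s_def)
    obtain c where c: "c > 0" "\<And>x. c \<le> measure \<mu> (ball x (s / 2))"
      using ball_measure_lower_bound[OF compact faithful, of "s / 2"] s by auto
    \<comment> \<open>At distance at least \<open>s\<close> from \<open>x\<close> one has
      \<open>t x y \<le> p\<close>, on the ball of radius \<open>s / 2\<close> one has
      \<open>t x y \<ge> q\<close>. As \<open>p < q\<close>, the weight outside is a fraction of
      order \<open>(p / q) ^ n\<close> of the total \<open>m n x\<close>. The bound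
      \<open>s \<le> D\<close> ensures \<open>p \<ge> 0\<close>.\<close>
    define p where "p = 1 - s / D"
    define q where "q = 1 - s / (2 * D)"
    have pq: "0 \<le> p" "p < q" "0 < q"
      using s D by (auto simp: p_def q_def field_simps)
    have m_ge: "c * q ^ n \<le> m n x" for n x
    proof -
      have ball: "ball x (s / 2) \<in> sets \<mu>"
        using faithful by (simp add: faithful_borel_prob_def)
      have "c * q ^ n \<le> measure \<mu> (ball x (s / 2)) * q ^ n"
        using c pq by (intro mult_right_mono) auto
      also have "\<dots> = (\<integral>y. indicator (ball x (s / 2)) y * q ^ n \<partial>\<mu>)"
        using ball by simp
      also have "\<dots> \<le> m n x"
        unfolding m_def
      proof (rule integral_mono[OF _ t_int])
        show "integrable \<mu> (\<lambda>y. indicator (ball x (s / 2)) y * q ^ n)"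
          by (intro integrable_mult_left integrable_real_indicator[OF ball]) (simp add: X.emeasure_eq_measure)
        fix y
        show "indicator (ball x (s / 2)) y * q ^ n \<le> t x y ^ n"
        proof (cases "y \<in> ball x (s / 2)")
          case True
          then have "q \<le> t x y"
            using D by (simp add: q_def t_def field_simps)
          then show ?thesis
            using True pq by (simp add: power_mono)
        next
          case False
          then show ?thesis
            using t_pos[of x y] by (simp add: less_imp_le)
        qed
      qed
      finally show ?thesis .
    qed
    define B where "B = norm \<eta>"
    have "0 \<le> p / q" "p / q < 1"
      using pq by simp_all
    then have "(\<lambda>n. (p / q) ^ n) \<longlonglongrightarrow> 0"
      by (rule LIMSEQ_realpow_zero)
    then have "(\<lambda>n. 2 * B / c * (p / q) ^ n) \<longlonglongrightarrow> 2 * B / c * 0"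
      by (rule tendsto_mult_left)
    then have "\<forall>\<^sub>F n in sequentially. 2 * B / c * (p / q) ^ n < e / 3"
      using e by (intro order_tendstoD) auto
    then show "\<forall>\<^sub>F n in sequentially. dist (kop (box (R n) 1 * k n) (X.incl \<eta>)) (X.incl \<eta>) < e"
    proof eventually_elim
      case (elim n)
      let ?g = "kernel_fun (box (R n) 1 * k n) (X.incl \<eta>)"
      \<comment> \<open>The estimate is uniform in \<open>x\<close>: one third of \<open>e\<close>
        comes from the oscillation of \<open>\<eta>\<close> near \<open>x\<close>, one third from
        the tail, and the remaining third makes the final inequality strict.\<close>
      have "norm (?g - \<eta>) \<le> e / 3 + e / 3"
      proof (rule norm_bound)
        fix x
        have mx: "m n x > 0" by (rule m_pos)
        have \<eta>_int: "integrable \<mu> (\<lambda>y. complex_of_real (t x y ^ n) * \<eta> y)"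
          using X.square_integrable_integrable[OF X.bcontfun_square_integrable[of "slice (k n) x * \<eta>"]]
          by (simp add: times_bcontfun.rep_eq[abs_def] k_apply)
        have const_int: "integrable \<mu> (\<lambda>y. complex_of_real (t x y ^ n) * \<eta> x)"
          by (intro integrable_mult_left integrable_of_real t_int)
        have "?g x = (\<integral>y. complex_of_real (inverse (m n x)) * (complex_of_real (t x y ^ n) * \<eta> y) \<partial>\<mu>)"
          by (simp add: kernel_fun_incl times_bcontfun.rep_eq R_apply k_apply mult.assoc)
        also have "\<dots> = complex_of_real (inverse (m n x)) * (\<integral>y. complex_of_real (t x y ^ n) * \<eta> y \<partial>\<mu>)"
          by (rule integral_mult_right_zero)
        finally have g: "?g x = complex_of_real (inverse (m n x)) * (\<integral>y. complex_of_real (t x y ^ n) * \<eta> y \<partial>\<mu>)" .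
        \<comment> \<open>By the normalisation \<open>\<eta> x\<close> is the average of a constant
          against the same weights, so the difference is an average of
          \<open>\<eta> y - \<eta> x\<close>.\<close>
        have "\<eta> x = complex_of_real (inverse (m n x)) * (\<integral>y. complex_of_real (t x y ^ n) * \<eta> x \<partial>\<mu>)"
          using mx by (simp add: integral_mult_left_zero integral_of_real m_def[symmetric] flip: of_real_power)
        then have "?g x - \<eta> x = complex_of_real (inverse (m n x)) *
            ((\<integral>y. complex_of_real (t x y ^ n) * \<eta> y \<partial>\<mu>) - (\<integral>y. complex_of_real (t x y ^ n) * \<eta> x \<partial>\<mu>))"
          by (simp add: g right_diff_distrib)
        also have "\<dots> = complex_of_real (inverse (m n x)) * (\<integral>y. complex_of_real (t x y ^ n) * (\<eta> y - \<eta> x) \<partial>\<mu>)"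
          by (simp only: right_diff_distrib Bochner_Integration.integral_diff[OF \<eta>_int const_int])
        finally have diff: "cmod (?g x - \<eta> x) = inverse (m n x) * cmod (\<integral>y. complex_of_real (t x y ^ n) * (\<eta> y - \<eta> x) \<partial>\<mu>)"
          using mx by (simp add: norm_mult norm_inverse)
        have "cmod (\<integral>y. complex_of_real (t x y ^ n) * (\<eta> y - \<eta> x) \<partial>\<mu>) \<le> (\<integral>y. e / 3 * t x y ^ n + 2 * B * p ^ n \<partial>\<mu>)"
        proof (rule order_trans[OF integral_norm_bound integral_mono[OF integrable_norm]])
          show "integrable \<mu> (\<lambda>y. complex_of_real (t x y ^ n) * (\<eta> y - \<eta> x))"
            using Bochner_Integration.integrable_diff[OF \<eta>_int const_int] by (simp add: right_diff_distrib)
          show "integrable \<mu> (\<lambda>y. e / 3 * t x y ^ n + 2 * B * p ^ n)"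
            by (intro Bochner_Integration.integrable_add integrable_mult_right t_int X.integrable_const)
          fix y
          have tn: "0 \<le> t x y ^ n" using t_pos[of x y] by (simp add: less_imp_le)
          have B0: "0 \<le> B" by (simp add: B_def)
          have norm_eq: "norm (complex_of_real (t x y ^ n) * (\<eta> y - \<eta> x)) = t x y ^ n * cmod (\<eta> y - \<eta> x)"
            by (simp only: norm_mult norm_of_real abs_of_nonneg[OF tn])
          show "norm (complex_of_real (t x y ^ n) * (\<eta> y - \<eta> x)) \<le> e / 3 * t x y ^ n + 2 * B * p ^ n"
          proof (cases "dist y x < s")
            case True
            then have "cmod (\<eta> y - \<eta> x) \<le> e / 3"
              using \<delta>(2)[of y x] s by (simp add: dist_norm)
            then have "t x y ^ n * cmod (\<eta> y - \<eta> x) \<le> e / 3 * t x y ^ n"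
              using mult_left_mono[OF _ tn, of "cmod (\<eta> y - \<eta> x)" "e / 3"] by (simp add: mult.commute)
            moreover have "0 \<le> 2 * B * p ^ n"
              using B0 pq by simp
            ultimately show ?thesis
              unfolding norm_eq by linarith
          next
            case False
            then have "t x y \<le> p"
              using D by (simp add: t_def p_def dist_commute divide_right_mono)
            then have "t x y ^ n \<le> p ^ n"
              using t_pos[of x y] by (intro power_mono) auto
            moreover have "cmod (\<eta> y - \<eta> x) \<le> 2 * B"
              using norm_triangle_ineq4[of "\<eta> y" "\<eta> x"] norm_bounded[of \<eta> x] norm_bounded[of \<eta> y]
              by (simp add: B_def)
            ultimately have "t x y ^ n * cmod (\<eta> y - \<eta> x) \<le> p ^ n * (2 * B)"
              using tn pq by (intro mult_mono) auto
            moreover have "0 \<le> e / 3 * t x y ^ n"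
              using e tn by simp
            ultimately show ?thesis
              unfolding norm_eq by (simp add: mult.commute)
          qed
        qed
        also have "\<dots> = e / 3 * m n x + 2 * B * p ^ n"
          using X.prob_space by (simp add: m_def t_int)
        finally have "cmod (?g x - \<eta> x) \<le> inverse (m n x) * (e / 3 * m n x + 2 * B * p ^ n)"
          unfolding diff using mx by (intro mult_left_mono) auto
        also have "\<dots> = e / 3 + 2 * B * p ^ n / m n x"
          using mx by (simp add: field_simps)
        also have "2 * B * p ^ n / m n x \<le> 2 * B * p ^ n / (c * q ^ n)"
          using m_ge[of n x] c(1) pq mx by (intro divide_left_mono) (auto simp: B_def)
        also have "\<dots> = 2 * B / c * (p / q) ^ n"
          by (simp add: power_divide)
        finally show "norm (apply_bcontfun (?g - \<eta>) x) \<le> e / 3 + e / 3"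
          using elim by simp
      qed
      then have "norm (X.incl (?g - \<eta>)) < e"
        using X.norm_incl_le[of "?g - \<eta>"] e by linarith
      moreover have "X.incl (?g - \<eta>) = X.incl ?g - X.incl \<eta>"
        by (rule bounded_clinear_diff[OF X.bounded_clinear_incl])
      ultimately show ?case
        by (simp only: dist_norm kernel_op_fun)
    qed
  qed
  with F_orb show ?thesis
    by (intro exI[of _ "\<lambda>n. box (R n) 1 * k n"]) blast
qed

end

section \<open>Approximation of the identity by \<open>b q b*\<close>\<close>

lemma cadjoint_cadjoint: "bounded_clinear T \<Longrightarrow> cadjoint (cadjoint T) = T"
  by (rule cadjoint_eqI[OF bounded_clinear_cadjoint]) (simp_all add: cinner_cadjoint_right)

lemma cadjoint_contraction:
  assumes b: "bounded_clinear b" and contr: "\<And>\<xi>. norm (b \<xi>) \<le> norm \<xi>"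
  shows "norm (cadjoint b \<xi>) \<le> norm \<xi>"
proof (rule norm_le_if_cinner_le)
  fix z
  have "cmod (cinner z (cadjoint b \<xi>)) \<le> norm (b z) * norm \<xi>"
    unfolding cinner_cadjoint_right[OF b] by (rule cauchy_schwarz)
  also have "\<dots> \<le> norm z * norm \<xi>"
    by (intro mult_right_mono contr) simp
  finally show "cmod (cinner z (cadjoint b \<xi>)) \<le> norm \<xi> * norm z"
    by (simp add: mult.commute)
qed simp

text \<open>In the expanded square the cross term subtracts \<open>(norm (b \<zeta>))^2\<close>
  twice, and contractivity of the adjoint gives back at most one of the two.\<close>

lemma landweber_step:
  assumes b: "bounded_clinear b" and contr: "\<And>\<xi>. norm (b \<xi>) \<le> norm \<xi>"
  shows "(norm (\<zeta> - cadjoint b (b \<zeta>)))\<^sup>2 \<le> (norm \<zeta>)\<^sup>2 - (norm (b \<zeta>))\<^sup>2"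
proof -
  have "cinner \<zeta> (cadjoint b (b \<zeta>)) = complex_of_real ((norm (b \<zeta>))\<^sup>2)"
    by (simp only: cinner_cadjoint_right[OF b] cinner_self)
  then have "Re (cinner \<zeta> (cadjoint b (b \<zeta>))) = (norm (b \<zeta>))\<^sup>2"
    by (simp only: Re_complex_of_real)
  moreover have "(norm (cadjoint b (b \<zeta>)))\<^sup>2 \<le> (norm (b \<zeta>))\<^sup>2"
    by (intro power_mono cadjoint_contraction[OF b contr]) simp
  ultimately show ?thesis
    by (simp add: norm_diff_square)
qed

text \<open>The squared norms of the iterates decrease and are bounded below, so their decrements
  tend to zero; by the preceding estimate these dominate \<open>(norm (b (y m)))^2\<close>.\<close>

lemma landweber_tendsto_zero:
  assumes b: "bounded_clinear b" and contr: "\<And>\<xi>. norm (b \<xi>) \<le> norm \<xi>"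
  shows "(\<lambda>m. b (((\<lambda>\<zeta>. \<zeta> - cadjoint b (b \<zeta>)) ^^ m) \<zeta>)) \<longlonglongrightarrow> 0"
proof -
  define y where "y m = ((\<lambda>\<zeta>. \<zeta> - cadjoint b (b \<zeta>)) ^^ m) \<zeta>" for m
  have step: "(norm (b (y m)))\<^sup>2 \<le> (norm (y m))\<^sup>2 - (norm (y (Suc m)))\<^sup>2" for m
    using landweber_step[OF b contr, of "y m"] by (simp add: y_def)
  then have "(norm (y (Suc m)))\<^sup>2 \<le> (norm (y m))\<^sup>2" for m
    using zero_le_power2[of "norm (b (y m))"] by (smt (verit))
  then have "decseq (\<lambda>m. (norm (y m))\<^sup>2)"
    by (rule decseq_SucI)
  then obtain L where "(\<lambda>m. (norm (y m))\<^sup>2) \<longlonglongrightarrow> L"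
    using decseq_convergent[of "\<lambda>m. (norm (y m))\<^sup>2" 0] by auto
  then have "(\<lambda>m. (norm (y m))\<^sup>2 - (norm (y (Suc m)))\<^sup>2) \<longlonglongrightarrow> L - L"
    by (intro tendsto_diff LIMSEQ_Suc)
  then have "(\<lambda>m. (norm (b (y m)))\<^sup>2) \<longlonglongrightarrow> 0"
    by (intro tendsto_sandwich[of "\<lambda>_. 0" "\<lambda>m. (norm (b (y m)))\<^sup>2" sequentially
          "\<lambda>m. (norm (y m))\<^sup>2 - (norm (y (Suc m)))\<^sup>2" 0])
      (auto simp: step)
  then have "(\<lambda>m. sqrt ((norm (b (y m)))\<^sup>2)) \<longlonglongrightarrow> sqrt 0"
    by (rule tendsto_real_sqrt)
  then have "(\<lambda>m. norm (b (y m))) \<longlonglongrightarrow> 0"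
    by simp
  then show ?thesis
    unfolding y_def by (rule tendsto_norm_zero_cancel)
qed

text \<open>Partial sum of the Neumann series for the inverse of \<open>b* b\<close>, in powers of
  \<open>1 - b* b\<close>. It is the polynomial \<open>q\<close> for which \<open>1 - b q b*\<close>
  is the \<open>m\<close>-th power of \<open>1 - b b*\<close>.\<close>

definition neumann_sum :: "('h::chilbert_space \<Rightarrow> 'h) \<Rightarrow> nat \<Rightarrow> 'h \<Rightarrow> 'h"
  where "neumann_sum b m \<zeta> = (\<Sum>j<m. ((\<lambda>\<zeta>. \<zeta> - cadjoint b (b \<zeta>)) ^^ j) \<zeta>)"

text \<open>With \<open>h = 1 - b b*\<close> and \<open>g = 1 - b* b\<close>, the relation
  \<open>b* h^j = g^j b*\<close> moves powers past the adjoint, and the telescoping sum takes the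
  form \<open>b q b*\<close>.\<close>

lemma residual_eq:
  assumes b: "bounded_clinear b"
  shows "((\<lambda>\<xi>. \<xi> - b (cadjoint b \<xi>)) ^^ m) \<xi> = \<xi> - b (neumann_sum b m (cadjoint b \<xi>))"
proof -
  let ?g = "\<lambda>\<zeta>. \<zeta> - cadjoint b (b \<zeta>)" and ?h = "\<lambda>\<xi>. \<xi> - b (cadjoint b \<xi>)"
  have adj: "cadjoint b ((?h ^^ m) \<xi>) = (?g ^^ m) (cadjoint b \<xi>)" for m
    by (induction m) (simp_all add: bounded_clinear_diff[OF bounded_clinear_cadjoint[OF b]])
  show ?thesis
  proof (induction m)
    case 0
    show ?case by (simp add: neumann_sum_def bounded_clinear_zero[OF b])
  next
    case (Suc m)
    have "(?h ^^ Suc m) \<xi> = (?h ^^ m) \<xi> - b (cadjoint b ((?h ^^ m) \<xi>))"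
      by simp
    also have "\<dots> = (?h ^^ m) \<xi> - b ((?g ^^ m) (cadjoint b \<xi>))"
      by (simp only: adj)
    also have "\<dots> = \<xi> - b (neumann_sum b m (cadjoint b \<xi>)) - b ((?g ^^ m) (cadjoint b \<xi>))"
      by (simp only: Suc)
    also have "\<dots> = \<xi> - b (neumann_sum b (Suc m) (cadjoint b \<xi>))"
      by (simp add: neumann_sum_def bounded_clinear_add[OF b])
    finally show ?case .
  qed
qed

text \<open>Each factor is bounded by \<open>landweber_step\<close> for the adjoint of
  \<open>b\<close>, which is again a contraction.\<close>

lemma residual_contraction:
  assumes b: "bounded_clinear b" and contr: "\<And>\<xi>. norm (b \<xi>) \<le> norm \<xi>"
  shows "norm (((\<lambda>\<xi>. \<xi> - b (cadjoint b \<xi>)) ^^ m) \<xi>) \<le> norm \<xi>"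
proof (induction m)
  case (Suc m)
  let ?\<xi> = "((\<lambda>\<xi>. \<xi> - b (cadjoint b \<xi>)) ^^ m) \<xi>"
  have "(norm (?\<xi> - b (cadjoint b ?\<xi>)))\<^sup>2 \<le> (norm ?\<xi>)\<^sup>2 - (norm (cadjoint b ?\<xi>))\<^sup>2"
    using landweber_step[OF bounded_clinear_cadjoint[OF b] cadjoint_contraction[OF b contr], of ?\<xi>]
    by (simp only: cadjoint_cadjoint[OF b])
  also have "\<dots> \<le> (norm ?\<xi>)\<^sup>2"
    by simp
  finally have "norm (?\<xi> - b (cadjoint b ?\<xi>)) \<le> norm ?\<xi>"
    by (rule power2_le_imp_le) simp
  with Suc show ?case
    by simp
qed simp

lemma residual_diff:
  assumes b: "bounded_clinear b"
  shows "((\<lambda>\<xi>. \<xi> - b (cadjoint b \<xi>)) ^^ m) (\<xi> - \<eta>) =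
    ((\<lambda>\<xi>. \<xi> - b (cadjoint b \<xi>)) ^^ m) \<xi> - ((\<lambda>\<xi>. \<xi> - b (cadjoint b \<xi>)) ^^ m) \<eta>"
  by (induction m)
    (simp_all add: bounded_clinear_diff[OF b] bounded_clinear_diff[OF bounded_clinear_cadjoint[OF b]])

lemma residual_range:
  assumes b: "bounded_clinear b"
  shows "((\<lambda>\<xi>. \<xi> - b (cadjoint b \<xi>)) ^^ m) (b \<zeta>) = b (((\<lambda>\<zeta>. \<zeta> - cadjoint b (b \<zeta>)) ^^ m) \<zeta>)"
  by (induction m) (simp_all add: bounded_clinear_diff[OF b])

text \<open>Split \<open>\<xi>\<close> as \<open>(\<xi> - b \<zeta>) + b \<zeta>\<close>: the
  residual is a contraction on the first part and tends to zero on the second. Only the distance to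
  the range matters; \<open>\<zeta>\<close> may be arbitrarily large.\<close>

lemma residual_eventually_small:
  assumes b: "bounded_clinear b" and contr: "\<And>\<xi>. norm (b \<xi>) \<le> norm \<xi>" and close: "norm (\<xi> - b \<zeta>) < e"
  shows "\<forall>\<^sub>F m in sequentially. norm (\<xi> - b (neumann_sum b m (cadjoint b \<xi>))) < e"
proof -
  have "(\<lambda>m. norm (b (((\<lambda>\<zeta>. \<zeta> - cadjoint b (b \<zeta>)) ^^ m) \<zeta>))) \<longlonglongrightarrow> 0"
    by (rule tendsto_norm_zero[OF landweber_tendsto_zero[OF b contr]])
  then have "\<forall>\<^sub>F m in sequentially. norm (b (((\<lambda>\<zeta>. \<zeta> - cadjoint b (b \<zeta>)) ^^ m) \<zeta>)) < e - norm (\<xi> - b \<zeta>)"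
    using close by (intro order_tendstoD) auto
  then show ?thesis
  proof eventually_elim
    case (elim m)
    let ?H = "\<lambda>\<xi>. ((\<lambda>\<xi>. \<xi> - b (cadjoint b \<xi>)) ^^ m) \<xi>"
    have "norm (?H \<xi>) = norm (?H (\<xi> - b \<zeta>) + ?H (b \<zeta>))"
      by (simp add: residual_diff[OF b])
    also have "\<dots> \<le> norm (?H (\<xi> - b \<zeta>)) + norm (?H (b \<zeta>))"
      by (rule norm_triangle_ineq)
    also have "\<dots> \<le> norm (\<xi> - b \<zeta>) + norm (?H (b \<zeta>))"
      by (intro add_right_mono residual_contraction[OF b contr])
    also have "\<dots> < e"
      using elim by (simp add: residual_range[OF b])
    finally show ?case
      by (simp add: residual_eq[OF b])
  qed
qed

text \<open>The operator \<open>1 - b* b\<close> is self-adjoint, hence so are its powers and their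
  sum. This makes \<open>b q b*\<close> self-adjoint in the final estimate.\<close>

lemma cinner_neumann_sum:
  assumes b: "bounded_clinear b"
  shows "cinner (neumann_sum b m \<xi>) \<eta> = cinner \<xi> (neumann_sum b m \<eta>)"
proof -
  let ?g = "\<lambda>\<zeta>. \<zeta> - cadjoint b (b \<zeta>)"
  have pow: "cinner ((?g ^^ j) \<xi>) \<eta> = cinner \<xi> ((?g ^^ j) \<eta>)" for j \<xi> \<eta>
  proof (induction j arbitrary: \<xi> \<eta>)
    case (Suc j)
    have "cinner ((?g ^^ Suc j) \<xi>) \<eta> = cinner ((?g ^^ j) \<xi>) (?g \<eta>)"
      by (simp add: cinner_diff_left cinner_diff_right cinner_cadjoint_left[OF b] cinner_cadjoint_right[OF b])
    also have "\<dots> = cinner \<xi> ((?g ^^ j) (?g \<eta>))"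
      by (rule Suc)
    also have "\<dots> = cinner \<xi> ((?g ^^ Suc j) \<eta>)"
      by (simp only: funpow_Suc_right o_apply)
    finally show ?case .
  qed simp
  have Suc: "neumann_sum b (Suc m) \<zeta> = neumann_sum b m \<zeta> + (?g ^^ m) \<zeta>" for m \<zeta>
    by (simp add: neumann_sum_def)
  show ?thesis
    by (induction m) (simp_all add: neumann_sum_def cinner_add_left cinner_add_right pow)
qed

lemma (in unitary_tensor) intertwiners_neumann_sum:
  assumes b: "b \<in> intertwiners tens U"
  shows "neumann_sum b m \<in> intertwiners tens U"
proof -
  let ?g = "\<lambda>\<zeta>. \<zeta> - cadjoint b (b \<zeta>)"
  have g: "?g \<in> intertwiners tens U"
    by (intro intertwiners_minus intertwiners_ident intertwiners_compose[OF intertwiners_cadjoint[OF b] b])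
  have pow: "(\<lambda>\<zeta>. (?g ^^ j) \<zeta>) \<in> intertwiners tens U" for j
  proof (induction j)
    case (Suc j)
    show ?case
      using intertwiners_compose[OF g Suc] by simp
  qed (simp add: intertwiners_ident)
  have "(\<lambda>\<zeta>. neumann_sum b m \<zeta>) \<in> intertwiners tens U"
  proof (induction m)
    case 0
    show ?case
      using intertwiners_minus[OF intertwiners_ident intertwiners_ident] by (simp add: neumann_sum_def)
  next
    case (Suc m)
    show ?case
      using intertwiners_plus[OF Suc pow[of m]] by (simp add: neumann_sum_def)
  qed
  then show ?thesis
    by simp
qed

section \<open>The weak operator topology\<close>

lemma in_weak_operator_closure_iff:
  fixes T :: "'h::chilbert_space \<Rightarrow> 'h"
  shows "T \<in> weak_operator_topology closure_of S \<longleftrightarrow> bounded_clinear T \<and>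
    (\<forall>V. open V \<longrightarrow> (\<lambda>(\<xi>, \<eta>). cinner \<xi> (T \<eta>)) \<in> V \<longrightarrow>
      (\<exists>s\<in>S. bounded_clinear s \<and> (\<lambda>(\<xi>, \<eta>). cinner \<xi> (s \<eta>)) \<in> V))"
proof -
  let ?F = "\<lambda>T (\<xi>, \<eta>). cinner \<xi> (T \<eta> :: 'h)"
  have top: "topspace weak_operator_topology = {T :: 'h \<Rightarrow> 'h. bounded_clinear T}"
    by (simp add: weak_operator_topology_def topspace_pullback_topology)
  have op: "openin weak_operator_topology V \<longleftrightarrow> (\<exists>Y. open Y \<and> V = ?F -` Y \<inter> {T. bounded_clinear T})"
    for V :: "('h \<Rightarrow> 'h) set"
    by (simp add: weak_operator_topology_def openin_pullback_topology)
  show ?thesis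
    unfolding in_closure_of top op
  proof (intro iffI conjI allI impI; (elim conjE exE)?)
    fix Y assume T: "T \<in> {T. bounded_clinear T}"
      and all: "\<forall>V. T \<in> V \<and> (\<exists>Y. open Y \<and> V = ?F -` Y \<inter> {T. bounded_clinear T}) \<longrightarrow> (\<exists>s. s \<in> S \<and> s \<in> V)"
      and Y: "open Y" "?F T \<in> Y"
    have mem: "T \<in> ?F -` Y \<inter> {T. bounded_clinear T}"
      using T Y(2) by simp
    have "\<exists>s. s \<in> S \<and> s \<in> ?F -` Y \<inter> {T. bounded_clinear T}"
      by (rule all[THEN spec, THEN mp, OF conjI[OF mem exI[of _ Y]]]) (simp add: Y(1))
    then show "\<exists>s\<in>S. bounded_clinear s \<and> ?F s \<in> Y"
      by auto
  next
    fix V Y assume all: "\<forall>V. open V \<longrightarrow> ?F T \<in> V \<longrightarrow> (\<exists>s\<in>S. bounded_clinear s \<and> ?F s \<in> V)"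
      and TV: "T \<in> V" and Y: "open Y" "V = ?F -` Y \<inter> {T. bounded_clinear T}"
    have "?F T \<in> Y"
      using TV unfolding Y(2) by simp
    then obtain s where "s \<in> S" "bounded_clinear s" "?F s \<in> Y"
      using all[THEN spec, THEN mp, OF Y(1)] by blast
    then show "\<exists>s. s \<in> S \<and> s \<in> V"
      unfolding Y(2) by auto
  qed simp_all
qed

text \<open>The operators violating the equation form a weakly open set, because it compares two
  coordinates of the product topology.\<close>

lemma weak_operator_closure_equation:
  assumes T: "T \<in> weak_operator_topology closure_of S"
    and eq: "\<And>s. s \<in> S \<Longrightarrow> cinner a (s b) = cinner c (s d)"
  shows "cinner a (T b) = cinner c (T d)"
proof (rule ccontr)
  assume neq: "cinner a (T b) \<noteq> cinner c (T d)"
  let ?V = "{g :: 'a \<times> 'a \<Rightarrow> complex. g (a, b) \<noteq> g (c, d)}"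
  have "open ?V"
    by (intro open_Collect_neq continuous_on_product_coordinates)
  moreover have "(\<lambda>(\<xi>, \<eta>). cinner \<xi> (T \<eta>)) \<in> ?V"
    using neq by simp
  ultimately obtain s where "s \<in> S" "(\<lambda>(\<xi>, \<eta>). cinner \<xi> (s \<eta>)) \<in> ?V"
    using T unfolding in_weak_operator_closure_iff by blast
  then show False
    using eq by simp
qed

text \<open>A basic open set of the product topology restricts only finitely many pairs
  \<open>(\<xi>, \<eta>)\<close>; \<open>B\<close> collects their components.\<close>

lemma in_weak_operator_closureI:
  fixes T :: "'h::chilbert_space \<Rightarrow> 'h"
  assumes T: "bounded_clinear T" and S: "\<And>s. s \<in> S \<Longrightarrow> bounded_clinear s"
    and approx: "\<And>B e. finite B \<Longrightarrow> e > 0 \<Longrightarrow>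
      \<exists>s\<in>S. \<forall>\<xi>\<in>B. \<forall>\<eta>\<in>B. cmod (cinner \<xi> (s \<eta>) - cinner \<xi> (T \<eta>)) < e"
  shows "T \<in> weak_operator_topology closure_of S"
  unfolding in_weak_operator_closure_iff
proof (intro conjI allI impI T)
  fix V :: "('h \<times> 'h \<Rightarrow> complex) set"
  let ?F = "\<lambda>s (\<xi>, \<eta>). cinner \<xi> (s \<eta> :: 'h)"
  assume "open V" "?F T \<in> V"
  then have "openin (product_topology (\<lambda>_. euclidean) UNIV) V" "?F T \<in> V"
    by (simp_all add: euclidean_product_topology)
  from product_topology_open_contains_basis[OF this]
  obtain Y where Y: "?F T \<in> PiE UNIV Y" "\<And>i. openin euclidean (Y i)"
      "finite {i. Y i \<noteq> topspace euclidean}" "PiE UNIV Y \<subseteq> V"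
    by auto
  define I where "I = {i. Y i \<noteq> UNIV}"
  have I: "finite I"
    using Y(3) by (simp add: I_def)
  have "\<exists>e>0. \<forall>w. cmod (w - ?F T i) < e \<longrightarrow> w \<in> Y i" for i
  proof -
    have "open (Y i)" "?F T i \<in> Y i"
      using Y(1) Y(2)[of i] by (simp_all add: PiE_UNIV_domain) blast
    then show ?thesis
      unfolding open_dist by (metis dist_norm)
  qed
  then obtain e where e: "\<And>i. e i > 0" "\<And>i w. cmod (w - ?F T i) < e i \<Longrightarrow> w \<in> Y i"
    by metis
  \<comment> \<open>The element 1 gives the minimum a meaning when no coordinate is
    restricted.\<close>
  define e0 where "e0 = Min (insert 1 (e ` I))"
  have e0: "e0 > 0" "\<And>i. i \<in> I \<Longrightarrow> e0 \<le> e i"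
    using I e(1) by (auto simp: e0_def)
  define B where "B = fst ` I \<union> snd ` I"
  have B: "finite B"
    using I by (simp add: B_def)
  obtain s where s: "s \<in> S" "\<And>\<xi> \<eta>. \<xi> \<in> B \<Longrightarrow> \<eta> \<in> B \<Longrightarrow> cmod (cinner \<xi> (s \<eta>) - cinner \<xi> (T \<eta>)) < e0"
    using approx[OF B e0(1)] by blast
  have "?F s i \<in> Y i" for i
  proof (cases "i \<in> I")
    case True
    obtain \<xi> \<eta> where i: "i = (\<xi>, \<eta>)" by (cases i)
    have "\<xi> \<in> B" "\<eta> \<in> B"
      using True i by (force simp: B_def)+
    then have "cmod (?F s i - ?F T i) < e i"
      using s(2)[of \<xi> \<eta>] e0(2)[OF True] by (simp add: i)
    then show ?thesis
      by (rule e(2))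
  next
    case False
    then show ?thesis
      by (simp add: I_def)
  qed
  then have "?F s \<in> PiE UNIV Y"
    by (simp add: PiE_UNIV_domain)
  then show "\<exists>s\<in>S. bounded_clinear s \<and> ?F s \<in> V"
    using Y(4) s(1) S by blast
qed

section \<open>Weak limits of intertwiners, and approximation by continuous kernels\<close>

context action_L2
begin

text \<open>Under a scalar functional on \<open>C(G)\<close> each side of the intertwining equation
  becomes, by the Riesz theorem, a matrix coefficient of the operator. Equalities of such
  coefficients survive weak limits, and functionals separate the points of
  \<open>C(G)\<close>.\<close>

lemma closure_intertwiners:
  assumes T: "T \<in> weak_operator_topology closure_of S" and S: "S \<subseteq> intertwiners tens U"
  shows "T \<in> intertwiners tens U"
  unfolding E.intertwiners_iff
proof (intro conjI allI)
  show bT: "bounded_clinear T"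
    using T unfolding in_weak_operator_closure_iff by blast
  fix \<xi> \<eta>
  let ?l = "\<lambda>s. ip (tens \<eta> 1) (U (tens (s \<xi>) 1))" and ?r = "\<lambda>s. ip (tens (cadjoint s \<eta>) 1) (U (tens \<xi> 1))"
  have "\<phi> (?l T - ?r T) = 0" if \<phi>: "bounded_clinear \<phi>" for \<phi> :: "'a \<Rightarrow> complex"
  proof -
    have "bounded_clinear (\<lambda>\<zeta>. \<phi> (ip (inv U (tens \<eta> 1)) (tens \<zeta> 1)))"
      by (rule bounded_clinear_compose[OF \<phi> bounded_clinear_compose[OF E.bounded_clinear_ip E.bounded_clinear_tens_left]])
    then obtain a where a: "\<And>\<zeta>. \<phi> (ip (inv U (tens \<eta> 1)) (tens \<zeta> 1)) = cinner a \<zeta>"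
      using riesz_representation by blast
    obtain C where C: "C > 0" "\<And>x. cmod (\<phi> x) \<le> C * norm x"
      using bounded_clinear_bound[OF \<phi>] by blast
    \<comment> \<open>In the second coefficient the vector sits in the conjugate-linear slot of
      \<open>ip\<close>. The adjoint inside and the conjugate outside \<open>\<phi>\<close> make the
      dependence linear, as the Riesz theorem requires.\<close>
    have "bounded_clinear (\<lambda>x. cnj (\<phi> (star x)))"
    proof (rule bounded_clinearI[where C = C])
      show "cmod (cnj (\<phi> (star x))) \<le> C * norm x" for x
        using C(2)[of "star x"] by (simp add: norm_star)
    qed (simp_all add: star_add star_scaleC bounded_clinear_add[OF \<phi>] bounded_clinear_scaleC[OF \<phi>])
    then have "bounded_clinear (\<lambda>\<zeta>. cnj (\<phi> (star (ip (U (tens \<xi> 1)) (tens \<zeta> 1)))))"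
      by (rule bounded_clinear_compose[OF _ bounded_clinear_compose[OF E.bounded_clinear_ip E.bounded_clinear_tens_left]])
    then obtain c where c: "\<And>\<zeta>. cnj (\<phi> (star (ip (U (tens \<xi> 1)) (tens \<zeta> 1)))) = cinner c \<zeta>"
      using riesz_representation by blast
    have c': "\<phi> (ip (tens \<zeta> 1) (U (tens \<xi> 1))) = cinner \<zeta> c" for \<zeta>
      using c[of \<zeta>] E.ip_commute[of "tens \<zeta> 1" "U (tens \<xi> 1)"] cinner_commute[of \<zeta> c]
      by (metis complex_cnj_cnj)
    have l: "\<phi> (?l s) = cinner a (s \<xi>)" for s
      using a[of "s \<xi>"] by (simp only: E.ip_inv_U)
    have r: "\<phi> (?r s) = cinner \<eta> (s c)" if "bounded_clinear s" for s
      by (simp only: c' cinner_cadjoint_left[OF that])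
    have "cinner a (T \<xi>) = cinner \<eta> (T c)"
    proof (rule weak_operator_closure_equation[OF T])
      fix s assume "s \<in> S"
      then have s: "s \<in> intertwiners tens U"
        using S by blast
      then have "?l s = ?r s" "bounded_clinear s"
        unfolding E.intertwiners_iff by blast+
      then show "cinner a (s \<xi>) = cinner \<eta> (s c)"
        using l[of s] r[of s] by simp
    qed
    then show ?thesis
      by (simp add: bounded_clinear_diff[OF \<phi>] l r[OF bT])
  qed
  then have "?l T - ?r T = 0"
    by (rule functionals_separate)
  then show "?l T = ?r T"
    by simp
qed

text \<open>\<open>\<rho>(f) \<xi>\<close> is the function
  \<open>\<langle>k x, \<xi>\<rangle>\<close> of \<open>x\<close> for the continuous family
  \<open>k\<close> of kernel vectors, and the adjoint integrates \<open>k y\<close> against its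
  argument. The sandwich thus has the kernel \<open>\<langle>k x, S (k y)\<rangle>\<close>,
  continuous for every bounded \<open>S\<close>.\<close>

lemma sandwich_kernel:
  assumes S: "bounded_clinear S"
  shows "\<exists>g. kop g = (\<lambda>\<xi>. kop f (S (cadjoint (kop f) \<xi>)))"
proof -
  let ?k = "kernel_vector f"
  define g where "g = Bcontfun (\<lambda>(x, y). cinner (?k x) (S (?k y)))"
  have k2: "continuous_on UNIV (\<lambda>z. ?k (h z))" if "continuous_on UNIV h" for h :: "'x \<times> 'x \<Rightarrow> 'x"
    by (rule continuous_on_compose2[OF continuous_kernel_vector that]) simp
  have g: "apply_bcontfun g (x, y) = cinner (?k x) (S (?k y))" for x y
  proof -
    have "compact (UNIV :: ('x \<times> 'x) set)"
      using compact_Times[OF compact compact] by simp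
    moreover have "continuous_on UNIV (\<lambda>(x, y). cinner (?k x) (S (?k y)))"
      unfolding case_prod_unfold
      by (intro bounded_bilinear.continuous_on[OF bounded_bilinear_cinner]
          bounded_linear.continuous_on[OF bounded_clinear_bounded_linear[OF S]] k2 continuous_intros)
    ultimately show ?thesis
      by (simp add: g_def apply_Bcontfun_compact)
  qed
  have "cinner (kernel_vector g x) \<xi> = cinner (?k x) (S (cadjoint (kop f) \<xi>))" for x \<xi>
  proof -
    \<comment> \<open>With \<open>S\<close> moved to the other side, the integral over
      \<open>y\<close> becomes the pairing of \<open>kop f \<omega>\<close> with
      \<open>\<xi>\<close>, so no vector-valued integral occurs.\<close>
    define \<omega> where "\<omega> = cadjoint S (?k x)"
    have "cinner (kernel_vector g x) \<xi> = (\<integral>y. cnj (cinner (?k y) \<omega>) * X.rep \<xi> y \<partial>\<mu>)"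
      unfolding cinner_kernel_vector g \<omega>_def cinner_cadjoint_right[OF S] cinner_commute[of _ "S _", symmetric] ..
    also have "\<dots> = cinner (kop f \<omega>) \<xi>"
      unfolding kernel_op_eq
      by (rule X.cinner_cls_rep[OF cinner_vector_square_integrable[OF continuous_kernel_vector], symmetric])
    also have "\<dots> = cinner (?k x) (S (cadjoint (kop f) \<xi>))"
      by (simp only: cinner_cadjoint_right[OF bounded_clinear_kernel_op, symmetric] \<omega>_def cinner_cadjoint_left[OF S])
    finally show ?thesis .
  qed
  then have "kop g = (\<lambda>\<xi>. kop f (S (cadjoint (kop f) \<xi>)))"
    unfolding fun_eq_iff kernel_op_eq by simp
  then show ?thesis
    by blast
qed

lemma kernel_op_scaleR: "kop (r *\<^sub>R f) \<xi> = r *\<^sub>R kop f \<xi>"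
proof -
  have "cinner (kernel_vector (r *\<^sub>R f) x) \<xi> = complex_of_real r * cinner (kernel_vector f x) \<xi>" for x
    by (simp add: cinner_kernel_vector scaleR_conv_of_real[where 'a = complex] mult.assoc)
  then show ?thesis
    unfolding kernel_op_eq
    by (simp add: X.cls_scaleC[OF cinner_vector_square_integrable[OF continuous_kernel_vector]] scaleC_of_real)
qed

lemma orbital_contraction_near_identity:
  assumes faithful: "faithful_borel_prob \<mu>" and iso: "isometric cls2 tn tens tens2 U"
    and B: "finite B" and e: "e > 0"
  shows "\<exists>f\<in>orb. (\<forall>\<xi>. norm (kop f \<xi>) \<le> norm \<xi>) \<and> (\<forall>\<xi>\<in>B. \<exists>\<zeta>. norm (\<xi> - kop f \<zeta>) < e)"
proof -
  obtain F where F: "\<And>n. F n \<in> orb" "\<And>\<eta>. (\<lambda>n. kop (F n) (X.incl \<eta>)) \<longlonglongrightarrow> X.incl \<eta>"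
    using approximate_unit[OF faithful iso] by blast
  have "\<exists>p. norm (\<xi> - X.incl p) < e / 2" for \<xi>
  proof -
    have span: "span (range X.incl) = range X.incl"
      unfolding linear_span_image[OF bounded_linear.linear[OF X.bounded_linear_incl]] by (simp only: span_UNIV)
    have "\<xi> \<in> closure (range X.incl)"
      using X.incl_dense[OF borel] unfolding span by (simp only: UNIV_I)
    then obtain y where "y \<in> range X.incl" "dist y \<xi> < e / 2"
      using half_gt_zero[OF e] unfolding closure_approachable by blast
    then obtain p where "dist (X.incl p) \<xi> < e / 2"
      by blast
    then show ?thesis
      by (intro exI[of _ p]) (simp add: dist_norm norm_minus_commute)
  qed
  then obtain p where p: "\<And>\<xi>. norm (\<xi> - X.incl (p \<xi>)) < e / 2"
    by metis
  have "\<forall>\<^sub>F n in sequentially. dist (kop (F n) (X.incl (p \<xi>))) (X.incl (p \<xi>)) < e / 2" for \<xi>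
    using F(2) e by (intro tendstoD) auto
  then have "\<forall>\<^sub>F n in sequentially. \<forall>\<xi>\<in>B. dist (kop (F n) (X.incl (p \<xi>))) (X.incl (p \<xi>)) < e / 2"
    using B by (intro eventually_ball_finite) auto
  then obtain n where n: "\<And>\<xi>. \<xi> \<in> B \<Longrightarrow> dist (kop (F n) (X.incl (p \<xi>))) (X.incl (p \<xi>)) < e / 2"
    unfolding eventually_sequentially by blast
  \<comment> \<open>Scaling by \<open>r\<close> gives a contraction by the sup-norm bound; the
    summand 1 covers \<open>F n = 0\<close>.\<close>
  define r where "r = inverse (norm (F n) + 1)"
  have pos: "norm (F n) + 1 > 0"
    by (simp add: add_nonneg_pos)
  then have r: "r > 0"
    by (simp add: r_def)
  have "r * norm (F n) \<le> r * (norm (F n) + 1)"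
    using r by (intro mult_left_mono) auto
  also have "\<dots> = 1"
    using pos by (simp add: r_def)
  finally have r_le: "r * norm (F n) \<le> 1" .
  show ?thesis
  proof (intro bexI[of _ "r *\<^sub>R F n"] conjI allI ballI)
    show "r *\<^sub>R F n \<in> orb"
      by (rule orb_scaleR[OF F(1)])
    show "norm (kop (r *\<^sub>R F n) \<xi>) \<le> norm \<xi>" for \<xi>
    proof -
      have "norm (kop (r *\<^sub>R F n) \<xi>) \<le> (r * norm (F n)) * norm \<xi>"
        using norm_kernel_op_le[of "r *\<^sub>R F n" \<xi>] r by simp
      also have "\<dots> \<le> 1 * norm \<xi>"
        by (intro mult_right_mono r_le) simp
      finally show ?thesis by simp
    qed
    fix \<xi> assume \<xi>: "\<xi> \<in> B"
    \<comment> \<open>The scaling is undone in the argument: a nonzero factor, however small, does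
      not change the range.\<close>
    have "kop (r *\<^sub>R F n) (inverse r *\<^sub>R X.incl (p \<xi>)) = kop (F n) (X.incl (p \<xi>))"
      using r linear_cmul[OF bounded_linear.linear[OF bounded_clinear_bounded_linear[OF bounded_clinear_kernel_op[of "F n"]]]]
      by (simp add: kernel_op_scaleR)
    moreover have "norm (\<xi> - kop (F n) (X.incl (p \<xi>))) < e"
      using n[OF \<xi>] p[of \<xi>] norm_triangle_ineq[of "\<xi> - X.incl (p \<xi>)" "X.incl (p \<xi>) - kop (F n) (X.incl (p \<xi>))"]
      by (simp add: dist_norm norm_minus_commute)
    ultimately show "\<exists>\<zeta>. norm (\<xi> - kop (r *\<^sub>R F n) \<zeta>) < e"
      by metis
  qed
qed

lemma intertwiner_approximation:
  assumes faithful: "faithful_borel_prob \<mu>" and iso: "isometric cls2 tn tens tens2 U"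
    and T: "T \<in> intertwiners tens U" and B: "finite B" and e: "e > 0"
  shows "\<exists>s\<in>kop ` orb. \<forall>\<xi>\<in>B. \<forall>\<eta>\<in>B. cmod (cinner \<xi> (s \<eta>) - cinner \<xi> (T \<eta>)) < e"
proof -
  note bT = E.intertwinersD(1)[OF T]
  obtain C where C: "C > 0" "\<And>\<xi>. norm (T \<xi>) \<le> C * norm \<xi>"
    using bounded_clinear_bound[OF bT] by blast
  define L where "L = Max (insert 0 (norm ` B)) + 1"
  have L: "norm \<xi> \<le> L" if "\<xi> \<in> B" for \<xi>
    using B that Max_ge[of "insert 0 (norm ` B)" "norm \<xi>"] by (simp add: L_def add_increasing2)
  have L1: "L \<ge> 1"
    using B Max_ge[of "insert 0 (norm ` B)" 0] by (simp add: L_def)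
  \<comment> \<open>The final error is at most
    \<open>(L + 1) C \<delta> + \<delta> C L = \<delta> (2 C L + C)\<close>, which stays within
    \<open>\<delta> (3 C L + C) \<le> e\<close>; \<open>\<delta> \<le> 1\<close> is what gives
    \<open>norm (a \<xi>) \<le> L + 1\<close>.\<close>
  define \<delta> where "\<delta> = min 1 (e / (3 * C * L + C))"
  have pos: "3 * C * L + C > 0"
    using C L1 by (simp add: add_pos_pos)
  have \<delta>: "0 < \<delta>" "\<delta> \<le> 1" "\<delta> \<le> e / (3 * C * L + C)"
    using e pos by (auto simp: \<delta>_def)
  then have \<delta>e: "\<delta> * (3 * C * L + C) \<le> e"
    using pos by (simp only: pos_le_divide_eq)
  obtain f where f: "f \<in> orb" and contr: "\<And>\<xi>. norm (kop f \<xi>) \<le> norm \<xi>"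
    and close: "\<And>\<xi>. \<xi> \<in> B \<Longrightarrow> \<exists>\<zeta>. norm (\<xi> - kop f \<zeta>) < \<delta>"
    using orbital_contraction_near_identity[OF faithful iso B \<delta>(1)] by blast
  note bb = bounded_clinear_kernel_op[of f]
  have "\<forall>\<^sub>F m in sequentially. norm (\<xi> - kop f (neumann_sum (kop f) m (cadjoint (kop f) \<xi>))) < \<delta>"
    if "\<xi> \<in> B" for \<xi>
    using close[OF that] residual_eventually_small[OF bb contr] by blast
  then have "\<forall>\<^sub>F m in sequentially. \<forall>\<xi>\<in>B. norm (\<xi> - kop f (neumann_sum (kop f) m (cadjoint (kop f) \<xi>))) < \<delta>"
    using B by (intro eventually_ball_finite) auto
  then obtain m where m: "\<And>\<xi>. \<xi> \<in> B \<Longrightarrow> norm (\<xi> - kop f (neumann_sum (kop f) m (cadjoint (kop f) \<xi>))) < \<delta>"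
    unfolding eventually_sequentially by blast
  define q where "q = neumann_sum (kop f) m"
  define a where "a \<xi> = kop f (q (cadjoint (kop f) \<xi>))" for \<xi>
  have fE: "kop f \<in> intertwiners tens U"
    using f by (simp add: orbital_iff_intertwiner)
  have qE: "q \<in> intertwiners tens U"
    unfolding q_def by (rule E.intertwiners_neumann_sum[OF fE])
  note adjE = E.intertwiners_cadjoint[OF fE]
  have a_self: "cinner (a \<xi>) \<eta> = cinner \<xi> (a \<eta>)" for \<xi> \<eta>
    by (simp add: a_def q_def cinner_neumann_sum[OF bb] cinner_cadjoint_left[OF bb] cinner_cadjoint_right[OF bb, symmetric])
  have aE: "a \<in> intertwiners tens U"
    unfolding a_def[abs_def] by (intro E.intertwiners_compose[OF fE] E.intertwiners_compose[OF qE] adjE)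
  \<comment> \<open>Chosen so that, with \<open>b = kop f\<close> and \<open>a = b q b*\<close>, the
    operator \<open>b S b*\<close> equals \<open>a T a\<close>: the outermost \<open>b\<close> and
    \<open>b*\<close> are left for \<open>sandwich_kernel\<close>, everything between them goes into
    \<open>S\<close>.\<close>
  define S where "S \<xi> = q (cadjoint (kop f) (T (kop f (q \<xi>))))" for \<xi>
  have SE: "S \<in> intertwiners tens U"
    unfolding S_def[abs_def]
    by (intro E.intertwiners_compose[OF qE] E.intertwiners_compose[OF adjE] E.intertwiners_compose[OF T]
        E.intertwiners_compose[OF fE] qE)
  obtain g where g: "kop g = (\<lambda>\<xi>. kop f (S (cadjoint (kop f) \<xi>)))"
    using sandwich_kernel[OF E.intertwinersD(1)[OF SE]] by blast
  have g': "kop g \<xi> = a (T (a \<xi>))" for \<xi>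
    by (simp add: g S_def a_def)
  have "kop g \<in> intertwiners tens U"
    unfolding g by (intro E.intertwiners_compose[OF fE] E.intertwiners_compose[OF SE] adjE)
  then have "kop g \<in> kop ` orb"
    by (simp add: orbital_iff_intertwiner)
  moreover have "cmod (cinner \<xi> (kop g \<eta>) - cinner \<xi> (T \<eta>)) < e" if "\<xi> \<in> B" "\<eta> \<in> B" for \<xi> \<eta>
  proof -
    have near: "norm (a \<xi> - \<xi>) < \<delta>" "norm (a \<eta> - \<eta>) < \<delta>"
      using m[OF that(1)] m[OF that(2)] by (simp_all add: a_def q_def norm_minus_commute)
    have a\<xi>: "norm (a \<xi>) \<le> L + 1"
      using near(1) \<delta>(2) L[OF that(1)] norm_triangle_ineq[of "a \<xi> - \<xi>" \<xi>] by simp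
    \<comment> \<open>Self-adjointness of \<open>a\<close> moves one copy to \<open>\<xi>\<close>;
      the error then splits into one term for each copy of \<open>a\<close>.\<close>
    have "cinner \<xi> (kop g \<eta>) - cinner \<xi> (T \<eta>) = cinner (a \<xi>) (T (a \<eta> - \<eta>)) + cinner (a \<xi> - \<xi>) (T \<eta>)"
      by (simp add: g' a_self[symmetric] cinner_diff_left cinner_diff_right bounded_clinear_diff[OF bT])
    also have "cmod \<dots> \<le> norm (a \<xi>) * norm (T (a \<eta> - \<eta>)) + norm (a \<xi> - \<xi>) * norm (T \<eta>)"
      by (intro order_trans[OF norm_triangle_ineq] add_mono cauchy_schwarz)
    also have "\<dots> < (L + 1) * (C * \<delta>) + \<delta> * (C * L)"
    proof (rule add_le_less_mono)
      have "norm (T (a \<eta> - \<eta>)) \<le> C * \<delta>"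
        using C(2)[of "a \<eta> - \<eta>"] mult_left_mono[OF less_imp_le[OF near(2)], of C] C(1) by linarith
      then show "norm (a \<xi>) * norm (T (a \<eta> - \<eta>)) \<le> (L + 1) * (C * \<delta>)"
        using a\<xi> L1 by (intro mult_mono) auto
      have "norm (T \<eta>) \<le> C * L"
        using C(2)[of \<eta>] mult_left_mono[OF L[OF that(2)], of C] C(1) by linarith
      then have "norm (a \<xi> - \<xi>) * norm (T \<eta>) \<le> norm (a \<xi> - \<xi>) * (C * L)"
        by (intro mult_left_mono) auto
      also have "\<dots> < \<delta> * (C * L)"
        using near(1) C(1) L1 by (intro mult_strict_right_mono) auto
      finally show "norm (a \<xi> - \<xi>) * norm (T \<eta>) < \<delta> * (C * L)" .
    qed
    also have "\<dots> \<le> \<delta> * (3 * C * L + C)"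
      using \<delta>(1) C L1 by (simp add: algebra_simps)
    also have "\<dots> \<le> e"
      by (rule \<delta>e)
    finally show ?thesis .
  qed
  ultimately show ?thesis
    by blast
qed

lemma closure_orbital_eq_intertwiners:
  assumes faithful: "faithful_borel_prob \<mu>" and iso: "isometric cls2 tn tens tens2 U"
  shows "weak_operator_topology closure_of (kop ` orb) = intertwiners tens U"
proof (intro equalityI subsetI)
  fix T assume "T \<in> weak_operator_topology closure_of (kop ` orb)"
  then show "T \<in> intertwiners tens U"
    by (rule closure_intertwiners) (auto simp: orbital_iff_intertwiner)
next
  fix T assume T: "T \<in> intertwiners tens U"
  show "T \<in> weak_operator_topology closure_of (kop ` orb)"
  proof (rule in_weak_operator_closureI[OF E.intertwinersD(1)[OF T]])
    show "bounded_clinear s" if "s \<in> kop ` orb" for s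
      using that bounded_clinear_kernel_op by blast
  qed (rule intertwiner_approximation[OF faithful iso T])
qed

end

theorem corollary2p2:
  fixes \<mu> :: "'x::metric_space measure"
    and tAA :: "'a::cstar_algebra \<Rightarrow> 'a \<Rightarrow> 'aa::cstar_algebra"
    and tAA_A :: "'aa \<Rightarrow> 'a \<Rightarrow> 'aaa::cstar_algebra"
    and tA_AA :: "'a \<Rightarrow> 'aa \<Rightarrow> 'aaa"
    and \<Delta> :: "'a \<Rightarrow> 'aa"
    and tX :: "('x \<Rightarrow>\<^sub>C complex) \<Rightarrow> 'a \<Rightarrow> 'p::cstar_algebra"
    and tXA_A :: "'p \<Rightarrow> 'a \<Rightarrow> 'q::cstar_algebra"
    and tX_AA :: "('x \<Rightarrow>\<^sub>C complex) \<Rightarrow> 'aa \<Rightarrow> 'q"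
    and \<beta> :: "('x \<Rightarrow>\<^sub>C complex) \<Rightarrow> 'p"
    and cls :: "('x \<Rightarrow> complex) \<Rightarrow> 'h::chilbert_space"
    and cls2 :: "('x \<times> 'x \<Rightarrow> complex) \<Rightarrow> 'k::chilbert_space"
    and act :: "'e::{complex_normed_vector, banach} \<Rightarrow> 'a \<Rightarrow> 'e"
    and ip :: "'e \<Rightarrow> 'e \<Rightarrow> 'a"
    and tens :: "'h \<Rightarrow> 'a \<Rightarrow> 'e"
    and act2 :: "'f::{complex_normed_vector, banach} \<Rightarrow> 'a \<Rightarrow> 'f"
    and ip2 :: "'f \<Rightarrow> 'f \<Rightarrow> 'a"
    and tens2 :: "'k \<Rightarrow> 'a \<Rightarrow> 'f"
    and U :: "'e \<Rightarrow> 'e"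
  assumes compact_X: "compact (UNIV :: 'x set)"
    and action: "quantum_action tAA tAA_A tA_AA \<Delta> tX tXA_A tX_AA \<beta>"
    and measure: "faithful_borel_prob \<mu>"
    and invariant: "invariant_measure tX \<beta> \<mu>"
    and L2: "L2_space \<mu> cls"
    and L2_prod: "L2_space (\<mu> \<Otimes>\<^sub>M \<mu>) cls2"
    and module: "hilbert_tensor act ip tens"
    and module_prod: "hilbert_tensor act2 ip2 tens2"
    and unitary: "associated_unitary tX \<beta> cls ip tens U"
    and isometric: "isometric cls2 (L2_tensor \<mu> cls cls2) tens tens2 U"
  shows "weak_operator_topology closure_of
      (kernel_op \<mu> cls `
        orbital_algebra \<mu> cls2 (L2_tensor \<mu> cls cls2) tens tens2 ip2 U)
    = intertwiners tens U"
proof -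
  have borel: "sets \<mu> = sets borel" and prob: "prob_space \<mu>"
    using measure by (auto simp: faithful_borel_prob_def)
  interpret prob: prob_space \<mu> by (rule prob)
  interpret prob2: pair_prob_space \<mu> \<mu> ..
  interpret Q: quantum_action tAA tAA_A tA_AA \<Delta> tX tXA_A tX_AA \<beta> by (rule action)
  obtain \<kappa> where U: "module_unitary ip U"
    and \<kappa>: "extends_to (\<lambda>(f, a). tX f a) (\<lambda>(f, a). tens (cls (apply_bcontfun f)) a) \<kappa>"
      "\<And>f a. U (tens (cls (apply_bcontfun f)) a) = \<kappa> (\<beta> f * tX 1 a)"
    using unitary unfolding associated_unitary_def by blast
  have meas: "apply_bcontfun p \<in> borel_measurable \<mu>" for p :: "'x \<Rightarrow>\<^sub>C complex"
    using borel_measurable_continuous_onI[OF continuous_on_apply_bcontfun[of UNIV p]]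
    by (simp cong: measurable_cong_sets add: borel)
  have "cont_L2 \<mu> cls"
    by (intro cont_L2.intro prob L2 cont_L2_axioms.intro meas)
  moreover have "cont_L2 (\<mu> \<Otimes>\<^sub>M \<mu>) cls2"
    by (intro cont_L2.intro prob2.prob_space_axioms L2_prod cont_L2_axioms.intro
        borel_measurable_pair_bcontfun compact_X borel)
  ultimately have "square_L2 \<mu> cls cls2"
    by (intro square_L2.intro square_L2_axioms.intro compact_X borel)
  moreover have "unitary_tensor act ip tens U"
    by (intro unitary_tensor.intro module unitary_tensor_axioms.intro U)
  ultimately interpret action_L2 \<mu> cls cls2 act ip tens U act2 ip2 tens2 tX \<beta> \<kappa>
    by (intro action_L2.intro module_prod Q.X.ab.min_tensor_axioms action_L2_axioms.intro
        Q.\<beta>_hom Q.podles \<kappa>)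
  show ?thesis
    by (rule closure_orbital_eq_intertwiners[OF measure isometric])
qed

end
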